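(* Let $\Lambda$ be an Artin algebra and let $\eta:\ 0\to \mathrm{X}\xrightarrow{\phi}\mathrm{Y}\xrightarrow{\psi}\mathrm{Z}\to 0$ be an almost split sequence in $\mathcal{P}(\Lambda)$. If $\mathrm{Z}$ is not isomorphic to $(P\to 0)$ for any indecomposable projective $\Lambda$-module $P$, then $$\mathrm{Cok}(\eta):\ 0\to \mathrm{Cok}(\mathrm{X})\to\mathrm{Cok}(\mathrm{Y})\to\mathrm{Cok}(\mathrm{Z})\to 0$$ is an almost split sequence in $\mathrm{mod}\text{-}\Lambda$.
   Context: $\mathrm{mod}\text{-}\Lambda$ is the category of finitely generated $\Lambda$-modules. $\mathcal{H}(\Lambda)$ is the morphism category of $\mathrm{mod}\text{-}\Lambda$: objects are morphisms $f:X\to Y$ in $\mathrm{mod}\text{-}\Lambda$, and a morphism from $(X\xrightarrow{f}Y)$ to $(X'\xrightarrow{f'}Y')$ is a pair $(\sigma_1,\sigma_2)$ with $\sigma_1:X\to X'$, $\sigma_2:Y\to Y'$ and $\sigma_2f=f'\sigma_1$. It is abelian, with exactness computed componentwise. $\mathcal{P}(\Lambda)$ is the full subcategory of $\mathcal{H}(\Lambda)$ of objects $(P\xrightarrow{f}Q)$ with $P,Q$ projective; it is extension-closed and carries the exact structure inherited from $\mathcal{H}(\Lambda)$. Almost split sequences in $\mathcal{P}(\Lambda)$ are taken with respect to this exact structure (short exact sequences whose left map is left almost split and right map is right almost split in $\mathcal{P}(\Lambda)$, with indecomposable end terms). The cokernel functor $\mathrm{Cok}:\mathcal{P}(\Lambda)\to\mathrm{mod}\text{-}\Lambda$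 sends $(P\xrightarrow{f}Q)$ to $\mathrm{Cok}(f)$, and morphisms to the induced maps on cokernels. *)

theory Defs
  imports "HOL-Algebra.Module" "HOL-Algebra.Ideal"
begin

section \<open>Artin algebras\<close>

locale artinian_cring = cring +
  assumes descending_chain:
    "(\<And>n. ideal (I n) R) \<Longrightarrow> (\<And>n. I (Suc n) \<subseteq> I n) \<Longrightarrow> \<exists>N. \<forall>n\<ge>N. I n = I N"

text \<open>The structure map \<open>\<iota>\<close> from the commutative artinian ring \<open>k\<close> into the centre of \<open>\<Lambda>\<close>
  makes \<open>\<Lambda>\<close> a \<open>k\<close>-algebra. (The locale \<^locale>\<open>algebra\<close> of the library is restricted to
  commutative algebras.)\<close>

locale artin_algebra = k?: artinian_cring k + \<Lambda>?: ring \<Lambda>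
  for k :: "'k ring" (structure) and \<Lambda> :: "'a ring" (structure) and \<iota> :: "'k \<Rightarrow> 'a" +
  assumes structure_map: "\<iota> \<in> ring_hom k \<Lambda>"
    and central: "c \<in> carrier k \<Longrightarrow> x \<in> carrier \<Lambda> \<Longrightarrow> \<iota> c \<otimes>\<^bsub>\<Lambda>\<^esub> x = x \<otimes>\<^bsub>\<Lambda>\<^esub> \<iota> c"
    and finitely_generated_algebra: "\<exists>S. finite S \<and> S \<subseteq> carrier \<Lambda> \<and>
      (\<forall>x\<in>carrier \<Lambda>. \<exists>c\<in>S \<rightarrow> carrier k. x = (\<Oplus>\<^bsub>\<Lambda>\<^esub>s\<in>S. \<iota> (c s) \<otimes>\<^bsub>\<Lambda>\<^esub> s))"

section \<open>Finitely generated right modules\<close>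

text \<open>The locale \<^locale>\<open>module\<close> of the library needs a commutative ring; only its record type is
  reused here, and the ring structure in that record (\<^const>\<open>mult\<close> and \<^const>\<open>one\<close> of the
  module) is irrelevant. The modules are right modules: \<open>r \<odot> x\<close> stands for the product usually
  written \<open>x r\<close>, whence the order of the factors in \<open>smult_assoc\<close>.\<close>

locale right_module = R?: ring R + M?: abelian_group M
  for R :: "'a ring" (structure) and M :: "('a, 'b) module" (structure) +
  assumes smult_closed [simp, intro]:
      "\<lbrakk>r \<in> carrier R; x \<in> carrier M\<rbrakk> \<Longrightarrow> r \<odot>\<^bsub>M\<^esub> x \<in> carrier M"
    and smult_l_distr: "\<lbrakk>r \<in> carrier R; s \<in> carrier R; x \<in> carrier M\<rbrakk> \<Longrightarrow>
      (r \<oplus>\<^bsub>R\<^esub> s) \<odot>\<^bsub>M\<^esub> x = r \<odot>\<^bsub>M\<^esub> x \<oplus>\<^bsub>M\<^esub> s \<odot>\<^bsub>M\<^esub> x"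
    and smult_r_distr: "\<lbrakk>r \<in> carrier R; x \<in> carrier M; y \<in> carrier M\<rbrakk> \<Longrightarrow>
      r \<odot>\<^bsub>M\<^esub> (x \<oplus>\<^bsub>M\<^esub> y) = r \<odot>\<^bsub>M\<^esub> x \<oplus>\<^bsub>M\<^esub> r \<odot>\<^bsub>M\<^esub> y"
    and smult_assoc: "\<lbrakk>r \<in> carrier R; s \<in> carrier R; x \<in> carrier M\<rbrakk> \<Longrightarrow>
      (r \<otimes>\<^bsub>R\<^esub> s) \<odot>\<^bsub>M\<^esub> x = s \<odot>\<^bsub>M\<^esub> (r \<odot>\<^bsub>M\<^esub> x)"
    and smult_one [simp]: "x \<in> carrier M \<Longrightarrow> \<one>\<^bsub>R\<^esub> \<odot>\<^bsub>M\<^esub> x = x"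

definition fg_module :: "'a ring \<Rightarrow> ('a, 'b) module \<Rightarrow> bool" where
  "fg_module R M \<longleftrightarrow> right_module R M \<and>
     (\<exists>S. finite S \<and> S \<subseteq> carrier M \<and>
       (\<forall>x\<in>carrier M. \<exists>c\<in>S \<rightarrow> carrier R. x = (\<Oplus>\<^bsub>M\<^esub>s\<in>S. c s \<odot>\<^bsub>M\<^esub> s)))"

text \<open>Homomorphisms are total functions of which only the values on the carrier matter; equality
  of homomorphisms is therefore always stated on carriers.\<close>

definition mod_hom :: "'a ring \<Rightarrow> ('a, 'b) module \<Rightarrow> ('a, 'c) module \<Rightarrow> ('b \<Rightarrow> 'c) set" where
  "mod_hom R M N = {h \<in> carrier M \<rightarrow> carrier N.
     (\<forall>x\<in>carrier M. \<forall>y\<in>carrier M. h (x \<oplus>\<^bsub>M\<^esub> y) = h x \<oplus>\<^bsub>N\<^esub> h y) \<and>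
     (\<forall>r\<in>carrier R. \<forall>x\<in>carrier M. h (r \<odot>\<^bsub>M\<^esub> x) = r \<odot>\<^bsub>N\<^esub> h x)}"

definition mod_iso :: "'a ring \<Rightarrow> ('a, 'b) module \<Rightarrow> ('a, 'c) module \<Rightarrow> bool" where
  "mod_iso R M N \<longleftrightarrow> (\<exists>h\<in>mod_hom R M N. bij_betw h (carrier M) (carrier N))"

definition mod_zero :: "('a, 'b) module \<Rightarrow> bool" where
  "mod_zero M \<longleftrightarrow> carrier M = {\<zero>\<^bsub>M\<^esub>}"

definition mod_sum :: "('a, 'b) module \<Rightarrow> ('a, 'c) module \<Rightarrow> ('a, 'b \<times> 'c) module" where
  "mod_sum M N =
     \<lparr>carrier = carrier M \<times> carrier N, mult = undefined, one = undefined,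
      zero = (\<zero>\<^bsub>M\<^esub>, \<zero>\<^bsub>N\<^esub>),
      add = (\<lambda>p q. (fst p \<oplus>\<^bsub>M\<^esub> fst q, snd p \<oplus>\<^bsub>N\<^esub> snd q)),
      smult = (\<lambda>r p. (r \<odot>\<^bsub>M\<^esub> fst p, r \<odot>\<^bsub>N\<^esub> snd p))\<rparr>"

text \<open>A definition cannot quantify over modules of all carrier types. A finitely generated module
  is a quotient of some \<open>R\<^sup>n\<close>, and so it has an isomorphic copy whose elements are sets of lists of
  ring elements (\<open>fg_module_representative\<close> and \<open>in_P_representative\<close> below). All quantifications
  over test modules and test objects in categorical notions range over this carrier type, whereas
  the given modules and objects may have any carrier type.\<close>

type_synonym 'a univ = "'a list set"

definition projective_mod :: "'a ring \<Rightarrow> ('a, 'b) module \<Rightarrow> bool" where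
  "projective_mod R P \<longleftrightarrow> fg_module R P \<and>
     (\<forall>(M :: ('a, 'a univ) module) (N :: ('a, 'a univ) module) g h.
        fg_module R M \<longrightarrow> fg_module R N \<longrightarrow> g \<in> mod_hom R M N \<longrightarrow> g ` carrier M = carrier N \<longrightarrow>
        h \<in> mod_hom R P N \<longrightarrow>
        (\<exists>l\<in>mod_hom R P M. \<forall>x\<in>carrier P. g (l x) = h x))"

definition indecomposable_mod :: "'a ring \<Rightarrow> ('a, 'b) module \<Rightarrow> bool" where
  "indecomposable_mod R M \<longleftrightarrow> fg_module R M \<and> \<not> mod_zero M \<and>
     (\<forall>(A :: ('a, 'a univ) module) (B :: ('a, 'a univ) module).
        fg_module R A \<longrightarrow> fg_module R B \<longrightarrow> mod_iso R M (mod_sum A B) \<longrightarrow>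
        mod_zero A \<or> mod_zero B)"

section \<open>Almost split sequences of modules\<close>

definition split_mono_mod ::
  "'a ring \<Rightarrow> ('a, 'b) module \<Rightarrow> ('b \<Rightarrow> 'c) \<Rightarrow> ('a, 'c) module \<Rightarrow> bool" where
  "split_mono_mod R M f N \<longleftrightarrow> (\<exists>r\<in>mod_hom R N M. \<forall>x\<in>carrier M. r (f x) = x)"

definition split_epi_mod ::
  "'a ring \<Rightarrow> ('a, 'b) module \<Rightarrow> ('b \<Rightarrow> 'c) \<Rightarrow> ('a, 'c) module \<Rightarrow> bool" where
  "split_epi_mod R M f N \<longleftrightarrow> (\<exists>s\<in>mod_hom R N M. \<forall>y\<in>carrier N. f (s y) = y)"

definition left_almost_split_mod ::
  "'a ring \<Rightarrow> ('a, 'b) module \<Rightarrow> ('b \<Rightarrow> 'c) \<Rightarrow> ('a, 'c) module \<Rightarrow> bool" where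
  "left_almost_split_mod R M f N \<longleftrightarrow> \<not> split_mono_mod R M f N \<and>
     (\<forall>W :: ('a, 'a univ) module. fg_module R W \<longrightarrow>
        (\<forall>g\<in>mod_hom R M W. \<not> split_mono_mod R M g W \<longrightarrow>
           (\<exists>h\<in>mod_hom R N W. \<forall>x\<in>carrier M. h (f x) = g x)))"

definition right_almost_split_mod ::
  "'a ring \<Rightarrow> ('a, 'b) module \<Rightarrow> ('b \<Rightarrow> 'c) \<Rightarrow> ('a, 'c) module \<Rightarrow> bool" where
  "right_almost_split_mod R M f N \<longleftrightarrow> \<not> split_epi_mod R M f N \<and>
     (\<forall>W :: ('a, 'a univ) module. fg_module R W \<longrightarrow>
        (\<forall>g\<in>mod_hom R W N. \<not> split_epi_mod R W g N \<longrightarrow>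
           (\<exists>h\<in>mod_hom R W M. \<forall>x\<in>carrier W. f (h x) = g x)))"

definition short_exact_mod ::
  "'a ring \<Rightarrow> ('a, 'b) module \<Rightarrow> ('b \<Rightarrow> 'c) \<Rightarrow> ('a, 'c) module \<Rightarrow> ('c \<Rightarrow> 'd) \<Rightarrow>
   ('a, 'd) module \<Rightarrow> bool" where
  "short_exact_mod R L f M g N \<longleftrightarrow>
     fg_module R L \<and> fg_module R M \<and> fg_module R N \<and> f \<in> mod_hom R L M \<and> g \<in> mod_hom R M N \<and>
     inj_on f (carrier L) \<and> f ` carrier L = {x \<in> carrier M. g x = \<zero>\<^bsub>N\<^esub>} \<and>
     g ` carrier M = carrier N"

definition almost_split_sequence_mod ::
  "'a ring \<Rightarrow> ('a, 'b) module \<Rightarrow> ('b \<Rightarrow> 'c) \<Rightarrow> ('a, 'c) module \<Rightarrow> ('c \<Rightarrow> 'd) \<Rightarrow>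
   ('a, 'd) module \<Rightarrow> bool" where
  "almost_split_sequence_mod R L f M g N \<longleftrightarrow> short_exact_mod R L f M g N \<and>
     left_almost_split_mod R L f M \<and> right_almost_split_mod R M g N \<and>
     indecomposable_mod R L \<and> indecomposable_mod R N"

section \<open>The morphism category\<close>

record ('a, 'b, 'c) mor_obj =
  src :: "('a, 'b) module"
  tgt :: "('a, 'c) module"
  arr :: "'b \<Rightarrow> 'c"

definition in_H :: "'a ring \<Rightarrow> ('a, 'b, 'c) mor_obj \<Rightarrow> bool" where
  "in_H R X \<longleftrightarrow> fg_module R (src X) \<and> fg_module R (tgt X) \<and> arr X \<in> mod_hom R (src X) (tgt X)"

definition in_P :: "'a ring \<Rightarrow> ('a, 'b, 'c) mor_obj \<Rightarrow> bool" where
  "in_P R X \<longleftrightarrow> in_H R X \<and> projective_mod R (src X) \<and> projective_mod R (tgt X)"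

definition mor_hom ::
  "'a ring \<Rightarrow> ('a, 'b, 'c) mor_obj \<Rightarrow> ('a, 'd, 'e) mor_obj \<Rightarrow> (('b \<Rightarrow> 'd) \<times> ('c \<Rightarrow> 'e)) set" where
  "mor_hom R X Y = {\<sigma>. fst \<sigma> \<in> mod_hom R (src X) (src Y) \<and> snd \<sigma> \<in> mod_hom R (tgt X) (tgt Y) \<and>
     (\<forall>x\<in>carrier (src X). snd \<sigma> (arr X x) = arr Y (fst \<sigma> x))}"

definition mor_comp ::
  "('d \<Rightarrow> 'f) \<times> ('e \<Rightarrow> 'g) \<Rightarrow> ('b \<Rightarrow> 'd) \<times> ('c \<Rightarrow> 'e) \<Rightarrow> ('b \<Rightarrow> 'f) \<times> ('c \<Rightarrow> 'g)" where
  "mor_comp \<tau> \<sigma> = (fst \<tau> \<circ> fst \<sigma>, snd \<tau> \<circ> snd \<sigma>)"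

definition mor_eq ::
  "('a, 'b, 'c) mor_obj \<Rightarrow> ('b \<Rightarrow> 'd) \<times> ('c \<Rightarrow> 'e) \<Rightarrow> ('b \<Rightarrow> 'd) \<times> ('c \<Rightarrow> 'e) \<Rightarrow> bool" where
  "mor_eq X \<sigma> \<tau> \<longleftrightarrow> (\<forall>x\<in>carrier (src X). fst \<sigma> x = fst \<tau> x) \<and>
     (\<forall>y\<in>carrier (tgt X). snd \<sigma> y = snd \<tau> y)"

definition mor_iso :: "'a ring \<Rightarrow> ('a, 'b, 'c) mor_obj \<Rightarrow> ('a, 'd, 'e) mor_obj \<Rightarrow> bool" where
  "mor_iso R X Y \<longleftrightarrow> (\<exists>\<sigma>\<in>mor_hom R X Y. \<exists>\<tau>\<in>mor_hom R Y X.
     mor_eq X (mor_comp \<tau> \<sigma>) (id, id) \<and> mor_eq Y (mor_comp \<sigma> \<tau>) (id, id))"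

definition mor_zero :: "('a, 'b, 'c) mor_obj \<Rightarrow> bool" where
  "mor_zero X \<longleftrightarrow> mod_zero (src X) \<and> mod_zero (tgt X)"

definition mor_sum ::
  "('a, 'b, 'c) mor_obj \<Rightarrow> ('a, 'd, 'e) mor_obj \<Rightarrow> ('a, 'b \<times> 'd, 'c \<times> 'e) mor_obj" where
  "mor_sum X Y = \<lparr>src = mod_sum (src X) (src Y), tgt = mod_sum (tgt X) (tgt Y),
     arr = map_prod (arr X) (arr Y)\<rparr>"

text \<open>The object \<open>P \<rightarrow> 0\<close>.\<close>

definition to_zero :: "('a, 'b) module \<Rightarrow> ('a, 'b, 'b) mor_obj" where
  "to_zero P = \<lparr>src = P, tgt = P\<lparr>carrier := {\<zero>\<^bsub>P\<^esub>}\<rparr>, arr = (\<lambda>_. \<zero>\<^bsub>P\<^esub>)\<rparr>"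

section \<open>Almost split sequences of morphisms between projectives\<close>

definition indecomposable_P :: "'a ring \<Rightarrow> ('a, 'b, 'c) mor_obj \<Rightarrow> bool" where
  "indecomposable_P R X \<longleftrightarrow> in_P R X \<and> \<not> mor_zero X \<and>
     (\<forall>(A :: ('a, 'a univ, 'a univ) mor_obj) (B :: ('a, 'a univ, 'a univ) mor_obj).
        in_P R A \<longrightarrow> in_P R B \<longrightarrow> mor_iso R X (mor_sum A B) \<longrightarrow> mor_zero A \<or> mor_zero B)"

definition split_mono_mor :: "'a ring \<Rightarrow> ('a, 'b, 'c) mor_obj \<Rightarrow> ('b \<Rightarrow> 'd) \<times> ('c \<Rightarrow> 'e) \<Rightarrow>
   ('a, 'd, 'e) mor_obj \<Rightarrow> bool" where
  "split_mono_mor R X \<sigma> Y \<longleftrightarrow> (\<exists>\<rho>\<in>mor_hom R Y X. mor_eq X (mor_comp \<rho> \<sigma>) (id, id))"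

definition split_epi_mor :: "'a ring \<Rightarrow> ('a, 'b, 'c) mor_obj \<Rightarrow> ('b \<Rightarrow> 'd) \<times> ('c \<Rightarrow> 'e) \<Rightarrow>
   ('a, 'd, 'e) mor_obj \<Rightarrow> bool" where
  "split_epi_mor R X \<sigma> Y \<longleftrightarrow> (\<exists>\<rho>\<in>mor_hom R Y X. mor_eq Y (mor_comp \<sigma> \<rho>) (id, id))"

definition left_almost_split_P :: "'a ring \<Rightarrow> ('a, 'b, 'c) mor_obj \<Rightarrow>
   ('b \<Rightarrow> 'd) \<times> ('c \<Rightarrow> 'e) \<Rightarrow> ('a, 'd, 'e) mor_obj \<Rightarrow> bool" where
  "left_almost_split_P R X \<sigma> Y \<longleftrightarrow> \<not> split_mono_mor R X \<sigma> Y \<and>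
     (\<forall>W :: ('a, 'a univ, 'a univ) mor_obj. in_P R W \<longrightarrow>
        (\<forall>\<tau>\<in>mor_hom R X W. \<not> split_mono_mor R X \<tau> W \<longrightarrow>
           (\<exists>\<theta>\<in>mor_hom R Y W. mor_eq X (mor_comp \<theta> \<sigma>) \<tau>)))"

definition right_almost_split_P :: "'a ring \<Rightarrow> ('a, 'b, 'c) mor_obj \<Rightarrow>
   ('b \<Rightarrow> 'd) \<times> ('c \<Rightarrow> 'e) \<Rightarrow> ('a, 'd, 'e) mor_obj \<Rightarrow> bool" where
  "right_almost_split_P R X \<sigma> Y \<longleftrightarrow> \<not> split_epi_mor R X \<sigma> Y \<and>
     (\<forall>W :: ('a, 'a univ, 'a univ) mor_obj. in_P R W \<longrightarrow>
        (\<forall>\<tau>\<in>mor_hom R W Y. \<not> split_epi_mor R W \<tau> Y \<longrightarrow>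
           (\<exists>\<theta>\<in>mor_hom R W X. mor_eq W (mor_comp \<sigma> \<theta>) \<tau>)))"

definition short_exact_P :: "'a ring \<Rightarrow> ('a, 'b, 'c) mor_obj \<Rightarrow> ('b \<Rightarrow> 'd) \<times> ('c \<Rightarrow> 'e) \<Rightarrow>
   ('a, 'd, 'e) mor_obj \<Rightarrow> ('d \<Rightarrow> 'f) \<times> ('e \<Rightarrow> 'g) \<Rightarrow> ('a, 'f, 'g) mor_obj \<Rightarrow> bool" where
  "short_exact_P R X \<phi> Y \<psi> Z \<longleftrightarrow> in_P R X \<and> in_P R Y \<and> in_P R Z \<and>
     \<phi> \<in> mor_hom R X Y \<and> \<psi> \<in> mor_hom R Y Z \<and>
     short_exact_mod R (src X) (fst \<phi>) (src Y) (fst \<psi>) (src Z) \<and>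
     short_exact_mod R (tgt X) (snd \<phi>) (tgt Y) (snd \<psi>) (tgt Z)"

definition almost_split_sequence_P :: "'a ring \<Rightarrow> ('a, 'b, 'c) mor_obj \<Rightarrow>
   ('b \<Rightarrow> 'd) \<times> ('c \<Rightarrow> 'e) \<Rightarrow> ('a, 'd, 'e) mor_obj \<Rightarrow> ('d \<Rightarrow> 'f) \<times> ('e \<Rightarrow> 'g) \<Rightarrow>
   ('a, 'f, 'g) mor_obj \<Rightarrow> bool" where
  "almost_split_sequence_P R X \<phi> Y \<psi> Z \<longleftrightarrow> short_exact_P R X \<phi> Y \<psi> Z \<and>
     left_almost_split_P R X \<phi> Y \<and> right_almost_split_P R Y \<psi> Z \<and>
     indecomposable_P R X \<and> indecomposable_P R Z"

section \<open>The cokernel functor\<close>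

definition im_arr :: "('a, 'b, 'c) mor_obj \<Rightarrow> 'c set" where
  "im_arr X = arr X ` carrier (src X)"

definition Cok :: "('a, 'b, 'c) mor_obj \<Rightarrow> ('a, 'c set) module" where
  "Cok X = (let N = tgt X; I = im_arr X in
     \<lparr>carrier = a_rcosets\<^bsub>N\<^esub> I, mult = undefined, one = undefined, zero = I,
      add = set_add N, smult = (\<lambda>r C. \<Union>y\<in>C. I +>\<^bsub>N\<^esub> (r \<odot>\<^bsub>N\<^esub> y))\<rparr>)"

text \<open>\<open>Cok_map Y \<sigma>\<close> is the map that a morphism \<open>\<sigma>\<close> from any object into \<open>Y\<close> induces between
  the cokernels; see \<open>Cok_map_coset\<close> below.\<close>

definition Cok_map ::
  "('a, 'd, 'e) mor_obj \<Rightarrow> ('b \<Rightarrow> 'd) \<times> ('c \<Rightarrow> 'e) \<Rightarrow> 'c set \<Rightarrow> 'e set" where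
  "Cok_map Y \<sigma> C = (\<Union>y\<in>C. im_arr Y +>\<^bsub>tgt Y\<^esub> snd \<sigma> y)"

section \<open>Adequacy of the definitions\<close>

lemma right_module_hom_zero:
  assumes "right_module R M" "right_module R N" "h \<in> mod_hom R M N"
  shows "h \<zero>\<^bsub>M\<^esub> = \<zero>\<^bsub>N\<^esub>"
proof -
  interpret M: right_module R M by fact
  interpret N: right_module R N by fact
  have c: "h \<zero>\<^bsub>M\<^esub> \<in> carrier N" using assms(3) by (auto simp: mod_hom_def)
  have "h (\<zero>\<^bsub>M\<^esub> \<oplus>\<^bsub>M\<^esub> \<zero>\<^bsub>M\<^esub>) = h \<zero>\<^bsub>M\<^esub> \<oplus>\<^bsub>N\<^esub> h \<zero>\<^bsub>M\<^esub>"
    using assms(3) M.M.zero_closed unfolding mod_hom_def by blast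
  then show ?thesis using c by (simp add: N.M.add.r_cancel_one')
qed

lemma mod_hom_finsum:
  assumes "right_module R M" "right_module R N" "h \<in> mod_hom R M N" "finite S"
    and "f \<in> S \<rightarrow> carrier M"
  shows "h (\<Oplus>\<^bsub>M\<^esub>s\<in>S. f s) = (\<Oplus>\<^bsub>N\<^esub>s\<in>S. h (f s))"
  using assms(4,5)
proof (induction S rule: finite_induct)
  interpret M: right_module R M by fact
  interpret N: right_module R N by fact
  case empty
  then show ?case using right_module_hom_zero[OF assms(1-3)] by simp
next
  interpret M: right_module R M by fact
  interpret N: right_module R N by fact
  case (insert s S)
  have hc: "h x \<in> carrier N" if "x \<in> carrier M" for x using assms(3) that by (auto simp: mod_hom_def)
  have f: "f s \<in> carrier M" "f \<in> S \<rightarrow> carrier M" using insert.prems by auto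
  have g: "(\<lambda>s. h (f s)) \<in> S \<rightarrow> carrier N" "h (f s) \<in> carrier N" using f hc by auto
  have "h (f s \<oplus>\<^bsub>M\<^esub> finsum M f S) = h (f s) \<oplus>\<^bsub>N\<^esub> h (finsum M f S)"
    using assms(3) f M.M.finsum_closed[of f S] unfolding mod_hom_def by blast
  then show ?case
    using insert.hyps insert.IH[OF f(2)] f g
    by (simp add: M.M.finsum_insert N.M.finsum_insert)
qed

lemma finsum_image_coefficients:
  assumes "right_module R N" "finite S" "g \<in> S \<rightarrow> carrier N" "c \<in> S \<rightarrow> carrier R"
  shows "\<exists>d\<in>g ` S \<rightarrow> carrier R. (\<Oplus>\<^bsub>N\<^esub>s\<in>S. c s \<odot>\<^bsub>N\<^esub> g s) = (\<Oplus>\<^bsub>N\<^esub>t\<in>g ` S. d t \<odot>\<^bsub>N\<^esub> t)"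
  using assms(2-)
proof (induction S rule: finite_induct)
  interpret N: right_module R N by fact
  case empty
  then show ?case by simp
next
  interpret N: right_module R N by fact
  case (insert s S)
  have g: "g s \<in> carrier N" "g \<in> S \<rightarrow> carrier N" and c: "c s \<in> carrier R" "c \<in> S \<rightarrow> carrier R"
    using insert.prems by auto
  obtain d where d: "d \<in> g ` S \<rightarrow> carrier R"
    and eq: "(\<Oplus>\<^bsub>N\<^esub>s\<in>S. c s \<odot>\<^bsub>N\<^esub> g s) = (\<Oplus>\<^bsub>N\<^esub>t\<in>g ` S. d t \<odot>\<^bsub>N\<^esub> t)"
    using insert.IH[OF g(2) c(2)] by blast
  have cg: "(\<lambda>s. c s \<odot>\<^bsub>N\<^esub> g s) \<in> S \<rightarrow> carrier N" using g c by auto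
  have lhs: "(\<Oplus>\<^bsub>N\<^esub>s\<in>insert s S. c s \<odot>\<^bsub>N\<^esub> g s) = c s \<odot>\<^bsub>N\<^esub> g s \<oplus>\<^bsub>N\<^esub> (\<Oplus>\<^bsub>N\<^esub>t\<in>g ` S. d t \<odot>\<^bsub>N\<^esub> t)"
    using insert.hyps g c cg by (simp add: N.M.finsum_insert eq)
  define U where "U = g ` S - {g s}"
  have U: "finite U" "g s \<notin> U" "U \<subseteq> g ` S" using insert.hyps by (auto simp: U_def)
  have dU: "(\<lambda>t. d t \<odot>\<^bsub>N\<^esub> t) \<in> U \<rightarrow> carrier N" using d g U by fastforce
  let ?d = "\<lambda>t. if t = g s then c s \<oplus>\<^bsub>R\<^esub> (if g s \<in> g ` S then d (g s) else \<zero>\<^bsub>R\<^esub>) else d t"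
  have d': "?d \<in> g ` insert s S \<rightarrow> carrier R" using d c by (auto simp: Pi_iff)
  have sumU: "(\<Oplus>\<^bsub>N\<^esub>t\<in>U. ?d t \<odot>\<^bsub>N\<^esub> t) = (\<Oplus>\<^bsub>N\<^esub>t\<in>U. d t \<odot>\<^bsub>N\<^esub> t)"
    by (rule N.M.finsum_cong') (use U dU in auto)
  have dU': "(\<lambda>t. ?d t \<odot>\<^bsub>N\<^esub> t) \<in> U \<rightarrow> carrier N" using dU U(2) by auto
  have im: "g ` insert s S = insert (g s) U" by (auto simp: U_def)
  have ds: "?d (g s) \<in> carrier R" using d c by auto
  have rhs: "(\<Oplus>\<^bsub>N\<^esub>t\<in>g ` insert s S. ?d t \<odot>\<^bsub>N\<^esub> t)
      = ?d (g s) \<odot>\<^bsub>N\<^esub> g s \<oplus>\<^bsub>N\<^esub> (\<Oplus>\<^bsub>N\<^esub>t\<in>U. d t \<odot>\<^bsub>N\<^esub> t)"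
    unfolding im sumU[symmetric]
    by (rule N.M.finsum_insert) (use U dU' ds g in auto)
  have Uc: "(\<Oplus>\<^bsub>N\<^esub>t\<in>U. d t \<odot>\<^bsub>N\<^esub> t) \<in> carrier N" using dU by (rule N.M.finsum_closed)
  have "c s \<odot>\<^bsub>N\<^esub> g s \<oplus>\<^bsub>N\<^esub> (\<Oplus>\<^bsub>N\<^esub>t\<in>g ` S. d t \<odot>\<^bsub>N\<^esub> t)
      = ?d (g s) \<odot>\<^bsub>N\<^esub> g s \<oplus>\<^bsub>N\<^esub> (\<Oplus>\<^bsub>N\<^esub>t\<in>U. d t \<odot>\<^bsub>N\<^esub> t)"
  proof (cases "g s \<in> g ` S")
    case True
    have dgs: "d (g s) \<in> carrier R" using d True by blast
    have "g ` S = insert (g s) U" using True by (auto simp: U_def)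
    then have "(\<Oplus>\<^bsub>N\<^esub>t\<in>g ` S. d t \<odot>\<^bsub>N\<^esub> t) = d (g s) \<odot>\<^bsub>N\<^esub> g s \<oplus>\<^bsub>N\<^esub> (\<Oplus>\<^bsub>N\<^esub>t\<in>U. d t \<odot>\<^bsub>N\<^esub> t)"
      using U dU dgs g by (simp add: N.M.finsum_insert)
    then show ?thesis
      using True Uc c g dgs by (simp add: N.smult_l_distr N.M.a_assoc)
  next
    case False
    then have "U = g ` S" by (auto simp: U_def)
    then show ?thesis using False c by simp
  qed
  then show ?case using d' lhs rhs by (intro bexI[of _ ?d]) simp_all
qed

lemma fg_module_image:
  assumes "fg_module R M" "right_module R N" "h \<in> mod_hom R M N" "h ` carrier M = carrier N"
  shows "fg_module R N"
proof -
  obtain S where M: "right_module R M" and S: "finite S" "S \<subseteq> carrier M"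
    and gen: "\<forall>x\<in>carrier M. \<exists>c\<in>S \<rightarrow> carrier R. x = (\<Oplus>\<^bsub>M\<^esub>s\<in>S. c s \<odot>\<^bsub>M\<^esub> s)"
    using assms(1) unfolding fg_module_def by blast
  interpret M: right_module R M by fact
  interpret N: right_module R N by fact
  have "\<exists>d\<in>h ` S \<rightarrow> carrier R. y = (\<Oplus>\<^bsub>N\<^esub>t\<in>h ` S. d t \<odot>\<^bsub>N\<^esub> t)" if y: "y \<in> carrier N" for y
  proof -
    obtain x where x: "x \<in> carrier M" "y = h x" using y assms(4) by blast
    obtain c where c: "c \<in> S \<rightarrow> carrier R" "x = (\<Oplus>\<^bsub>M\<^esub>s\<in>S. c s \<odot>\<^bsub>M\<^esub> s)" using gen x by blast
    have hS: "h \<in> S \<rightarrow> carrier N" using S assms(4) by blast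
    have "y = (\<Oplus>\<^bsub>N\<^esub>s\<in>S. h (c s \<odot>\<^bsub>M\<^esub> s))"
      unfolding x(2) c(2) by (rule mod_hom_finsum[OF M assms(2,3) S(1)]) (use S c in auto)
    also have "\<dots> = (\<Oplus>\<^bsub>N\<^esub>s\<in>S. c s \<odot>\<^bsub>N\<^esub> h s)"
    proof (rule N.M.finsum_cong')
      show "(\<lambda>s. c s \<odot>\<^bsub>N\<^esub> h s) \<in> S \<rightarrow> carrier N" using c(1) hS by auto
      show "h (c s \<odot>\<^bsub>M\<^esub> s) = c s \<odot>\<^bsub>N\<^esub> h s" if "s \<in> S" for s
        using that c(1) S assms(3) unfolding mod_hom_def by blast
    qed simp
    finally show ?thesis using finsum_image_coefficients[OF assms(2) S(1) hS c(1)] by simp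
  qed
  moreover have "h ` S \<subseteq> carrier N" using S assms(4) by blast
  ultimately show ?thesis
    using assms(2) S(1) unfolding fg_module_def by (intro conjI exI[of _ "h ` S"]) auto
qed

lemma right_module_surj_image:
  assumes "right_module R M" "h ` carrier M = carrier N" "\<zero>\<^bsub>N\<^esub> = h \<zero>\<^bsub>M\<^esub>"
    and "\<And>x y. x \<in> carrier M \<Longrightarrow> y \<in> carrier M \<Longrightarrow> h x \<oplus>\<^bsub>N\<^esub> h y = h (x \<oplus>\<^bsub>M\<^esub> y)"
    and "\<And>r x. r \<in> carrier R \<Longrightarrow> x \<in> carrier M \<Longrightarrow> r \<odot>\<^bsub>N\<^esub> h x = h (r \<odot>\<^bsub>M\<^esub> x)"
  shows "right_module R N \<and> h \<in> mod_hom R M N"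
proof -
  interpret M: right_module R M by fact
  have S: "\<exists>y\<in>carrier M. x = h y" if "x \<in> carrier N" for x using that assms(2) by blast
  have C: "h x \<in> carrier N" if "x \<in> carrier M" for x using that assms(2) by blast
  have "abelian_group N"
  proof (rule abelian_groupI)
    fix x y assume "x \<in> carrier N" "y \<in> carrier N"
    then show "x \<oplus>\<^bsub>N\<^esub> y \<in> carrier N" using S C by (auto dest!: S simp: assms(4))
  next
    show "\<zero>\<^bsub>N\<^esub> \<in> carrier N" using C by (simp add: assms(3))
  next
    fix x y z assume "x \<in> carrier N" "y \<in> carrier N" "z \<in> carrier N"
    then show "x \<oplus>\<^bsub>N\<^esub> y \<oplus>\<^bsub>N\<^esub> z = x \<oplus>\<^bsub>N\<^esub> (y \<oplus>\<^bsub>N\<^esub> z)"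
      by (auto dest!: S simp: assms(4) M.M.a_assoc)
  next
    fix x y assume "x \<in> carrier N" "y \<in> carrier N"
    then show "x \<oplus>\<^bsub>N\<^esub> y = y \<oplus>\<^bsub>N\<^esub> x" by (auto dest!: S simp: assms(4) M.M.a_comm)
  next
    fix x assume "x \<in> carrier N"
    then show "\<zero>\<^bsub>N\<^esub> \<oplus>\<^bsub>N\<^esub> x = x" by (auto dest!: S simp: assms(3,4))
  next
    fix x assume "x \<in> carrier N"
    then obtain u where u: "u \<in> carrier M" "x = h u" using S by blast
    then have "h (\<ominus>\<^bsub>M\<^esub> u) \<oplus>\<^bsub>N\<^esub> x = \<zero>\<^bsub>N\<^esub>" by (simp add: assms(3,4) M.M.l_neg)
    then show "\<exists>y\<in>carrier N. y \<oplus>\<^bsub>N\<^esub> x = \<zero>\<^bsub>N\<^esub>" using u C by blast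
  qed
  moreover have "right_module_axioms R N"
    by standard
      (auto dest!: S simp: assms(4,5) C M.smult_l_distr M.smult_r_distr M.smult_assoc)
  ultimately have "right_module R N"
    using M.R.ring_axioms by (simp add: right_module_def)
  then show ?thesis using C by (auto simp: mod_hom_def assms(4,5))
qed

lemma mod_hom_comp:
  "f \<in> mod_hom R L M \<Longrightarrow> g \<in> mod_hom R M N \<Longrightarrow> g \<circ> f \<in> mod_hom R L N"
  by (auto simp: mod_hom_def Pi_iff)

lemma mod_hom_inv:
  assumes "right_module R M" "right_module R N" "h \<in> mod_hom R M N"
    and "bij_betw h (carrier M) (carrier N)"
  shows "inv_into (carrier M) h \<in> mod_hom R N M"
proof -
  interpret M: right_module R M by fact
  interpret N: right_module R N by fact
  let ?i = "inv_into (carrier M) h"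
  have i: "?i y \<in> carrier M" "h (?i y) = y" if "y \<in> carrier N" for y
    using assms(4) that by (auto simp: bij_betw_def inv_into_into f_inv_into_f)
  have e: "?i (h x) = x" if "x \<in> carrier M" for x
    using assms(4) that by (simp add: bij_betw_def)
  have "?i (x \<oplus>\<^bsub>N\<^esub> y) = ?i x \<oplus>\<^bsub>M\<^esub> ?i y" if "x \<in> carrier N" "y \<in> carrier N" for x y
  proof -
    have "h (?i x \<oplus>\<^bsub>M\<^esub> ?i y) = x \<oplus>\<^bsub>N\<^esub> y" using assms(3) i that by (simp add: mod_hom_def)
    then show ?thesis using e[of "?i x \<oplus>\<^bsub>M\<^esub> ?i y"] i that by simp
  qed
  moreover have "?i (r \<odot>\<^bsub>N\<^esub> x) = r \<odot>\<^bsub>M\<^esub> ?i x" if "r \<in> carrier R" "x \<in> carrier N" for r x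
  proof -
    have "h (r \<odot>\<^bsub>M\<^esub> ?i x) = r \<odot>\<^bsub>N\<^esub> x" using assms(3) i that by (simp add: mod_hom_def)
    then show ?thesis using e[of "r \<odot>\<^bsub>M\<^esub> ?i x"] i that by simp
  qed
  ultimately show ?thesis using i by (auto simp: mod_hom_def)
qed

lemma fg_module_representative:
  fixes M :: "('a, 'b) module"
  assumes "fg_module R M"
  shows "\<exists>N :: ('a, 'a univ) module. fg_module R N \<and> mod_iso R M N"
proof -
  obtain S where M: "right_module R M" and S: "finite S" "S \<subseteq> carrier M"
    and gen: "\<forall>x\<in>carrier M. \<exists>c\<in>S \<rightarrow> carrier R. x = (\<Oplus>\<^bsub>M\<^esub>s\<in>S. c s \<odot>\<^bsub>M\<^esub> s)"
    using assms unfolding fg_module_def by blast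
  obtain xs where xs: "set xs = S" "distinct xs" using finite_distinct_list[OF S(1)] by blast
  define e :: "'b \<Rightarrow> 'a univ" where
    "e x = {map c xs | c. c \<in> S \<rightarrow> carrier R \<and> x = (\<Oplus>\<^bsub>M\<^esub>s\<in>S. c s \<odot>\<^bsub>M\<^esub> s)}" for x
  interpret M: right_module R M by fact
  have inj: "inj_on e (carrier M)"
  proof (rule inj_onI)
    fix x y assume x: "x \<in> carrier M" and y: "y \<in> carrier M" and eq: "e x = e y"
    obtain c where c: "c \<in> S \<rightarrow> carrier R" "x = (\<Oplus>\<^bsub>M\<^esub>s\<in>S. c s \<odot>\<^bsub>M\<^esub> s)" using gen x by blast
    then have "map c xs \<in> e y" unfolding eq[symmetric] unfolding e_def by blast
    then obtain d where d: "map c xs = map d xs" "y = (\<Oplus>\<^bsub>M\<^esub>s\<in>S. d s \<odot>\<^bsub>M\<^esub> s)"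
      "d \<in> S \<rightarrow> carrier R"
      unfolding e_def by blast
    have "c s = d s" if "s \<in> S" for s using d(1) that xs(1) by auto
    then have "(\<Oplus>\<^bsub>M\<^esub>s\<in>S. c s \<odot>\<^bsub>M\<^esub> s) = (\<Oplus>\<^bsub>M\<^esub>s\<in>S. d s \<odot>\<^bsub>M\<^esub> s)"
      using d(3) S by (intro M.M.finsum_cong') auto
    then show "x = y" using c d by simp
  qed
  define i where "i = inv_into (carrier M) e"
  have i: "i (e x) = x" if "x \<in> carrier M" for x using that inj by (simp add: i_def)
  define N :: "('a, 'a univ) module" where
    "N = \<lparr>carrier = e ` carrier M, mult = undefined, one = undefined, zero = e \<zero>\<^bsub>M\<^esub>,
      add = (\<lambda>a b. e (i a \<oplus>\<^bsub>M\<^esub> i b)), smult = (\<lambda>r a. e (r \<odot>\<^bsub>M\<^esub> i a))\<rparr>"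
  have N: "right_module R N \<and> e \<in> mod_hom R M N"
    by (rule right_module_surj_image[OF M]) (simp_all add: N_def i)
  moreover have im: "e ` carrier M = carrier N" by (simp add: N_def)
  ultimately have "fg_module R N" using fg_module_image[OF assms] by blast
  moreover have "mod_iso R M N" using N inj im unfolding mod_iso_def bij_betw_def by blast
  ultimately show ?thesis by blast
qed

lemma projective_mod_iso:
  fixes P :: "('a, 'b) module" and Q :: "('a, 'c) module"
  assumes "projective_mod R P" "fg_module R Q" "mod_iso R P Q"
  shows "projective_mod R Q"
  unfolding projective_mod_def
proof (intro conjI allI impI assms(2))
  fix M N :: "('a, 'a univ) module" and g h
  assume a: "fg_module R M" "fg_module R N" "g \<in> mod_hom R M N" "g ` carrier M = carrier N"
    "h \<in> mod_hom R Q N"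
  obtain t where t: "t \<in> mod_hom R P Q" "bij_betw t (carrier P) (carrier Q)"
    using assms(3) by (auto simp: mod_iso_def)
  have PQ: "right_module R P" "right_module R Q"
    using assms(1,2) by (auto simp: projective_mod_def fg_module_def)
  let ?i = "inv_into (carrier P) t"
  have i: "?i \<in> mod_hom R Q P" by (rule mod_hom_inv[OF PQ t])
  have ti: "t (?i y) = y" "?i y \<in> carrier P" if "y \<in> carrier Q" for y
    using t(2) that by (auto simp: bij_betw_def inv_into_into f_inv_into_f)
  have "h \<circ> t \<in> mod_hom R P N" using t a by (intro mod_hom_comp)
  then have "\<exists>l\<in>mod_hom R P M. \<forall>x\<in>carrier P. g (l x) = (h \<circ> t) x"
    using assms(1) a(1-4) unfolding projective_mod_def by blast
  then obtain l where l: "l \<in> mod_hom R P M" "\<forall>x\<in>carrier P. g (l x) = h (t x)" by auto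
  have "l \<circ> ?i \<in> mod_hom R Q M" using l i by (intro mod_hom_comp)
  moreover have "\<forall>x\<in>carrier Q. g ((l \<circ> ?i) x) = h x" using l ti by simp
  ultimately show "\<exists>l\<in>mod_hom R Q M. \<forall>x\<in>carrier Q. g (l x) = h x" by blast
qed

lemma in_P_representative:
  fixes X :: "('a, 'b, 'c) mor_obj"
  assumes "in_P R X"
  shows "\<exists>W :: ('a, 'a univ, 'a univ) mor_obj. in_P R W \<and> mor_iso R X W"
proof -
  have fg: "fg_module R (src X)" "fg_module R (tgt X)" and f: "arr X \<in> mod_hom R (src X) (tgt X)"
    and proj: "projective_mod R (src X)" "projective_mod R (tgt X)"
    using assms by (auto simp: in_P_def in_H_def)
  obtain P Q :: "('a, 'a univ) module" where P: "fg_module R P" "mod_iso R (src X) P"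
    and Q: "fg_module R Q" "mod_iso R (tgt X) Q"
    using fg_module_representative[OF fg(1)] fg_module_representative[OF fg(2)] by blast
  obtain s where s: "s \<in> mod_hom R (src X) P" "bij_betw s (carrier (src X)) (carrier P)"
    using P by (auto simp: mod_iso_def)
  obtain t where t: "t \<in> mod_hom R (tgt X) Q" "bij_betw t (carrier (tgt X)) (carrier Q)"
    using Q by (auto simp: mod_iso_def)
  define s' where "s' = inv_into (carrier (src X)) s"
  define t' where "t' = inv_into (carrier (tgt X)) t"
  have s': "s' \<in> mod_hom R P (src X)" and t': "t' \<in> mod_hom R Q (tgt X)"
    unfolding s'_def t'_def using fg P Q s t by (auto intro!: mod_hom_inv simp: fg_module_def)
  have ss: "\<And>x. x \<in> carrier (src X) \<Longrightarrow> s' (s x) = x" "\<And>x. x \<in> carrier P \<Longrightarrow> s (s' x) = x"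
    using s(2) by (auto simp: s'_def bij_betw_def f_inv_into_f)
  have tt: "\<And>x. x \<in> carrier (tgt X) \<Longrightarrow> t' (t x) = x" "\<And>x. x \<in> carrier Q \<Longrightarrow> t (t' x) = x"
    using t(2) by (auto simp: t'_def bij_betw_def f_inv_into_f)
  have ac: "arr X x \<in> carrier (tgt X)" if "x \<in> carrier (src X)" for x
    using f that by (auto simp: mod_hom_def)
  have sc: "s' x \<in> carrier (src X)" if "x \<in> carrier P" for x
    using s' that by (auto simp: mod_hom_def)
  define W where "W = \<lparr>src = P, tgt = Q, arr = t \<circ> arr X \<circ> s'\<rparr>"
  have "in_P R W"
    using P Q s' f t projective_mod_iso[OF proj(1) P] projective_mod_iso[OF proj(2) Q]
    by (auto simp: in_P_def in_H_def W_def intro!: mod_hom_comp)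
  moreover have "(s, t) \<in> mor_hom R X W" "(s', t') \<in> mor_hom R W X"
    using s t s' t' ss tt ac sc by (simp_all add: mor_hom_def W_def)
  then have "mor_iso R X W"
    unfolding mor_iso_def using ss tt
    by (intro bexI[of _ "(s, t)"] bexI[of _ "(s', t')"])
      (simp_all add: mor_eq_def mor_comp_def W_def)
  ultimately show ?thesis by blast
qed

lemma im_arr_subgroup:
  assumes "in_H R X"
  shows "abelian_subgroup (im_arr X) (tgt X)"
proof -
  have f: "arr X \<in> mod_hom R (src X) (tgt X)" and
    M: "right_module R (src X)" "right_module R (tgt X)"
    using assms by (auto simp: in_H_def fg_module_def)
  interpret M: right_module R "src X" by fact
  interpret N: right_module R "tgt X" by fact
  have "additive_subgroup (im_arr X) (tgt X)"
  proof (rule additive_subgroup.intro, rule subgroup.intro)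
    show "im_arr X \<subseteq> carrier (add_monoid (tgt X))" using f by (auto simp: im_arr_def mod_hom_def)
    show "x \<otimes>\<^bsub>add_monoid (tgt X)\<^esub> y \<in> im_arr X" if xy: "x \<in> im_arr X" "y \<in> im_arr X" for x y
    proof -
      obtain u v where uv: "u \<in> carrier (src X)" "v \<in> carrier (src X)"
        "x = arr X u" "y = arr X v"
        using xy unfolding im_arr_def by blast
      then have "x \<oplus>\<^bsub>tgt X\<^esub> y = arr X (u \<oplus>\<^bsub>src X\<^esub> v)" using f by (simp add: mod_hom_def)
      then show ?thesis using uv by (simp add: im_arr_def)
    qed
    show "\<one>\<^bsub>add_monoid (tgt X)\<^esub> \<in> im_arr X"
      using right_module_hom_zero[OF M f] M.M.zero_closed unfolding im_arr_def
      by (metis image_eqI monoid.select_convs(2))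
    show "inv\<^bsub>add_monoid (tgt X)\<^esub> x \<in> im_arr X" if x: "x \<in> im_arr X" for x
    proof -
      obtain u where u: "u \<in> carrier (src X)" "x = arr X u" using x by (auto simp: im_arr_def)
      have "arr X (\<ominus>\<^bsub>src X\<^esub> u) \<oplus>\<^bsub>tgt X\<^esub> x = arr X (\<ominus>\<^bsub>src X\<^esub> u \<oplus>\<^bsub>src X\<^esub> u)"
        using f u by (simp add: mod_hom_def)
      also have "\<dots> = \<zero>\<^bsub>tgt X\<^esub>" using u right_module_hom_zero[OF M f] by (simp add: M.M.l_neg)
      finally have "\<ominus>\<^bsub>tgt X\<^esub> x = arr X (\<ominus>\<^bsub>src X\<^esub> u)"
        using f u by (intro N.M.minus_equality) (auto simp: mod_hom_def)
      then show ?thesis using u by (auto simp: im_arr_def a_inv_def)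
    qed
  qed
  then show ?thesis by (rule abelian_subgroupI3) (rule N.M.abelian_group_axioms)
qed

text \<open>On cosets the operations of \<^const>\<open>Cok\<close> and the map \<^const>\<open>Cok_map\<close> are the expected ones.\<close>

lemma Cok_simps:
  assumes "in_H R X"
  shows "(\<lambda>y. im_arr X +>\<^bsub>tgt X\<^esub> y) ` carrier (tgt X) = carrier (Cok X)"
    and "\<zero>\<^bsub>Cok X\<^esub> = im_arr X +>\<^bsub>tgt X\<^esub> \<zero>\<^bsub>tgt X\<^esub>"
    and "x \<in> carrier (tgt X) \<Longrightarrow> y \<in> carrier (tgt X) \<Longrightarrow>
      (im_arr X +>\<^bsub>tgt X\<^esub> x) \<oplus>\<^bsub>Cok X\<^esub> (im_arr X +>\<^bsub>tgt X\<^esub> y)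
        = im_arr X +>\<^bsub>tgt X\<^esub> (x \<oplus>\<^bsub>tgt X\<^esub> y)"
    and "r \<in> carrier R \<Longrightarrow> x \<in> carrier (tgt X) \<Longrightarrow>
      r \<odot>\<^bsub>Cok X\<^esub> (im_arr X +>\<^bsub>tgt X\<^esub> x) = im_arr X +>\<^bsub>tgt X\<^esub> (r \<odot>\<^bsub>tgt X\<^esub> x)"
proof -
  interpret I: abelian_subgroup "im_arr X" "tgt X" by (rule im_arr_subgroup) fact
  have f: "arr X \<in> mod_hom R (src X) (tgt X)" and
    M: "right_module R (src X)" "right_module R (tgt X)"
    using assms by (auto simp: in_H_def fg_module_def)
  interpret M: right_module R "src X" by fact
  interpret N: right_module R "tgt X" by fact
  show "(\<lambda>y. im_arr X +>\<^bsub>tgt X\<^esub> y) ` carrier (tgt X) = carrier (Cok X)"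
    by (auto simp: Cok_def Let_def A_RCOSETS_def' a_r_coset_def')
  show "\<zero>\<^bsub>Cok X\<^esub> = im_arr X +>\<^bsub>tgt X\<^esub> \<zero>\<^bsub>tgt X\<^esub>"
    using I.a_subset by (simp add: Cok_def Let_def I.a_coset_add_zero)
  show "(im_arr X +>\<^bsub>tgt X\<^esub> x) \<oplus>\<^bsub>Cok X\<^esub> (im_arr X +>\<^bsub>tgt X\<^esub> y)
        = im_arr X +>\<^bsub>tgt X\<^esub> (x \<oplus>\<^bsub>tgt X\<^esub> y)"
    if "x \<in> carrier (tgt X)" "y \<in> carrier (tgt X)"
    using that by (simp add: Cok_def Let_def I.a_rcos_sum)
  show "r \<odot>\<^bsub>Cok X\<^esub> (im_arr X +>\<^bsub>tgt X\<^esub> x) = im_arr X +>\<^bsub>tgt X\<^esub> (r \<odot>\<^bsub>tgt X\<^esub> x)"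
    if r: "r \<in> carrier R" and x: "x \<in> carrier (tgt X)"
  proof -
    have "im_arr X +>\<^bsub>tgt X\<^esub> (r \<odot>\<^bsub>tgt X\<^esub> y) = im_arr X +>\<^bsub>tgt X\<^esub> (r \<odot>\<^bsub>tgt X\<^esub> x)"
      if y: "y \<in> im_arr X +>\<^bsub>tgt X\<^esub> x" for y
    proof -
      obtain u where u: "u \<in> carrier (src X)" "y = arr X u \<oplus>\<^bsub>tgt X\<^esub> x"
        using y by (auto simp: a_r_coset_def' im_arr_def)
      have au: "arr X u \<in> carrier (tgt X)" "r \<odot>\<^bsub>tgt X\<^esub> arr X u = arr X (r \<odot>\<^bsub>src X\<^esub> u)"
        using f u r by (auto simp: mod_hom_def)
      have "r \<odot>\<^bsub>tgt X\<^esub> y = arr X (r \<odot>\<^bsub>src X\<^esub> u) \<oplus>\<^bsub>tgt X\<^esub> r \<odot>\<^bsub>tgt X\<^esub> x"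
        using u r x au by (simp add: N.smult_r_distr)
      then have "r \<odot>\<^bsub>tgt X\<^esub> y \<in> im_arr X +>\<^bsub>tgt X\<^esub> (r \<odot>\<^bsub>tgt X\<^esub> x)"
        using u r by (auto simp: a_r_coset_def' im_arr_def)
      then show ?thesis using r x
        by (metis I.a_repr_independence I.a_subgroup N.smult_closed)
    qed
    moreover have "x \<in> im_arr X +>\<^bsub>tgt X\<^esub> x" using x by (rule I.a_rcos_self)
    ultimately have "(\<Union>y\<in>im_arr X +>\<^bsub>tgt X\<^esub> x. im_arr X +>\<^bsub>tgt X\<^esub> (r \<odot>\<^bsub>tgt X\<^esub> y))
        = im_arr X +>\<^bsub>tgt X\<^esub> (r \<odot>\<^bsub>tgt X\<^esub> x)"
      by (intro SUP_eq_const) blast+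
    then show ?thesis by (simp add: Cok_def Let_def)
  qed
qed

lemma Cok_fg_module:
  assumes "in_H R X"
  shows "fg_module R (Cok X)"
    and "(\<lambda>y. im_arr X +>\<^bsub>tgt X\<^esub> y) \<in> mod_hom R (tgt X) (Cok X)"
proof -
  have M: "fg_module R (tgt X)" "right_module R (tgt X)"
    using assms by (auto simp: in_H_def fg_module_def)
  have *: "right_module R (Cok X) \<and> (\<lambda>y. im_arr X +>\<^bsub>tgt X\<^esub> y) \<in> mod_hom R (tgt X) (Cok X)"
    by (rule right_module_surj_image[OF M(2)]) (simp_all add: Cok_simps[OF assms])
  then show "(\<lambda>y. im_arr X +>\<^bsub>tgt X\<^esub> y) \<in> mod_hom R (tgt X) (Cok X)" by blast
  show "fg_module R (Cok X)" using fg_module_image[OF M(1)] * Cok_simps(1)[OF assms] by blast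
qed

lemma Cok_map_coset:
  assumes "in_H R X" "in_H R Y" "\<sigma> \<in> mor_hom R X Y" "y \<in> carrier (tgt X)"
  shows "Cok_map Y \<sigma> (im_arr X +>\<^bsub>tgt X\<^esub> y) = im_arr Y +>\<^bsub>tgt Y\<^esub> snd \<sigma> y"
proof -
  interpret I: abelian_subgroup "im_arr X" "tgt X" by (rule im_arr_subgroup) fact
  interpret J: abelian_subgroup "im_arr Y" "tgt Y" by (rule im_arr_subgroup) fact
  have s: "fst \<sigma> \<in> mod_hom R (src X) (src Y)" "snd \<sigma> \<in> mod_hom R (tgt X) (tgt Y)"
    "\<And>x. x \<in> carrier (src X) \<Longrightarrow> snd \<sigma> (arr X x) = arr Y (fst \<sigma> x)"
    using assms(3) by (auto simp: mor_hom_def)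
  have f: "arr X \<in> mod_hom R (src X) (tgt X)" using assms by (auto simp: in_H_def)
  have "im_arr Y +>\<^bsub>tgt Y\<^esub> snd \<sigma> z = im_arr Y +>\<^bsub>tgt Y\<^esub> snd \<sigma> y"
    if z: "z \<in> im_arr X +>\<^bsub>tgt X\<^esub> y" for z
  proof -
    obtain u where u: "u \<in> carrier (src X)" "z = arr X u \<oplus>\<^bsub>tgt X\<^esub> y"
      using z by (auto simp: a_r_coset_def' im_arr_def)
    have "arr X u \<in> carrier (tgt X)" using f u by (auto simp: mod_hom_def)
    then have "snd \<sigma> z = arr Y (fst \<sigma> u) \<oplus>\<^bsub>tgt Y\<^esub> snd \<sigma> y"
      using s u assms(4) by (simp add: mod_hom_def)
    moreover have "fst \<sigma> u \<in> carrier (src Y)" using s(1) u by (auto simp: mod_hom_def)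
    ultimately have "snd \<sigma> z \<in> im_arr Y +>\<^bsub>tgt Y\<^esub> snd \<sigma> y"
      by (auto simp: a_r_coset_def' im_arr_def)
    moreover have "snd \<sigma> y \<in> carrier (tgt Y)" using s(2) assms(4) by (auto simp: mod_hom_def)
    ultimately show ?thesis
      by (metis J.a_repr_independence J.a_subgroup)
  qed
  moreover have "y \<in> im_arr X +>\<^bsub>tgt X\<^esub> y" using assms(4) by (rule I.a_rcos_self)
  ultimately show ?thesis unfolding Cok_map_def by (intro SUP_eq_const) blast+
qed

end

theory Submission
  imports Defs
begin

text \<open>Maps between modules lift along projective presentations, and since \<open>\<Lambda>\<close> is noetherian, every
  finitely generated module is the cokernel of an object of \<open>\<P>(\<Lambda>)\<close>. Hence the almost split
  properties pass to cokernels as soon as \<open>Cok(\<psi>)\<close> is not a split epimorphism and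
  \<open>0 \<rightarrow> Cok(X) \<rightarrow> Cok(Y) \<rightarrow> Cok(Z) \<rightarrow> 0\<close> is exact. Write \<open>Z = (Z\<^sub>1 \<rightarrow> Z\<^sub>2)\<close>. The hypothesis on \<open>Z\<close>
  means \<open>Z\<^sub>2 \<noteq> 0\<close>, so no morphism \<open>(Q \<rightarrow> 0) \<rightarrow> Z\<close> is a split epimorphism and all of them factor
  through \<open>\<psi>\<close>. With \<open>Q\<close> free this makes \<open>Ker(Y) \<rightarrow> Ker(Z)\<close> surjective, and exactness follows
  as in the snake lemma. With \<open>Q = Z\<^sub>1\<close> it shows that a section of \<open>Cok(\<psi>)\<close> could be lifted and
  corrected to a section of \<open>\<psi>\<close>. Finally, the ends of an almost split sequence are
  automatically indecomposable: the inclusions of two proper summands would both factor through the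
  right hand map and so yield a section.\<close>

section \<open>Homomorphisms and submodules\<close>

text \<open>The functor \<open>Cok\<close> is full but not faithful: an endomorphism of Z that
  induces the identity of \<open>Cok(Z)\<close> need not be invertible. The morphisms that it kills
  are the sums of one through an object \<open>(Q = Q)\<close> and one through an object
  \<open>(Q -> 0)\<close>; these are therefore the two kinds of objects that have to be lifted along
  \<open>\<psi>\<close>, and the second kind is what makes \<open>(P -> 0)\<close> exceptional. In
  the opposite direction nothing has to be corrected, since a splitting in the category of morphisms
  always descends to cokernels. Two obstacles lie outside this argument. The chain condition is
  given only for ideals of the ground ring k, so finite generation of kernels has to be derived from
  it: k is shown to be noetherian, and the property is carried over to modules finitely generated
  over k. Moreover the definitions test only modules and objects on the carrier type
  \<open>univ\<close>, while free presentations live on function types, so lifting properties are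
  transported along isomorphic copies.\<close>

lemma mod_homD:
  assumes "h \<in> mod_hom R M N"
  shows mod_hom_closed: "x \<in> carrier M \<Longrightarrow> h x \<in> carrier N"
    and mod_hom_add: "x \<in> carrier M \<Longrightarrow> y \<in> carrier M \<Longrightarrow> h (x \<oplus>\<^bsub>M\<^esub> y) = h x \<oplus>\<^bsub>N\<^esub> h y"
    and mod_hom_smult: "r \<in> carrier R \<Longrightarrow> x \<in> carrier M \<Longrightarrow> h (r \<odot>\<^bsub>M\<^esub> x) = r \<odot>\<^bsub>N\<^esub> h x"
  using assms by (auto simp: mod_hom_def)

lemma mod_homI:
  assumes "\<And>x. x \<in> carrier M \<Longrightarrow> h x \<in> carrier N"
    and "\<And>x y. x \<in> carrier M \<Longrightarrow> y \<in> carrier M \<Longrightarrow> h (x \<oplus>\<^bsub>M\<^esub> y) = h x \<oplus>\<^bsub>N\<^esub> h y"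
    and "\<And>r x. r \<in> carrier R \<Longrightarrow> x \<in> carrier M \<Longrightarrow> h (r \<odot>\<^bsub>M\<^esub> x) = r \<odot>\<^bsub>N\<^esub> h x"
  shows "h \<in> mod_hom R M N"
  using assms by (auto simp: mod_hom_def)

lemma fg_right_module: "fg_module R M \<Longrightarrow> right_module R M"
  by (simp add: fg_module_def)

context right_module
begin

lemma smult_zero_right [simp]:
  assumes "r \<in> carrier R"
  shows "r \<odot>\<^bsub>M\<^esub> \<zero>\<^bsub>M\<^esub> = \<zero>\<^bsub>M\<^esub>"
proof -
  have "r \<odot>\<^bsub>M\<^esub> \<zero>\<^bsub>M\<^esub> \<oplus>\<^bsub>M\<^esub> r \<odot>\<^bsub>M\<^esub> \<zero>\<^bsub>M\<^esub> = r \<odot>\<^bsub>M\<^esub> \<zero>\<^bsub>M\<^esub>"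
    using assms smult_r_distr[of r "\<zero>\<^bsub>M\<^esub>" "\<zero>\<^bsub>M\<^esub>"] by simp
  then show ?thesis using assms by (simp add: M.add.r_cancel_one')
qed

lemma smult_zero_left [simp]:
  assumes "x \<in> carrier M"
  shows "\<zero>\<^bsub>R\<^esub> \<odot>\<^bsub>M\<^esub> x = \<zero>\<^bsub>M\<^esub>"
proof -
  have "\<zero>\<^bsub>R\<^esub> \<odot>\<^bsub>M\<^esub> x \<oplus>\<^bsub>M\<^esub> \<zero>\<^bsub>R\<^esub> \<odot>\<^bsub>M\<^esub> x = \<zero>\<^bsub>R\<^esub> \<odot>\<^bsub>M\<^esub> x"
    using assms smult_l_distr[of "\<zero>\<^bsub>R\<^esub>" "\<zero>\<^bsub>R\<^esub>" x] by simp
  then show ?thesis using assms by (simp add: M.add.r_cancel_one')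
qed

lemma smult_minus_one:
  assumes "x \<in> carrier M"
  shows "(\<ominus>\<^bsub>R\<^esub> \<one>\<^bsub>R\<^esub>) \<odot>\<^bsub>M\<^esub> x = \<ominus>\<^bsub>M\<^esub> x"
proof -
  have "(\<ominus>\<^bsub>R\<^esub> \<one>\<^bsub>R\<^esub>) \<odot>\<^bsub>M\<^esub> x \<oplus>\<^bsub>M\<^esub> \<one>\<^bsub>R\<^esub> \<odot>\<^bsub>M\<^esub> x = \<zero>\<^bsub>M\<^esub>"
    using assms smult_l_distr[of "\<ominus>\<^bsub>R\<^esub> \<one>\<^bsub>R\<^esub>" "\<one>\<^bsub>R\<^esub>" x] by (simp add: R.l_neg)
  then show ?thesis using assms by (simp add: M.minus_equality)
qed

lemma smult_neg:
  assumes "r \<in> carrier R" "x \<in> carrier M"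
  shows "r \<odot>\<^bsub>M\<^esub> (\<ominus>\<^bsub>M\<^esub> x) = \<ominus>\<^bsub>M\<^esub> (r \<odot>\<^bsub>M\<^esub> x)"
proof -
  have "r \<odot>\<^bsub>M\<^esub> (\<ominus>\<^bsub>M\<^esub> x) \<oplus>\<^bsub>M\<^esub> r \<odot>\<^bsub>M\<^esub> x = \<zero>\<^bsub>M\<^esub>"
    using assms smult_r_distr[of r "\<ominus>\<^bsub>M\<^esub> x" x] by (simp add: M.l_neg)
  then show ?thesis using assms by (simp add: M.minus_equality)
qed

lemma minus_eq_iff:
  assumes "x \<in> carrier M" "y \<in> carrier M"
  shows "x \<ominus>\<^bsub>M\<^esub> y = \<zero>\<^bsub>M\<^esub> \<longleftrightarrow> x = y"
proof
  assume "x \<ominus>\<^bsub>M\<^esub> y = \<zero>\<^bsub>M\<^esub>"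
  then have "\<ominus>\<^bsub>M\<^esub> (\<ominus>\<^bsub>M\<^esub> y) = x" using assms by (intro M.minus_equality) (simp_all add: M.minus_eq)
  then show "x = y" using assms by simp
qed (use assms in \<open>simp add: M.minus_eq M.r_neg\<close>)

lemma minus_add_cancel:
  assumes "x \<in> carrier M" "y \<in> carrier M"
  shows "(x \<ominus>\<^bsub>M\<^esub> y) \<oplus>\<^bsub>M\<^esub> y = x"
  using assms by (simp add: M.minus_eq M.a_assoc M.l_neg)

end

lemma mod_hom_zero_neg:
  assumes "right_module R M" "right_module R N" "h \<in> mod_hom R M N"
  shows mod_hom_zero: "h \<zero>\<^bsub>M\<^esub> = \<zero>\<^bsub>N\<^esub>"
    and mod_hom_neg: "x \<in> carrier M \<Longrightarrow> h (\<ominus>\<^bsub>M\<^esub> x) = \<ominus>\<^bsub>N\<^esub> h x"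
    and mod_hom_minus: "x \<in> carrier M \<Longrightarrow> y \<in> carrier M \<Longrightarrow> h (x \<ominus>\<^bsub>M\<^esub> y) = h x \<ominus>\<^bsub>N\<^esub> h y"
proof -
  interpret M: right_module R M by fact
  interpret N: right_module R N by fact
  show "h \<zero>\<^bsub>M\<^esub> = \<zero>\<^bsub>N\<^esub>" by (rule right_module_hom_zero[OF assms])
  show neg: "h (\<ominus>\<^bsub>M\<^esub> x) = \<ominus>\<^bsub>N\<^esub> h x" if "x \<in> carrier M" for x
    using that assms(3)
    by (simp add: mod_homD[OF assms(3)] flip: M.smult_minus_one N.smult_minus_one)
  show "h (x \<ominus>\<^bsub>M\<^esub> y) = h x \<ominus>\<^bsub>N\<^esub> h y" if "x \<in> carrier M" "y \<in> carrier M"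
    using that by (simp add: M.M.minus_eq N.M.minus_eq mod_homD[OF assms(3)] neg)
qed

lemma mod_hom_id: "(\<lambda>x. x) \<in> mod_hom R M M"
  by (auto simp: mod_hom_def)

lemma mod_hom_comp': "f \<in> mod_hom R L M \<Longrightarrow> g \<in> mod_hom R M N \<Longrightarrow> (\<lambda>x. g (f x)) \<in> mod_hom R L N"
  by (auto simp: mod_hom_def Pi_iff)

lemma mod_hom_const_zero: "right_module R N \<Longrightarrow> (\<lambda>_. \<zero>\<^bsub>N\<^esub>) \<in> mod_hom R M N"
proof -
  assume "right_module R N"
  then interpret N: right_module R N .
  show ?thesis by (auto simp: mod_hom_def)
qed

lemma mod_hom_plus:
  assumes "right_module R N" "f \<in> mod_hom R M N" "g \<in> mod_hom R M N"
  shows "(\<lambda>x. f x \<oplus>\<^bsub>N\<^esub> g x) \<in> mod_hom R M N"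
proof -
  interpret N: right_module R N by fact
  show ?thesis
    by (rule mod_homI) (simp_all add: mod_homD[OF assms(2)] mod_homD[OF assms(3)]
        N.smult_r_distr N.M.a_ac)
qed

lemma mod_hom_uminus:
  assumes "right_module R N" "f \<in> mod_hom R M N"
  shows "(\<lambda>x. \<ominus>\<^bsub>N\<^esub> f x) \<in> mod_hom R M N"
proof -
  interpret N: right_module R N by fact
  show ?thesis
    by (rule mod_homI) (simp_all add: mod_homD[OF assms(2)] N.smult_neg N.M.minus_add)
qed

lemma mod_hom_diff:
  assumes "right_module R N" "f \<in> mod_hom R M N" "g \<in> mod_hom R M N"
  shows "(\<lambda>x. f x \<ominus>\<^bsub>N\<^esub> g x) \<in> mod_hom R M N"
  using mod_hom_plus[OF assms(1,2) mod_hom_uminus[OF assms(1,3)]] by (simp add: a_minus_def)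

lemma mod_hom_inj_onI:
  assumes "right_module R M" "right_module R N" "h \<in> mod_hom R M N"
    and "\<And>x. x \<in> carrier M \<Longrightarrow> h x = \<zero>\<^bsub>N\<^esub> \<Longrightarrow> x = \<zero>\<^bsub>M\<^esub>"
  shows "inj_on h (carrier M)"
proof (rule inj_onI)
  interpret M: right_module R M by fact
  interpret N: right_module R N by fact
  fix x y assume xy: "x \<in> carrier M" "y \<in> carrier M" "h x = h y"
  have "h (x \<ominus>\<^bsub>M\<^esub> y) = \<zero>\<^bsub>N\<^esub>"
    using xy by (simp add: mod_hom_minus[OF assms(1-3)] mod_homD[OF assms(3)] N.minus_eq_iff)
  then have "x \<ominus>\<^bsub>M\<^esub> y = \<zero>\<^bsub>M\<^esub>" using assms(4) xy by simp
  then show "x = y" using xy by (simp add: M.minus_eq_iff)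
qed

section \<open>Submodules and finite generation\<close>

definition submod :: "('a, 'm) ring_scheme \<Rightarrow> ('a, 'b) module \<Rightarrow> 'b set \<Rightarrow> bool" where
  "submod R M N \<longleftrightarrow> N \<subseteq> carrier M \<and> \<zero>\<^bsub>M\<^esub> \<in> N \<and>
     (\<forall>x\<in>N. \<forall>y\<in>N. x \<oplus>\<^bsub>M\<^esub> y \<in> N) \<and> (\<forall>r\<in>carrier R. \<forall>x\<in>N. r \<odot>\<^bsub>M\<^esub> x \<in> N)"

lemma submodD:
  assumes "submod R M N"
  shows submod_subset: "N \<subseteq> carrier M" and submod_carrier: "x \<in> N \<Longrightarrow> x \<in> carrier M"
    and submod_zero: "\<zero>\<^bsub>M\<^esub> \<in> N"
    and submod_add: "x \<in> N \<Longrightarrow> y \<in> N \<Longrightarrow> x \<oplus>\<^bsub>M\<^esub> y \<in> N"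
    and submod_smult: "r \<in> carrier R \<Longrightarrow> x \<in> N \<Longrightarrow> r \<odot>\<^bsub>M\<^esub> x \<in> N"
  using assms by (auto simp: submod_def)

lemma submod_inter: "submod R M A \<Longrightarrow> submod R M B \<Longrightarrow> submod R M (A \<inter> B)"
  by (auto simp: submod_def)

text \<open>Generation is expressed by minimality among submodules instead of linear combinations.
  Images, kernels and changes of the base ring are then handled by exhibiting suitable submodules,
  without rearranging finite sums.\<close>

definition gen_by :: "('a, 'm) ring_scheme \<Rightarrow> ('a, 'b) module \<Rightarrow> 'b set \<Rightarrow> 'b set \<Rightarrow> bool" where
  "gen_by R M S N \<longleftrightarrow> S \<subseteq> N \<and> (\<forall>N'. submod R M N' \<longrightarrow> S \<subseteq> N' \<longrightarrow> N \<subseteq> N')"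

definition fg_sub :: "('a, 'm) ring_scheme \<Rightarrow> ('a, 'b) module \<Rightarrow> 'b set \<Rightarrow> bool" where
  "fg_sub R M N \<longleftrightarrow> (\<exists>S. finite S \<and> gen_by R M S N)"

lemma gen_by_subset: "gen_by R M S N \<Longrightarrow> S \<subseteq> N"
  by (simp add: gen_by_def)

lemma gen_by_least: "gen_by R M S N \<Longrightarrow> submod R M A \<Longrightarrow> S \<subseteq> A \<Longrightarrow> N \<subseteq> A"
  by (simp add: gen_by_def)

lemma fg_subE:
  assumes "fg_sub R M N"
  obtains S where "finite S" "gen_by R M S N"
  using assms by (auto simp: fg_sub_def)

lemma fg_subI:
  assumes "finite S" "S \<subseteq> N" "\<And>A. submod R M A \<Longrightarrow> S \<subseteq> A \<Longrightarrow> N \<subseteq> A"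
  shows "fg_sub R M N"
  using assms by (auto simp: fg_sub_def gen_by_def)

definition noetherian_mod :: "('a, 'm) ring_scheme \<Rightarrow> ('a, 'b) module \<Rightarrow> bool" where
  "noetherian_mod R M \<longleftrightarrow> (\<forall>N. submod R M N \<longrightarrow> fg_sub R M N)"

context right_module
begin

text \<open>Negatives come from the action of \<open>-1\<close>; \<open>submod\<close> lists only
  zero, sums and scalar multiples.\<close>

lemma submod_neg:
  assumes "submod R M N" "x \<in> N"
  shows "\<ominus>\<^bsub>M\<^esub> x \<in> N"
proof -
  have "(\<ominus>\<^bsub>R\<^esub> \<one>\<^bsub>R\<^esub>) \<odot>\<^bsub>M\<^esub> x \<in> N" using assms by (simp add: submod_smult)
  then show ?thesis using assms submod_carrier[OF assms] by (simp add: smult_minus_one)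
qed

lemma submod_minus:
  assumes "submod R M N" "x \<in> N" "y \<in> N"
  shows "x \<ominus>\<^bsub>M\<^esub> y \<in> N"
  using assms by (simp add: M.minus_eq submod_neg submod_add[OF assms(1)])

lemma submod_self: "submod R M (carrier M)" by (auto simp: submod_def)

lemma submod_zero_set: "submod R M {\<zero>\<^bsub>M\<^esub>}" by (auto simp: submod_def)

lemma submod_right_module:
  assumes "submod R M N"
  shows "right_module R (M\<lparr>carrier := N\<rparr>)"
proof -
  note S = submodD[OF assms]
  have "abelian_group (M\<lparr>carrier := N\<rparr>)"
  proof (rule abelian_groupI)
    fix x assume "x \<in> carrier (M\<lparr>carrier := N\<rparr>)"
    then show "\<exists>y\<in>carrier (M\<lparr>carrier := N\<rparr>).
        y \<oplus>\<^bsub>M\<lparr>carrier := N\<rparr>\<^esub> x = \<zero>\<^bsub>M\<lparr>carrier := N\<rparr>\<^esub>"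
      using S(2) submod_neg[OF assms] by (intro bexI[of _ "\<ominus>\<^bsub>M\<^esub> x"]) (auto simp: M.l_neg)
  qed (auto simp: S(2-) M.a_assoc intro: M.a_comm)
  moreover have "right_module_axioms R (M\<lparr>carrier := N\<rparr>)"
    by standard (auto simp: S(2-) smult_l_distr smult_r_distr smult_assoc)
  ultimately show ?thesis using R.ring_axioms by (simp add: right_module_def)
qed

lemma submod_finsum:
  assumes "submod R M N" "finite S" "f \<in> S \<rightarrow> N"
  shows "(\<Oplus>\<^bsub>M\<^esub>s\<in>S. f s) \<in> N"
  using assms(2,3)
proof (induction S)
  case empty
  then show ?case using submod_zero[OF assms(1)] by simp
next
  case (insert s S)
  then have "f \<in> insert s S \<rightarrow> carrier M" using submod_subset[OF assms(1)] by auto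
  then show ?case using insert submod_add[OF assms(1)] by (simp add: M.finsum_insert)
qed

lemma smult_finsum:
  assumes "finite S" "f \<in> S \<rightarrow> carrier M" "r \<in> carrier R"
  shows "r \<odot>\<^bsub>M\<^esub> (\<Oplus>\<^bsub>M\<^esub>s\<in>S. f s) = (\<Oplus>\<^bsub>M\<^esub>s\<in>S. r \<odot>\<^bsub>M\<^esub> f s)"
  using assms(1,2)
proof (induction S)
  case empty
  then show ?case using assms(3) by simp
next
  case (insert s S)
  then have f: "f s \<in> carrier M" "f \<in> S \<rightarrow> carrier M" by auto
  then have "(\<lambda>s. r \<odot>\<^bsub>M\<^esub> f s) \<in> S \<rightarrow> carrier M" using assms(3) by auto
  with insert f assms(3) show ?case
    by (simp add: M.finsum_insert smult_r_distr)
qed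

lemma lin_comb_submod:
  assumes S: "finite S" "v \<in> S \<rightarrow> carrier M"
  shows "submod R M {x. \<exists>c\<in>S \<rightarrow> carrier R. x = (\<Oplus>\<^bsub>M\<^esub>s\<in>S. c s \<odot>\<^bsub>M\<^esub> v s)}" (is "submod R M ?N")
proof -
  have cl: "(\<lambda>s. c s \<odot>\<^bsub>M\<^esub> v s) \<in> S \<rightarrow> carrier M" if "c \<in> S \<rightarrow> carrier R" for c
    using that S by auto
  show ?thesis unfolding submod_def
  proof (intro conjI ballI subsetI)
    fix x assume "x \<in> ?N" then show "x \<in> carrier M" using cl by auto
  next
    have "(\<Oplus>\<^bsub>M\<^esub>s\<in>S. \<zero>\<^bsub>R\<^esub> \<odot>\<^bsub>M\<^esub> v s) = (\<Oplus>\<^bsub>M\<^esub>s\<in>S. \<zero>\<^bsub>M\<^esub>)"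
      by (rule M.finsum_cong') (use S in \<open>auto simp: Pi_iff\<close>)
    then show "\<zero>\<^bsub>M\<^esub> \<in> ?N" by (auto intro!: bexI[of _ "\<lambda>_. \<zero>\<^bsub>R\<^esub>"])
  next
    fix x y assume "x \<in> ?N" "y \<in> ?N"
    then obtain c d where c: "c \<in> S \<rightarrow> carrier R" "x = (\<Oplus>\<^bsub>M\<^esub>s\<in>S. c s \<odot>\<^bsub>M\<^esub> v s)"
      and d: "d \<in> S \<rightarrow> carrier R" "y = (\<Oplus>\<^bsub>M\<^esub>s\<in>S. d s \<odot>\<^bsub>M\<^esub> v s)" by blast
    have "x \<oplus>\<^bsub>M\<^esub> y = (\<Oplus>\<^bsub>M\<^esub>s\<in>S. c s \<odot>\<^bsub>M\<^esub> v s \<oplus>\<^bsub>M\<^esub> d s \<odot>\<^bsub>M\<^esub> v s)"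
      using cl[OF c(1)] cl[OF d(1)] c(2) d(2) by (simp add: M.finsum_addf)
    also have "\<dots> = (\<Oplus>\<^bsub>M\<^esub>s\<in>S. (c s \<oplus>\<^bsub>R\<^esub> d s) \<odot>\<^bsub>M\<^esub> v s)"
      by (rule M.finsum_cong') (use S c d in \<open>auto simp: smult_l_distr Pi_iff\<close>)
    finally show "x \<oplus>\<^bsub>M\<^esub> y \<in> ?N" using c d by (auto intro!: bexI[of _ "\<lambda>s. c s \<oplus>\<^bsub>R\<^esub> d s"])
  next
    fix r x assume r: "r \<in> carrier R" and "x \<in> ?N"
    then obtain c where c: "c \<in> S \<rightarrow> carrier R" "x = (\<Oplus>\<^bsub>M\<^esub>s\<in>S. c s \<odot>\<^bsub>M\<^esub> v s)" by blast
    have "r \<odot>\<^bsub>M\<^esub> x = (\<Oplus>\<^bsub>M\<^esub>s\<in>S. r \<odot>\<^bsub>M\<^esub> (c s \<odot>\<^bsub>M\<^esub> v s))"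
      unfolding c(2) by (rule smult_finsum[OF S(1) cl[OF c(1)] r])
    also have "\<dots> = (\<Oplus>\<^bsub>M\<^esub>s\<in>S. (c s \<otimes>\<^bsub>R\<^esub> r) \<odot>\<^bsub>M\<^esub> v s)"
      by (rule M.finsum_cong') (use S c r in \<open>auto simp: smult_assoc Pi_iff\<close>)
    finally show "r \<odot>\<^bsub>M\<^esub> x \<in> ?N"
      using c r by (auto intro!: bexI[of _ "\<lambda>s. c s \<otimes>\<^bsub>R\<^esub> r"])
  qed
qed

lemma finsum_delta:
  assumes "finite S" "v \<in> S \<rightarrow> carrier M" "t \<in> S"
  shows "(\<Oplus>\<^bsub>M\<^esub>s\<in>S. (if s = t then \<one>\<^bsub>R\<^esub> else \<zero>\<^bsub>R\<^esub>) \<odot>\<^bsub>M\<^esub> v s) = v t"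
proof -
  have "(\<Oplus>\<^bsub>M\<^esub>s\<in>S. (if s = t then \<one>\<^bsub>R\<^esub> else \<zero>\<^bsub>R\<^esub>) \<odot>\<^bsub>M\<^esub> v s)
      = (\<Oplus>\<^bsub>M\<^esub>s\<in>S. if t = s then v s else \<zero>\<^bsub>M\<^esub>)"
    by (rule M.finsum_cong') (use assms in \<open>auto simp: Pi_iff\<close>)
  then show ?thesis using assms by (simp add: M.finsum_singleton)
qed

end

text \<open>The linear combinations of \<open>S\<close> form a submodule containing \<open>S\<close>
  (coefficients that are one at a single place and zero elsewhere), so minimality makes it
  everything. Conversely, every submodule containing \<open>S\<close> contains these
  combinations.\<close>

lemma fg_module_iff:
  "fg_module R M \<longleftrightarrow> right_module R M \<and> fg_sub R M (carrier M)"
proof (intro iffI conjI)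
  assume *: "fg_module R M"
  then show "right_module R M" by (rule fg_right_module)
  then interpret right_module R M .
  obtain S where S: "finite S" "S \<subseteq> carrier M"
    and gen: "\<forall>x\<in>carrier M. \<exists>c\<in>S \<rightarrow> carrier R. x = (\<Oplus>\<^bsub>M\<^esub>s\<in>S. c s \<odot>\<^bsub>M\<^esub> s)"
    using * unfolding fg_module_def by blast
  have "carrier M \<subseteq> N" if N: "submod R M N" "S \<subseteq> N" for N
  proof
    fix x assume "x \<in> carrier M"
    then obtain c where c: "c \<in> S \<rightarrow> carrier R" "x = (\<Oplus>\<^bsub>M\<^esub>s\<in>S. c s \<odot>\<^bsub>M\<^esub> s)" using gen by blast
    have "(\<lambda>s. c s \<odot>\<^bsub>M\<^esub> s) \<in> S \<rightarrow> N" using N(2) c(1) submod_smult[OF N(1)] by blast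
    then show "x \<in> N" unfolding c(2) by (rule submod_finsum[OF N(1) S(1)])
  qed
  with S show "fg_sub R M (carrier M)" unfolding fg_sub_def gen_by_def by blast
next
  assume *: "right_module R M \<and> fg_sub R M (carrier M)"
  then interpret right_module R M by blast
  obtain S where S: "finite S" "S \<subseteq> carrier M"
    and gen: "\<forall>N. submod R M N \<longrightarrow> S \<subseteq> N \<longrightarrow> carrier M \<subseteq> N"
    using * unfolding fg_sub_def gen_by_def by blast
  let ?N = "{x. \<exists>c\<in>S \<rightarrow> carrier R. x = (\<Oplus>\<^bsub>M\<^esub>s\<in>S. c s \<odot>\<^bsub>M\<^esub> s)}"
  have "submod R M ?N" using S lin_comb_submod[of S "\<lambda>s. s"] by auto
  moreover have "S \<subseteq> ?N"
  proof
    fix t assume "t \<in> S"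
    then have "t = (\<Oplus>\<^bsub>M\<^esub>s\<in>S. (if s = t then \<one>\<^bsub>R\<^esub> else \<zero>\<^bsub>R\<^esub>) \<odot>\<^bsub>M\<^esub> s)"
      using S by (intro finsum_delta[of S "\<lambda>s. s" t, symmetric]) auto
    then show "t \<in> ?N" by (auto intro!: bexI[of _ "\<lambda>s. if s = t then \<one>\<^bsub>R\<^esub> else \<zero>\<^bsub>R\<^esub>"])
  qed
  ultimately have "carrier M \<subseteq> ?N" using gen by blast
  then show "fg_module R M" unfolding fg_module_def using * S by blast
qed

lemma fg_sub_fg_module:
  assumes "right_module R M" "submod R M N" "fg_sub R M N"
  shows "fg_module R (M\<lparr>carrier := N\<rparr>)"
proof -
  interpret right_module R M by fact
  have "submod R M N'" if "submod R (M\<lparr>carrier := N\<rparr>) N'" for N'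
    using that submod_subset[OF assms(2)] by (auto simp: submod_def)
  then have "fg_sub R (M\<lparr>carrier := N\<rparr>) N"
    using assms(3) by (metis fg_sub_def gen_by_def)
  then show ?thesis using submod_right_module[OF assms(2)] by (simp add: fg_module_iff)
qed

lemma submod_image:
  assumes "right_module R M" "right_module R N" "h \<in> mod_hom R M N" "submod R M A"
  shows "submod R N (h ` A)"
proof -
  note A = submodD[OF assms(4)]
  show ?thesis unfolding submod_def
  proof (intro conjI ballI)
    show "h ` A \<subseteq> carrier N" using A(2) by (auto intro: mod_hom_closed[OF assms(3)])
    show "\<zero>\<^bsub>N\<^esub> \<in> h ` A" using imageI[OF A(3), of h] by (simp add: mod_hom_zero[OF assms(1-3)])
  next
    fix x y assume "x \<in> h ` A" "y \<in> h ` A"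
    then obtain a b where ab: "a \<in> A" "b \<in> A" "x = h a" "y = h b" by blast
    then have "x \<oplus>\<^bsub>N\<^esub> y = h (a \<oplus>\<^bsub>M\<^esub> b)" using A(2) by (simp add: mod_hom_add[OF assms(3)])
    then show "x \<oplus>\<^bsub>N\<^esub> y \<in> h ` A" using A(4)[OF ab(1,2)] by simp
  next
    fix r x assume r: "r \<in> carrier R" "x \<in> h ` A"
    then obtain a where a: "a \<in> A" "x = h a" by blast
    then have "r \<odot>\<^bsub>N\<^esub> x = h (r \<odot>\<^bsub>M\<^esub> a)" using A(2) r by (simp add: mod_hom_smult[OF assms(3)])
    then show "r \<odot>\<^bsub>N\<^esub> x \<in> h ` A" using A(5)[OF r(1) a(1)] by simp
  qed
qed

lemma submod_kernel:
  assumes "right_module R M" "right_module R N" "h \<in> mod_hom R M N"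
  shows "submod R M {x \<in> carrier M. h x = \<zero>\<^bsub>N\<^esub>}"
proof -
  interpret M: right_module R M by fact
  interpret N: right_module R N by fact
  show ?thesis
    by (auto simp: submod_def mod_homD[OF assms(3)] mod_hom_zero[OF assms])
qed

text \<open>Generators of the kernel part together with preimages in \<open>N\<close> of generators
  of the image generate \<open>N\<close>, because two elements of \<open>N\<close> with the same
  image differ by an element of the kernel part.\<close>

lemma fg_sub_extension:
  assumes "right_module R M" "right_module R L" "h \<in> mod_hom R M L" "submod R M N"
    and "fg_sub R L (h ` N)" "fg_sub R M (N \<inter> {x \<in> carrier M. h x = \<zero>\<^bsub>L\<^esub>})"
  shows "fg_sub R M N"
proof -
  interpret M: right_module R M by fact
  interpret L: right_module R L by fact
  note N = submodD[OF assms(4)]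
  obtain T where T0: "finite T" "gen_by R L T (h ` N)" by (rule fg_subE[OF assms(5)])
  note T = T0(1) gen_by_subset[OF T0(2)] gen_by_least[OF T0(2)]
  obtain S where S0: "finite S" "gen_by R M S (N \<inter> {x \<in> carrier M. h x = \<zero>\<^bsub>L\<^esub>})"
    by (rule fg_subE[OF assms(6)])
  note S = S0(1) gen_by_subset[OF S0(2)] gen_by_least[OF S0(2)]
  obtain T' where T': "finite T'" "T' \<subseteq> N" "h ` T' = T"
    using finite_subset_image[OF T(1,2)] by blast
  have "N \<subseteq> A" if A: "submod R M A" "S \<union> T' \<subseteq> A" for A
  proof
    fix x assume x: "x \<in> N"
    \<comment> \<open>Working with \<open>A \<inter> N\<close> instead of \<open>A\<close> makes the
      chosen \<open>y\<close> lie in \<open>N\<close>, so that \<open>x - y\<close> stays in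
      \<open>N\<close> and falls into the kernel part.\<close>
    have AN: "submod R M (A \<inter> N)" by (rule submod_inter[OF A(1) assms(4)])
    have "T \<subseteq> h ` (A \<inter> N)" using T' A by blast
    with T(3)[OF submod_image[OF assms(1-3) AN]] have "h ` N \<subseteq> h ` (A \<inter> N)" by blast
    with x obtain y where y: "y \<in> A" "y \<in> N" "h x = h y" by blast
    have xy: "x \<in> carrier M" "y \<in> carrier M" using x y N(2) by auto
    then have "h (x \<ominus>\<^bsub>M\<^esub> y) = \<zero>\<^bsub>L\<^esub>"
      using y(3) by (simp add: mod_hom_minus[OF assms(1-3)] mod_homD[OF assms(3)] L.minus_eq_iff)
    moreover have "x \<ominus>\<^bsub>M\<^esub> y \<in> N" using x y(2) M.submod_minus[OF assms(4)] by blast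
    ultimately have "x \<ominus>\<^bsub>M\<^esub> y \<in> A" using S(3)[OF A(1)] A(2) xy by auto
    then have "(x \<ominus>\<^bsub>M\<^esub> y) \<oplus>\<^bsub>M\<^esub> y \<in> A" using y(1) submod_add[OF A(1)] by blast
    then show "x \<in> A" using xy by (simp add: M.minus_add_cancel)
  qed
  with S(1,2) T'(1,2) show ?thesis by (intro fg_subI[of "S \<union> T'"]) simp_all
qed

section \<open>Submodules of finitely generated modules over Artin algebras\<close>

definition reg_mod :: "'a ring \<Rightarrow> ('a, 'a) module" where
  "reg_mod R = \<lparr>carrier = carrier R, mult = undefined, one = undefined, zero = \<zero>\<^bsub>R\<^esub>,
     add = (\<lambda>x y. x \<oplus>\<^bsub>R\<^esub> y), smult = (\<lambda>r x. x \<otimes>\<^bsub>R\<^esub> r)\<rparr>"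

lemma reg_mod_simps [simp]:
  "carrier (reg_mod R) = carrier R" "\<zero>\<^bsub>reg_mod R\<^esub> = \<zero>\<^bsub>R\<^esub>"
  "x \<oplus>\<^bsub>reg_mod R\<^esub> y = x \<oplus>\<^bsub>R\<^esub> y" "r \<odot>\<^bsub>reg_mod R\<^esub> x = x \<otimes>\<^bsub>R\<^esub> r"
  by (simp_all add: reg_mod_def)

definition restrict_scalars :: "('k \<Rightarrow> 'a) \<Rightarrow> ('a, 'b) module \<Rightarrow> ('k, 'b) module" where
  "restrict_scalars i M = \<lparr>carrier = carrier M, mult = undefined, one = undefined, zero = \<zero>\<^bsub>M\<^esub>,
     add = (\<lambda>x y. x \<oplus>\<^bsub>M\<^esub> y), smult = (\<lambda>c x. i c \<odot>\<^bsub>M\<^esub> x)\<rparr>"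

lemma restrict_scalars_simps [simp]:
  "carrier (restrict_scalars i M) = carrier M" "\<zero>\<^bsub>restrict_scalars i M\<^esub> = \<zero>\<^bsub>M\<^esub>"
  "x \<oplus>\<^bsub>restrict_scalars i M\<^esub> y = x \<oplus>\<^bsub>M\<^esub> y" "c \<odot>\<^bsub>restrict_scalars i M\<^esub> x = i c \<odot>\<^bsub>M\<^esub> x"
  by (simp_all add: restrict_scalars_def)

text \<open>The records built here leave \<open>mult\<close> and \<open>one\<close> undefined and so
  differ from the original ones, but being an abelian group depends on the three listed fields
  only.\<close>

lemma abelian_group_cong:
  assumes "abelian_group M" "carrier N = carrier M" "zero N = zero M" "add N = add M"
  shows "abelian_group N"
proof -
  interpret abelian_group M by fact
  show ?thesis
    by (rule abelian_groupI) (auto simp: assms(2-) a_assoc intro: a_comm l_neg)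
qed

lemma reg_mod_right_module: "ring R \<Longrightarrow> right_module R (reg_mod R)"
proof -
  assume "ring R"
  then interpret ring R .
  have "abelian_group (reg_mod R)"
    by (rule abelian_group_cong[OF abelian_group_axioms]) (simp_all add: reg_mod_def)
  moreover have "right_module_axioms R (reg_mod R)"
    by standard (simp_all add: r_distr l_distr m_assoc)
  ultimately show ?thesis using ring_axioms by (simp add: right_module_def)
qed

lemma restrict_scalars_right_module:
  assumes "ring k" "i \<in> ring_hom k R" "right_module R M"
  shows "right_module k (restrict_scalars i M)"
proof -
  interpret M: right_module R M by fact
  interpret k: ring k by fact
  have "abelian_group (restrict_scalars i M)"
    by (rule abelian_group_cong[OF M.M.abelian_group_axioms]) (simp_all add: restrict_scalars_def)
  moreover have "right_module_axioms k (restrict_scalars i M)"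
    using ring_hom_closed[OF assms(2)] ring_hom_add[OF assms(2)] ring_hom_mult[OF assms(2)]
      ring_hom_one[OF assms(2)]
    by unfold_locales (simp_all add: M.smult_l_distr M.smult_r_distr M.smult_assoc)
  ultimately show ?thesis using k.ring_axioms by (simp add: right_module_def)
qed

context right_module
begin

definition span :: "'b set \<Rightarrow> 'b set" where
  "span S = \<Inter>{N. submod R M N \<and> S \<subseteq> N}"

lemma span_submod: "S \<subseteq> carrier M \<Longrightarrow> submod R M (span S)"
  using submod_self by (fastforce simp: span_def submod_def)

lemma span_superset: "S \<subseteq> span S"
  by (auto simp: span_def)

lemma span_least: "submod R M N \<Longrightarrow> S \<subseteq> N \<Longrightarrow> span S \<subseteq> N"
  by (auto simp: span_def)

text \<open>This is the sum \<open>U + w R\<close>. It serves twice: to enlarge a maximal submodule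
  by one vector, and to split off one generator of a finitely generated module.\<close>

lemma submod_join_cyclic:
  assumes "submod R M U" "w \<in> carrier M"
  shows "submod R M {u \<oplus>\<^bsub>M\<^esub> c \<odot>\<^bsub>M\<^esub> w | u c. u \<in> U \<and> c \<in> carrier R}" (is "submod R M ?V")
proof -
  note U = submodD[OF assms(1)]
  show ?thesis unfolding submod_def
  proof (intro conjI ballI)
    show "?V \<subseteq> carrier M" using U(2) assms(2) by auto
    have "\<zero>\<^bsub>M\<^esub> = \<zero>\<^bsub>M\<^esub> \<oplus>\<^bsub>M\<^esub> \<zero>\<^bsub>R\<^esub> \<odot>\<^bsub>M\<^esub> w" using assms(2) by simp
    then show "\<zero>\<^bsub>M\<^esub> \<in> ?V" using U(3) R.zero_closed by blast
  next
    fix x y assume "x \<in> ?V" "y \<in> ?V"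
    then obtain u c u' c' where 1: "x = u \<oplus>\<^bsub>M\<^esub> c \<odot>\<^bsub>M\<^esub> w" "u \<in> U" "c \<in> carrier R"
      and 2: "y = u' \<oplus>\<^bsub>M\<^esub> c' \<odot>\<^bsub>M\<^esub> w" "u' \<in> U" "c' \<in> carrier R" by blast
    have "x \<oplus>\<^bsub>M\<^esub> y = (u \<oplus>\<^bsub>M\<^esub> u') \<oplus>\<^bsub>M\<^esub> (c \<oplus>\<^bsub>R\<^esub> c') \<odot>\<^bsub>M\<^esub> w"
      using 1 2 U(2) assms(2) by (simp add: smult_l_distr M.a_ac)
    moreover have "u \<oplus>\<^bsub>M\<^esub> u' \<in> U" "c \<oplus>\<^bsub>R\<^esub> c' \<in> carrier R" using 1 2 U(4) by auto
    ultimately show "x \<oplus>\<^bsub>M\<^esub> y \<in> ?V" by blast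
  next
    fix r x assume r: "r \<in> carrier R" and "x \<in> ?V"
    then obtain u c where 1: "x = u \<oplus>\<^bsub>M\<^esub> c \<odot>\<^bsub>M\<^esub> w" "u \<in> U" "c \<in> carrier R" by blast
    have "r \<odot>\<^bsub>M\<^esub> x = r \<odot>\<^bsub>M\<^esub> u \<oplus>\<^bsub>M\<^esub> (c \<otimes>\<^bsub>R\<^esub> r) \<odot>\<^bsub>M\<^esub> w"
      using 1 r U(2) assms(2) by (simp add: smult_r_distr smult_assoc)
    moreover have "r \<odot>\<^bsub>M\<^esub> u \<in> U" "c \<otimes>\<^bsub>R\<^esub> r \<in> carrier R" using 1 r U(5) by auto
    ultimately show "r \<odot>\<^bsub>M\<^esub> x \<in> ?V" by blast
  qed
qed

lemma submod_Union_chain: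
  assumes "C \<noteq> {}" "\<And>A. A \<in> C \<Longrightarrow> submod R M A" "\<And>A B. A \<in> C \<Longrightarrow> B \<in> C \<Longrightarrow> A \<subseteq> B \<or> B \<subseteq> A"
  shows "submod R M (\<Union>C)"
  unfolding submod_def
proof (intro conjI ballI)
  show "\<Union>C \<subseteq> carrier M" using submod_subset[OF assms(2)] by blast
  obtain A where "A \<in> C" using assms(1) by blast
  then show "\<zero>\<^bsub>M\<^esub> \<in> \<Union>C" using submod_zero[OF assms(2)] by blast
next
  fix x y assume "x \<in> \<Union>C" "y \<in> \<Union>C"
  then obtain A where "A \<in> C" "x \<in> A" "y \<in> A" using assms(3) by blast
  then show "x \<oplus>\<^bsub>M\<^esub> y \<in> \<Union>C" using submod_add[OF assms(2)] by blast
next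
  fix r x assume "r \<in> carrier R" "x \<in> \<Union>C"
  then show "r \<odot>\<^bsub>M\<^esub> x \<in> \<Union>C" using submod_smult[OF assms(2)] by blast
qed

end

section \<open>Commutative artinian rings are noetherian\<close>

context
  fixes R :: "'a ring" (structure)
  assumes artinian: "artinian_cring R"
begin

interpretation artinian_cring R by (rule artinian)

lemma submod_ideal: "submod R (reg_mod R) I \<Longrightarrow> ideal I R"
proof -
  assume I: "submod R (reg_mod R) I"
  interpret M: right_module R "reg_mod R" by (rule reg_mod_right_module) (rule ring_axioms)
  note D = submodD[OF I, simplified]
  have n: "\<ominus> x \<in> I" if "x \<in> I" for x
    using D(5)[of "\<ominus> \<one>" x] that D(2) by (simp add: r_minus)
  have "subgroup I (add_monoid R)"
    using D n by unfold_locales (auto simp: a_inv_def)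
  moreover have "a \<otimes> x \<in> I" "x \<otimes> a \<in> I" if "a \<in> I" "x \<in> carrier R" for a x
    using D(5)[OF that(2,1)] m_comm[OF that(2) D(2)[OF that(1)]] by simp_all
  ultimately show ?thesis by (intro idealI[OF ring_axioms]) auto
qed

text \<open>The descending chain condition in the form that provides minimal counterexamples. The
  pairs are restricted to submodules because the chain condition speaks of ideals only.\<close>

lemma wf_submod:
  "wf {(J, I). submod R (reg_mod R) J \<and> submod R (reg_mod R) I \<and> J \<subset> I}"
  unfolding wf_iff_no_infinite_down_chain
proof
  assume "\<exists>f. \<forall>i. (f (Suc i), f i) \<in> {(J, I). submod R (reg_mod R) J \<and> submod R (reg_mod R) I \<and> J \<subset> I}"
  then obtain f where *: "\<forall>i. (f (Suc i), f i) \<in>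
      {(J, I). submod R (reg_mod R) J \<and> submod R (reg_mod R) I \<and> J \<subset> I}" by (rule exE)
  have f: "submod R (reg_mod R) (f i)" "f (Suc i) \<subset> f i" for i
    using spec[OF *, of i] by simp_all
  have "\<exists>N. \<forall>n\<ge>N. f n = f N"
    by (rule descending_chain) (simp_all add: submod_ideal f less_imp_le[OF f(2)])
  then obtain N where N: "\<forall>n\<ge>N. f n = f N" by (rule exE)
  have "f (Suc N) = f N" by (rule N[rule_format]) simp
  then show False using f(2)[of N] by simp
qed

text \<open>Commutativity makes multiplication by a fixed element linear over the ring.\<close>

lemma mult_hom: "x \<in> carrier R \<Longrightarrow> (\<lambda>y. y \<otimes> x) \<in> mod_hom R (reg_mod R) (reg_mod R)"
  by (rule mod_homI) (simp_all add: l_distr, simp add: m_ac)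

text \<open>The inverse comes from the chain of the ideals \<open>x\<^sup>n R\<close>, which is stationary.\<close>

lemma mult_surj_inverse:
  assumes I: "submod R (reg_mod R) I" and x: "x \<in> carrier R" and "(\<lambda>y. y \<otimes> x) ` I = I"
  shows "\<exists>r\<in>carrier R. \<forall>y\<in>I. y \<otimes> x \<otimes> r = y"
proof -
  note D = submodD[OF I, simplified]
  have "PIdl (x [^] Suc n) \<subseteq> PIdl (x [^] n)" for n :: nat
  proof
    fix y assume "y \<in> PIdl (x [^] Suc n)"
    then obtain c where c: "c \<in> carrier R" "y = c \<otimes> x [^] Suc n" by (auto simp: cgenideal_def)
    then have "y = (c \<otimes> x) \<otimes> x [^] n" using x by (simp add: m_ac)
    then show "y \<in> PIdl (x [^] n)" using c x unfolding cgenideal_def by blast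
  qed
  then have "\<exists>N::nat. \<forall>n\<ge>N. PIdl (x [^] n) = PIdl (x [^] N)"
    using x by (intro descending_chain) (simp_all add: cgenideal_ideal)
  then obtain N :: nat where N: "\<forall>n\<ge>N. PIdl (x [^] n) = PIdl (x [^] N)" by (rule exE)
  have "PIdl (x [^] Suc N) = PIdl (x [^] N)" by (rule N[rule_format]) simp
  then have "x [^] N \<in> PIdl (x [^] Suc N)" using cgenideal_self[of "x [^] N"] x by simp
  then obtain c where c: "c \<in> carrier R" "x [^] N = c \<otimes> x [^] Suc N" by (auto simp: cgenideal_def)
  \<comment> \<open>Iterated surjectivity makes every element of \<open>I\<close> a multiple of each
    power of \<open>x\<close>, with cofactor again in \<open>I\<close>.\<close>
  have pow: "\<exists>z\<in>I. y = z \<otimes> x [^] n" if "y \<in> I" for y and n :: nat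
    using that
  proof (induction n arbitrary: y)
    case 0
    then show ?case using D(2) by (auto intro!: bexI[of _ y])
  next
    case (Suc n)
    then obtain y' where y': "y' \<in> I" "y = y' \<otimes> x" using assms(3) by blast
    then obtain z where z: "z \<in> I" "y' = z \<otimes> x [^] n" using Suc.IH by blast
    then have "y = z \<otimes> x [^] Suc n" using y' D(2)[OF z(1)] x by (simp add: m_assoc)
    then show ?case using z by blast
  qed
  \<comment> \<open>Write \<open>y = z x^N\<close>. Stationarity gave
    \<open>x^N = c x^(N+1)\<close>, hence \<open>y x c = z c x^(N+1) = z x^N = y\<close>.\<close>
  have "y \<otimes> x \<otimes> c = y" if y: "y \<in> I" for y
  proof -
    obtain z where z: "z \<in> I" "y = z \<otimes> x [^] N" using pow[OF y] by blast
    then have "y \<otimes> x \<otimes> c = z \<otimes> (c \<otimes> x [^] Suc N)"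
      using D(2)[OF z(1)] x c(1) by (simp add: m_ac)
    then show ?thesis unfolding c(2)[symmetric] z(2)[symmetric] .
  qed
  then show ?thesis using c(1) by blast
qed

text \<open>In a minimal non-finitely generated ideal \<open>I\<close> every ring element acts as zero or
  invertibly, so that \<open>I\<close> is a vector space over a field; a hyperplane together with one more vector
  would then generate \<open>I\<close>.\<close>

lemma artinian_cring_noetherian: "noetherian_mod R (reg_mod R)"
proof (rule ccontr)
  let ?M = "reg_mod R"
  interpret M: right_module R ?M by (rule reg_mod_right_module) (rule ring_axioms)
  assume "\<not> noetherian_mod R ?M"
  then obtain I0 where I0: "I0 \<in> {I. submod R ?M I \<and> \<not> fg_sub R ?M I}"
    by (auto simp: noetherian_mod_def)
  obtain I where I': "I \<in> {I. submod R ?M I \<and> \<not> fg_sub R ?M I}"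
    and min': "\<And>J. (J, I) \<in> {(J, I). submod R ?M J \<and> submod R ?M I \<and> J \<subset> I} \<Longrightarrow>
      J \<notin> {I. submod R ?M I \<and> \<not> fg_sub R ?M I}"
    by (rule wfE_min[OF wf_submod I0]) blast
  have I: "submod R ?M I" "\<not> fg_sub R ?M I" using I' by simp_all
  have min: "fg_sub R ?M J" if "submod R ?M J" "J \<subset> I" for J
    using min'[of J] that I(1) by simp
  note D = submodD[OF I(1), simplified]
  \<comment> \<open>Otherwise kernel and image of multiplication by \<open>x\<close> on
    \<open>I\<close> would be proper submodules of \<open>I\<close>, finitely generated by
    minimality, and \<open>I\<close> would be an extension of one by the other.\<close>
  have act: "(\<forall>y\<in>I. y \<otimes> x = \<zero>) \<or> (\<lambda>y. y \<otimes> x) ` I = I" if x: "x \<in> carrier R" for x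
  proof (rule ccontr)
    assume *: "\<not> ?thesis"
    note h = mult_hom[OF x]
    let ?K = "I \<inter> {y \<in> carrier ?M. y \<otimes> x = \<zero>\<^bsub>?M\<^esub>}"
    have "submod R ?M ((\<lambda>y. y \<otimes> x) ` I)"
      by (rule submod_image[OF M.right_module_axioms M.right_module_axioms h I(1)])
    moreover have "(\<lambda>y. y \<otimes> x) ` I \<subset> I" using * D(5)[OF x] by blast
    ultimately have 1: "fg_sub R ?M ((\<lambda>y. y \<otimes> x) ` I)" by (rule min)
    have "submod R ?M ?K"
      by (rule submod_inter[OF I(1) submod_kernel[OF M.right_module_axioms M.right_module_axioms h]])
    moreover have "?K \<subset> I" using * by auto
    ultimately have 2: "fg_sub R ?M ?K" by (rule min)
    show False
      using fg_sub_extension[OF M.right_module_axioms M.right_module_axioms h I(1) 1 2] I(2) by blast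
  qed
  have "fg_sub R ?M {\<zero>}" by (rule fg_subI[of "{}"]) (simp_all add: submod_def)
  then obtain v where v: "v \<in> I" "v \<noteq> \<zero>" using I(2) D(3) by (cases "I = {\<zero>}") auto
  \<comment> \<open>The hyperplane is taken maximal among the submodules of \<open>I\<close> that
    avoid the nonzero \<open>v\<close>. Being proper, it is finitely generated by minimality of
    \<open>I\<close>.\<close>
  let ?C = "{U. submod R ?M U \<and> U \<subseteq> I \<and> v \<notin> U}"
  have "\<exists>U\<in>?C. \<forall>X\<in>?C. U \<subseteq> X \<longrightarrow> X = U"
  proof (rule subset_Zorn_nonempty)
    show "?C \<noteq> {}" using M.submod_zero_set v D(3) by auto
    fix C assume C: "C \<noteq> {}" "subset.chain ?C C"
    have "submod R ?M (\<Union>C)"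
      by (rule M.submod_Union_chain[OF C(1)]) (use C(2) in \<open>auto simp: subset_chain_def\<close>)
    then show "\<Union>C \<in> ?C" using C(2) by (auto simp: subset_chain_def)
  qed
  then obtain U where U': "U \<in> ?C" and max': "\<forall>X\<in>?C. U \<subseteq> X \<longrightarrow> X = U" by (rule bexE)
  have U: "submod R ?M U" "U \<subseteq> I" "v \<notin> U" using U' by simp_all
  have max: "X = U" if "submod R ?M X" "X \<subseteq> I" "v \<notin> X" "U \<subseteq> X" for X
    using bspec[OF max', of X] that by simp
  note DU = submodD[OF U(1), simplified]
  have UI: "U \<subset> I" using U(2,3) v(1) by blast
  obtain S where S0: "finite S" "gen_by R ?M S U" by (rule fg_subE[OF min[OF U(1) UI]])
  note S = S0(1) gen_by_subset[OF S0(2)] gen_by_least[OF S0(2)]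
  have "w \<in> N" if N: "submod R ?M N" "insert v S \<subseteq> N" and w: "w \<in> I" for N w
  proof (cases "w \<in> U")
    case True
    then show ?thesis using S(3)[OF N(1)] N(2) by blast
  next
    case False
    let ?V = "{u \<oplus>\<^bsub>?M\<^esub> c \<odot>\<^bsub>?M\<^esub> w | u c. u \<in> U \<and> c \<in> carrier R}"
    have wc: "w \<in> carrier R" using w D(2) by blast
    have V: "submod R ?M ?V" by (rule M.submod_join_cyclic[OF U(1)]) (simp add: wc)
    have "?V \<subseteq> I" using U(2) D(4,5) w by auto
    moreover have "U \<subseteq> ?V"
    proof
      fix u assume "u \<in> U"
      moreover have "u = u \<oplus>\<^bsub>?M\<^esub> \<zero> \<odot>\<^bsub>?M\<^esub> w" using DU(2)[OF \<open>u \<in> U\<close>] wc by simp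
      ultimately show "u \<in> ?V" by blast
    qed
    moreover have "w \<in> ?V"
    proof -
      have "w = \<zero> \<oplus>\<^bsub>?M\<^esub> \<one> \<odot>\<^bsub>?M\<^esub> w" using wc by simp
      then show ?thesis using DU(3) one_closed by blast
    qed
    ultimately have "v \<in> ?V" using max[OF V] False by blast
    then obtain u c where uc: "v = u \<oplus> w \<otimes> c" "u \<in> U" "c \<in> carrier R" by auto
    \<comment> \<open>The element \<open>c\<close> does not annihilate \<open>I\<close>: if
      \<open>w c\<close> were zero, then \<open>v = u\<close> would lie in \<open>U\<close>. So
      \<open>c\<close> acts invertibly, and \<open>w\<close> is recovered from
      \<open>v - u\<close>.\<close>
    have "(\<lambda>y. y \<otimes> c) ` I = I"
      using act[OF uc(3)] uc w U(3) DU(2)[OF uc(2)] by auto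
    then obtain r where r: "r \<in> carrier R" "\<forall>y\<in>I. y \<otimes> c \<otimes> r = y"
      using mult_surj_inverse[OF I(1) uc(3)] by blast
    have "v \<ominus> u = w \<otimes> c"
      using uc(1,3) DU(2)[OF uc(2)] wc by (simp add: minus_eq a_ac r_neg2)
    then have "w = (v \<ominus> u) \<otimes> r" using r(2) w by simp
    moreover have "u \<in> N" using S(3)[OF N(1)] N(2) uc(2) by blast
    then have "v \<ominus>\<^bsub>?M\<^esub> u \<in> N" using M.submod_minus[OF N(1)] N(2) by blast
    moreover have "v \<ominus>\<^bsub>?M\<^esub> u = v \<ominus> u"
      by (simp add: a_minus_def a_inv_def m_inv_def reg_mod_def)
    ultimately show ?thesis using submod_smult[OF N(1) r(1)] by simp
  qed
  then have "fg_sub R ?M I" using S(1,2) U(2) v(1) by (intro fg_subI[of "insert v S"]) auto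
  then show False using I(2) by blast
qed

end

text \<open>Induction on the generating set, much as with leading coefficients in Hilbert's basis
  theorem: a submodule \<open>N\<close> of \<open>span (insert s S)\<close> is controlled by
  \<open>N \<inter> span S\<close> and by the right ideal of the coefficients of \<open>s\<close>
  that occur in \<open>N\<close>.\<close>

lemma fg_noetherian_mod:
  assumes "noetherian_mod R (reg_mod R)" "fg_module R M"
  shows "noetherian_mod R M"
proof -
  interpret right_module R M using assms(2) by (rule fg_right_module)
  have reg: "right_module R (reg_mod R)" by (rule reg_mod_right_module) (rule R.ring_axioms)
  have *: "fg_sub R M N" if "finite S" "S \<subseteq> carrier M" "submod R M N" "N \<subseteq> span S" for S N
    using that
  proof (induction S arbitrary: N)
    case empty
    then have "N = {\<zero>\<^bsub>M\<^esub>}"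
      using span_least[OF submod_zero_set, of "{}"] submod_zero by blast
    then show ?case by (intro fg_subI[of "{}"]) (simp_all add: submod_def)
  next
    case (insert s S)
    let ?P = "span S"
    have s: "s \<in> carrier M" and P: "submod R M ?P" using insert.prems span_submod by auto
    note N = insert.prems(2)
    note DP = submodD[OF P] and DN = submodD[OF N]
    have "span (insert s S) \<subseteq> {u \<oplus>\<^bsub>M\<^esub> c \<odot>\<^bsub>M\<^esub> s | u c. u \<in> ?P \<and> c \<in> carrier R}" (is "_ \<subseteq> ?V")
    proof (rule span_least[OF submod_join_cyclic[OF P s]])
      have "s = \<zero>\<^bsub>M\<^esub> \<oplus>\<^bsub>M\<^esub> \<one>\<^bsub>R\<^esub> \<odot>\<^bsub>M\<^esub> s" using s by simp
      then have "s \<in> ?V" using DP(3) R.one_closed by blast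
      moreover have "t \<in> ?V" if "t \<in> S" for t
      proof -
        have t: "t \<in> ?P" using that span_superset by blast
        then have "t = t \<oplus>\<^bsub>M\<^esub> \<zero>\<^bsub>R\<^esub> \<odot>\<^bsub>M\<^esub> s" using s DP(2) by simp
        then show ?thesis using t R.zero_closed by blast
      qed
      ultimately show "insert s S \<subseteq> ?V" by blast
    qed
    then have dec: "\<exists>u c. x = u \<oplus>\<^bsub>M\<^esub> c \<odot>\<^bsub>M\<^esub> s \<and> u \<in> ?P \<and> c \<in> carrier R" if "x \<in> N" for x
      using insert.prems(3) that by blast
    \<comment> \<open>The coefficient of \<open>s\<close> in an element is not unique, so
      \<open>J A\<close> collects every one that occurs. This replaces a passage to the quotient by
      \<open>span S\<close>. It is defined for all \<open>A\<close> since \<open>J N\<close> gets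
      compared with \<open>J (A \<inter> N)\<close>.\<close>
    define J where "J A = {c \<in> carrier R. \<exists>u\<in>?P. u \<oplus>\<^bsub>M\<^esub> c \<odot>\<^bsub>M\<^esub> s \<in> A}" for A
    have J: "submod R (reg_mod R) (J A)" if A: "submod R M A" for A
      unfolding submod_def
    proof (intro conjI ballI)
      note DA = submodD[OF A]
      show "J A \<subseteq> carrier (reg_mod R)" by (auto simp: J_def)
      have "\<zero>\<^bsub>M\<^esub> \<oplus>\<^bsub>M\<^esub> \<zero>\<^bsub>R\<^esub> \<odot>\<^bsub>M\<^esub> s \<in> A" using s DA(3) by simp
      then show "\<zero>\<^bsub>reg_mod R\<^esub> \<in> J A" using DP(3) by (auto simp: J_def)
      fix x assume x: "x \<in> J A"
      then obtain u where u: "x \<in> carrier R" "u \<in> ?P" "u \<oplus>\<^bsub>M\<^esub> x \<odot>\<^bsub>M\<^esub> s \<in> A" by (auto simp: J_def)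
      { fix y assume "y \<in> J A"
        then obtain u' where u': "y \<in> carrier R" "u' \<in> ?P" "u' \<oplus>\<^bsub>M\<^esub> y \<odot>\<^bsub>M\<^esub> s \<in> A"
          by (auto simp: J_def)
        have "(u \<oplus>\<^bsub>M\<^esub> u') \<oplus>\<^bsub>M\<^esub> (x \<oplus>\<^bsub>R\<^esub> y) \<odot>\<^bsub>M\<^esub> s = (u \<oplus>\<^bsub>M\<^esub> x \<odot>\<^bsub>M\<^esub> s) \<oplus>\<^bsub>M\<^esub> (u' \<oplus>\<^bsub>M\<^esub> y \<odot>\<^bsub>M\<^esub> s)"
          using u(1) u'(1) DP(2)[OF u(2)] DP(2)[OF u'(2)] s by (simp add: smult_l_distr M.a_ac)
        also have "\<dots> \<in> A" using DA(4) u u' by blast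
        finally show "x \<oplus>\<^bsub>reg_mod R\<^esub> y \<in> J A" using u u' DP(4) by (auto simp: J_def) }
      fix r assume r: "r \<in> carrier R"
      have "r \<odot>\<^bsub>M\<^esub> u \<oplus>\<^bsub>M\<^esub> (x \<otimes>\<^bsub>R\<^esub> r) \<odot>\<^bsub>M\<^esub> s = r \<odot>\<^bsub>M\<^esub> (u \<oplus>\<^bsub>M\<^esub> x \<odot>\<^bsub>M\<^esub> s)"
        using u(1) DP(2)[OF u(2)] s r by (simp add: smult_r_distr smult_assoc)
      also have "\<dots> \<in> A" using DA(5) r u by blast
      finally show "r \<odot>\<^bsub>reg_mod R\<^esub> x \<in> J A" using u r DP(5) by (auto simp: J_def)
    qed
    have "fg_sub R (reg_mod R) (J N)"
      using assms(1) J[OF N] by (simp add: noetherian_mod_def)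
    then obtain C where C0: "finite C" "gen_by R (reg_mod R) C (J N)" by (rule fg_subE)
    note C = C0(1) gen_by_subset[OF C0(2)] gen_by_least[OF C0(2)]
    have "\<forall>c\<in>C. \<exists>u. u \<in> ?P \<and> u \<oplus>\<^bsub>M\<^esub> c \<odot>\<^bsub>M\<^esub> s \<in> N" using C(2) by (auto simp: J_def)
    then obtain u where u: "\<And>c. c \<in> C \<Longrightarrow> u c \<in> ?P" "\<And>c. c \<in> C \<Longrightarrow> u c \<oplus>\<^bsub>M\<^esub> c \<odot>\<^bsub>M\<^esub> s \<in> N"
      by metis
    let ?T = "(\<lambda>c. u c \<oplus>\<^bsub>M\<^esub> c \<odot>\<^bsub>M\<^esub> s) ` C"
    have "fg_sub R M (N \<inter> ?P)"
      using insert.IH[OF _ submod_inter[OF N P]] insert.prems(1) by blast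
    then obtain T where T0: "finite T" "gen_by R M T (N \<inter> ?P)" by (rule fg_subE)
    note T = T0(1) gen_by_subset[OF T0(2)] gen_by_least[OF T0(2)]
    have "x \<in> A" if A: "submod R M A" "T \<union> ?T \<subseteq> A" and x: "x \<in> N" for A x
    proof -
      have AN: "submod R M (A \<inter> N)" by (rule submod_inter[OF A(1) N])
      have "c \<in> J (A \<inter> N)" if c: "c \<in> C" for c
      proof -
        have "c \<in> carrier R" using c C(2) by (auto simp: J_def)
        moreover have "u c \<oplus>\<^bsub>M\<^esub> c \<odot>\<^bsub>M\<^esub> s \<in> A \<inter> N" using A(2) u(2)[OF c] c by blast
        ultimately show ?thesis using u(1)[OF c] unfolding J_def by blast
      qed
      then have "C \<subseteq> J (A \<inter> N)" by blast
      then have JN: "J N \<subseteq> J (A \<inter> N)" by (rule C(3)[OF J[OF AN]])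
      obtain m c where m: "x = m \<oplus>\<^bsub>M\<^esub> c \<odot>\<^bsub>M\<^esub> s" "m \<in> ?P" "c \<in> carrier R" using dec[OF x] by blast
      then have "c \<in> J N" using x by (auto simp: J_def)
      then obtain m' where m': "m' \<in> ?P" "m' \<oplus>\<^bsub>M\<^esub> c \<odot>\<^bsub>M\<^esub> s \<in> A" "m' \<oplus>\<^bsub>M\<^esub> c \<odot>\<^bsub>M\<^esub> s \<in> N"
        using JN by (auto simp: J_def)
      \<comment> \<open>Both \<open>x\<close> and \<open>?y\<close> can be written with the
        coefficient \<open>c\<close>, so their difference \<open>m - m'\<close> lies in
        \<open>span S\<close> as well as in \<open>N\<close>.\<close>
      let ?y = "m' \<oplus>\<^bsub>M\<^esub> c \<odot>\<^bsub>M\<^esub> s"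
      have mc: "m \<in> carrier M" "m' \<in> carrier M" "c \<odot>\<^bsub>M\<^esub> s \<in> carrier M"
        using m m' DP(2) s by auto
      then have "x \<ominus>\<^bsub>M\<^esub> ?y = m \<ominus>\<^bsub>M\<^esub> m'"
        unfolding m(1) by (simp add: M.minus_eq M.minus_add M.a_ac M.r_neg1 M.r_neg)
      moreover have "m \<ominus>\<^bsub>M\<^esub> m' \<in> ?P" using submod_minus[OF P m(2) m'(1)] .
      moreover have "x \<ominus>\<^bsub>M\<^esub> ?y \<in> N" using submod_minus[OF N x m'(3)] .
      ultimately have "x \<ominus>\<^bsub>M\<^esub> ?y \<in> A" using T(3)[OF A(1)] A(2) by auto
      then have "(x \<ominus>\<^bsub>M\<^esub> ?y) \<oplus>\<^bsub>M\<^esub> ?y \<in> A" using m'(2) submod_add[OF A(1)] by blast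
      then show ?thesis using mc m(1) by (simp add: minus_add_cancel)
    qed
    then show ?case
      using T(1,2) C(1) u(2) by (intro fg_subI[of "T \<union> ?T"]) auto
  qed
  have "fg_sub R M (carrier M)" using assms(2) by (simp add: fg_module_iff)
  then obtain S where S0: "finite S" "gen_by R M S (carrier M)" by (rule fg_subE)
  note S = S0(1) gen_by_subset[OF S0(2)] gen_by_least[OF S0(2)]
  have "carrier M \<subseteq> span S" using S(3)[OF span_submod[OF S(2)] span_superset] .
  then show ?thesis unfolding noetherian_mod_def
    using *[OF S(1,2)] submod_subset by (metis subset_trans)
qed

text \<open>The property passes through \<open>k\<close>: \<open>\<Lambda>\<close> is finitely
  generated over \<open>k\<close> and \<open>M\<close> over \<open>\<Lambda>\<close>, so
  \<open>M\<close> is finitely generated, hence noetherian, over \<open>k\<close>. A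
  \<open>\<Lambda>\<close>-submodule is a \<open>k\<close>-submodule, and its generators over
  \<open>k\<close> also generate it over \<open>\<Lambda>\<close>.\<close>

theorem artin_algebra_fg_sub:
  assumes "artin_algebra k \<Lambda> i" "fg_module \<Lambda> M" "submod \<Lambda> M N"
  shows "fg_sub \<Lambda> M N"
proof -
  interpret artin_algebra k \<Lambda> i by fact
  interpret M: right_module \<Lambda> M using assms(2) by (rule fg_right_module)
  let ?L = "restrict_scalars i (reg_mod \<Lambda>)" and ?M = "restrict_scalars i M"
  have iota: "i c \<in> carrier \<Lambda>" if "c \<in> carrier k" for c
    using ring_hom_closed[OF structure_map that] .
  have rL: "right_module k ?L"
    by (rule restrict_scalars_right_module[OF k.ring_axioms structure_map reg_mod_right_module])
      (rule \<Lambda>.ring_axioms)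
  have rM: "right_module k ?M"
    by (rule restrict_scalars_right_module[OF k.ring_axioms structure_map M.right_module_axioms])
  obtain S where S: "finite S" "S \<subseteq> carrier \<Lambda>"
    and gen: "\<forall>x\<in>carrier \<Lambda>. \<exists>c\<in>S \<rightarrow> carrier k. x = (\<Oplus>\<^bsub>\<Lambda>\<^esub>s\<in>S. i (c s) \<otimes>\<^bsub>\<Lambda>\<^esub> s)"
    using finitely_generated_algebra by blast
  \<comment> \<open>The algebra is spanned by terms \<open>i (c s) \<otimes> s\<close>, while
    restricting the regular right module gives \<open>s \<otimes> i (c s)\<close>; centrality of the
    structure map identifies the two.\<close>
  have "(\<Oplus>\<^bsub>\<Lambda>\<^esub>s\<in>S. i (c s) \<otimes>\<^bsub>\<Lambda>\<^esub> s) = (\<Oplus>\<^bsub>?L\<^esub>s\<in>S. c s \<odot>\<^bsub>?L\<^esub> s)" if c: "c \<in> S \<rightarrow> carrier k" for c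
  proof -
    have "(\<Oplus>\<^bsub>\<Lambda>\<^esub>s\<in>S. i (c s) \<otimes>\<^bsub>\<Lambda>\<^esub> s) = (\<Oplus>\<^bsub>\<Lambda>\<^esub>s\<in>S. s \<otimes>\<^bsub>\<Lambda>\<^esub> i (c s))"
      by (rule \<Lambda>.finsum_cong') (use S c central iota in \<open>auto simp: Pi_iff subset_iff\<close>)
    then show ?thesis by (simp add: finsum_def finprod_def reg_mod_def restrict_scalars_def)
  qed
  with gen have "fg_module k ?L" unfolding fg_module_def using rL S by fastforce
  then have "fg_sub k ?L (carrier \<Lambda>)" by (simp add: fg_module_iff)
  then obtain S where S0: "finite S" "gen_by k ?L S (carrier \<Lambda>)" by (rule fg_subE)
  note S = S0(1) gen_by_subset[OF S0(2)] gen_by_least[OF S0(2)]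
  have "fg_sub \<Lambda> M (carrier M)" using assms(2) by (simp add: fg_module_iff)
  then obtain T where T0: "finite T" "gen_by \<Lambda> M T (carrier M)" by (rule fg_subE)
  note T = T0(1) gen_by_subset[OF T0(2)] gen_by_least[OF T0(2)]
  let ?G = "(\<lambda>(s, t). s \<odot>\<^bsub>M\<^esub> t) ` (S \<times> T)"
  have "carrier ?M \<subseteq> A" if A: "submod k ?M A" "?G \<subseteq> A" for A
  proof -
    note D = submodD[OF A(1), simplified]
    \<comment> \<open>For a fixed generator \<open>t\<close> of \<open>M\<close>, the elements of
      \<open>\<Lambda>\<close> that move \<open>t\<close> into \<open>A\<close> form a
      \<open>k\<close>-submodule containing \<open>S\<close>, hence are all of
      \<open>\<Lambda>\<close>.\<close>
    have 1: "r \<odot>\<^bsub>M\<^esub> t \<in> A" if t: "t \<in> T" and r: "r \<in> carrier \<Lambda>" for r t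
    proof -
      have tM: "t \<in> carrier M" using t T(2) by blast
      have "submod k ?L {l \<in> carrier \<Lambda>. l \<odot>\<^bsub>M\<^esub> t \<in> A}"
        unfolding submod_def using D tM iota
        by (auto simp: M.smult_l_distr M.smult_assoc)
      moreover have "S \<subseteq> {l \<in> carrier \<Lambda>. l \<odot>\<^bsub>M\<^esub> t \<in> A}" using S(2) A(2) t by auto
      ultimately show ?thesis using S(3) r by blast
    qed
    \<comment> \<open>This is the largest \<open>\<Lambda>\<close>-submodule contained in
      \<open>A\<close>. By the previous step it contains \<open>T\<close>, so it is all of
      \<open>M\<close>.\<close>
    have "submod \<Lambda> M {x \<in> carrier M. \<forall>r\<in>carrier \<Lambda>. r \<odot>\<^bsub>M\<^esub> x \<in> A}"
      unfolding submod_def using D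
      by (auto simp: M.smult_r_distr simp flip: M.smult_assoc)
    moreover have "T \<subseteq> {x \<in> carrier M. \<forall>r\<in>carrier \<Lambda>. r \<odot>\<^bsub>M\<^esub> x \<in> A}" using 1 T(2) by auto
    ultimately have "carrier M \<subseteq> {x \<in> carrier M. \<forall>r\<in>carrier \<Lambda>. r \<odot>\<^bsub>M\<^esub> x \<in> A}" by (rule T(3))
    then have "\<one>\<^bsub>\<Lambda>\<^esub> \<odot>\<^bsub>M\<^esub> x \<in> A" if "x \<in> carrier M" for x using that by blast
    then show ?thesis by auto
  qed
  moreover have "?G \<subseteq> carrier ?M" using S(2) T(2) by auto
  ultimately have "fg_sub k ?M (carrier ?M)" using S(1) T(1) by (intro fg_subI[of ?G]) simp_all
  then have "fg_module k ?M" using rM unfolding fg_module_iff by blast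
  then have "noetherian_mod k ?M" by (rule fg_noetherian_mod[OF artinian_cring_noetherian[OF k.artinian_cring_axioms]])
  moreover have sub: "submod k ?M A" if "submod \<Lambda> M A" for A
    using submodD[OF that] iota unfolding submod_def by auto
  ultimately have "fg_sub k ?M N" using assms(3) unfolding noetherian_mod_def by blast
  then obtain C where "finite C" "gen_by k ?M C N" by (rule fg_subE)
  then show ?thesis using sub by (intro fg_subI[of C]) (simp_all add: gen_by_subset gen_by_least)
qed

section \<open>Free modules and projective presentations\<close>

text \<open>For finite \<open>S\<close> this is the free right module on \<open>S\<close>. Its
  elements are extensional functions, so that they are equal as soon as they agree on
  \<open>S\<close>. The index set may have any type; below it consists of the very elements onto
  which the basis is mapped.\<close>

definition free_mod :: "'a ring \<Rightarrow> 's set \<Rightarrow> ('a, 's \<Rightarrow> 'a) module" where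
  "free_mod R S = \<lparr>carrier = S \<rightarrow>\<^sub>E carrier R, mult = undefined, one = undefined,
     zero = (\<lambda>s\<in>S. \<zero>\<^bsub>R\<^esub>), add = (\<lambda>f g. \<lambda>s\<in>S. f s \<oplus>\<^bsub>R\<^esub> g s), smult = (\<lambda>r f. \<lambda>s\<in>S. f s \<otimes>\<^bsub>R\<^esub> r)\<rparr>"

lemma free_mod_simps [simp]:
  "carrier (free_mod R S) = S \<rightarrow>\<^sub>E carrier R" "\<zero>\<^bsub>free_mod R S\<^esub> = (\<lambda>s\<in>S. \<zero>\<^bsub>R\<^esub>)"
  "f \<oplus>\<^bsub>free_mod R S\<^esub> g = (\<lambda>s\<in>S. f s \<oplus>\<^bsub>R\<^esub> g s)" "r \<odot>\<^bsub>free_mod R S\<^esub> f = (\<lambda>s\<in>S. f s \<otimes>\<^bsub>R\<^esub> r)"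
  by (simp_all add: free_mod_def)

definition free_basis :: "'a ring \<Rightarrow> 's set \<Rightarrow> 's \<Rightarrow> 's \<Rightarrow> 'a" where
  "free_basis R S t = (\<lambda>s\<in>S. if s = t then \<one>\<^bsub>R\<^esub> else \<zero>\<^bsub>R\<^esub>)"

lemma free_mod_right_module:
  fixes R :: "'a ring" (structure)
  assumes "ring R"
  shows "right_module R (free_mod R S)"
proof -
  interpret ring R by fact
  have ext: "(\<lambda>s\<in>S. f s) = f" if "f \<in> S \<rightarrow>\<^sub>E carrier R" for f
    using that by (auto simp: PiE_def extensional_restrict)
  have "abelian_group (free_mod R S)"
  proof (rule abelian_groupI)
    fix f assume f: "f \<in> carrier (free_mod R S)"
    then have "(\<lambda>s\<in>S. \<zero> \<oplus> f s) = (\<lambda>s\<in>S. f s)" by (intro restrict_ext) (auto simp: PiE_iff)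
    then show "\<zero>\<^bsub>free_mod R S\<^esub> \<oplus>\<^bsub>free_mod R S\<^esub> f = f"
      using f ext by (simp cong: restrict_cong)
    show "\<exists>g\<in>carrier (free_mod R S). g \<oplus>\<^bsub>free_mod R S\<^esub> f = \<zero>\<^bsub>free_mod R S\<^esub>"
      using f by (intro bexI[of _ "\<lambda>s\<in>S. \<ominus> f s"]) (auto intro!: restrict_ext simp: l_neg PiE_iff)
  qed (auto intro!: restrict_ext simp: PiE_iff a_assoc intro: a_comm)
  moreover have "(\<lambda>s\<in>S. f s \<otimes> \<one>) = f" if "f \<in> S \<rightarrow>\<^sub>E carrier R" for f
  proof -
    have "(\<lambda>s\<in>S. f s \<otimes> \<one>) = (\<lambda>s\<in>S. f s)" using that by (intro restrict_ext) (auto simp: PiE_iff)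
    then show ?thesis using ext[OF that] by simp
  qed
  then have "right_module_axioms R (free_mod R S)"
    by unfold_locales (auto intro!: restrict_ext simp: PiE_iff l_distr r_distr m_assoc)
  ultimately show ?thesis using ring_axioms by (simp add: right_module_def)
qed

lemma free_basis_closed: "ring R \<Longrightarrow> free_basis R S t \<in> carrier (free_mod R S)"
  by (auto simp: free_basis_def ring.ring_simprules)

text \<open>A function \<open>f\<close> is built up from its truncations to finite subsets
  \<open>T\<close> of \<open>S\<close>: enlarging \<open>T\<close> by \<open>t\<close> adds the
  basis vector of \<open>t\<close> multiplied by \<open>f t\<close>.\<close>

lemma free_mod_gen:
  fixes R :: "'a ring" (structure)
  assumes "ring R" "finite S"
  shows "gen_by R (free_mod R S) (free_basis R S ` S) (carrier (free_mod R S))"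
  unfolding gen_by_def
proof (intro conjI allI impI subsetI)
  interpret ring R by fact
  interpret F: right_module R "free_mod R S" by (rule free_mod_right_module) fact
  fix f assume "f \<in> free_basis R S ` S"
  then show "f \<in> carrier (free_mod R S)" using free_basis_closed[OF assms(1)] by fast
next
  interpret ring R by fact
  interpret F: right_module R "free_mod R S" by (rule free_mod_right_module) fact
  fix N f
  assume N: "submod R (free_mod R S) N" "free_basis R S ` S \<subseteq> N" and f: "f \<in> carrier (free_mod R S)"
  have "(\<lambda>s\<in>S. if s \<in> T then f s else \<zero>) \<in> N" if "finite T" "T \<subseteq> S" for T
    using that
  proof (induction T)
    case empty
    then show ?case using submod_zero[OF N(1)] by (simp add: restrict_def)
  next
    case (insert t T)
    have "f t \<odot>\<^bsub>free_mod R S\<^esub> free_basis R S t \<in> N"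
      using N insert.prems f by (intro submod_smult[OF N(1)]) auto
    moreover have "(\<lambda>s\<in>S. if s \<in> T then f s else \<zero>) \<in> N"
      using insert.IH insert.prems by blast
    ultimately have "(\<lambda>s\<in>S. if s \<in> T then f s else \<zero>) \<oplus>\<^bsub>free_mod R S\<^esub>
        (f t \<odot>\<^bsub>free_mod R S\<^esub> free_basis R S t) \<in> N"
      using submod_add[OF N(1)] by blast
    also have "(\<lambda>s\<in>S. if s \<in> T then f s else \<zero>) \<oplus>\<^bsub>free_mod R S\<^esub>
        (f t \<odot>\<^bsub>free_mod R S\<^esub> free_basis R S t) = (\<lambda>s\<in>S. if s \<in> insert t T then f s else \<zero>)"
      using insert.hyps insert.prems f by (auto simp: free_basis_def PiE_iff intro!: restrict_ext)
    finally show ?case .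
  qed
  from this[OF assms(2)] have "(\<lambda>s\<in>S. if s \<in> S then f s else \<zero>) \<in> N" by simp
  moreover have "(\<lambda>s\<in>S. if s \<in> S then f s else \<zero>) = (\<lambda>s\<in>S. f s)"
    by (rule restrict_ext) simp
  moreover have "(\<lambda>s\<in>S. f s) = f" using f by (simp only: free_mod_simps PiE_restrict)
  ultimately show "f \<in> N" by (simp only:)
qed

lemma free_mod_fg: "ring R \<Longrightarrow> finite S \<Longrightarrow> fg_module R (free_mod R S)"
  unfolding fg_module_iff fg_sub_def
  using free_mod_right_module free_mod_gen by blast

text \<open>With \<open>f\<close> varying over \<open>free_mod R S\<close> this is the homomorphism
  that sends the basis vector of each \<open>s\<close> in \<open>S\<close> to
  \<open>v s\<close>.\<close>

definition lin_comb :: "('a, 'b) module \<Rightarrow> 's set \<Rightarrow> ('s \<Rightarrow> 'b) \<Rightarrow> ('s \<Rightarrow> 'a) \<Rightarrow> 'b" where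
  "lin_comb M S v f = (\<Oplus>\<^bsub>M\<^esub>s\<in>S. f s \<odot>\<^bsub>M\<^esub> v s)"

lemma lin_comb_hom:
  assumes "right_module R M" "finite S" "v \<in> S \<rightarrow> carrier M"
  shows "lin_comb M S v \<in> mod_hom R (free_mod R S) M"
proof -
  interpret right_module R M by fact
  have cl: "(\<lambda>s. f s \<odot>\<^bsub>M\<^esub> v s) \<in> S \<rightarrow> carrier M" if "f \<in> S \<rightarrow>\<^sub>E carrier R" for f
    using that assms(3) by (auto simp: PiE_iff Pi_iff)
  show ?thesis
  proof (rule mod_homI)
    fix f assume f: "f \<in> carrier (free_mod R S)"
    then show "lin_comb M S v f \<in> carrier M"
      unfolding lin_comb_def using cl[of f] by (auto intro: M.finsum_closed)
    { fix g assume g: "g \<in> carrier (free_mod R S)"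
      have "(\<Oplus>\<^bsub>M\<^esub>s\<in>S. (f \<oplus>\<^bsub>free_mod R S\<^esub> g) s \<odot>\<^bsub>M\<^esub> v s)
          = (\<Oplus>\<^bsub>M\<^esub>s\<in>S. f s \<odot>\<^bsub>M\<^esub> v s \<oplus>\<^bsub>M\<^esub> g s \<odot>\<^bsub>M\<^esub> v s)"
        by (rule M.finsum_cong') (use f g assms(3) in \<open>auto simp: smult_l_distr Pi_iff PiE_iff\<close>)
      then show "lin_comb M S v (f \<oplus>\<^bsub>free_mod R S\<^esub> g) = lin_comb M S v f \<oplus>\<^bsub>M\<^esub> lin_comb M S v g"
        unfolding lin_comb_def using cl[of f] cl[of g] f g by (simp add: M.finsum_addf) }
    fix r assume r: "r \<in> carrier R"
    have "(\<Oplus>\<^bsub>M\<^esub>s\<in>S. (r \<odot>\<^bsub>free_mod R S\<^esub> f) s \<odot>\<^bsub>M\<^esub> v s) = (\<Oplus>\<^bsub>M\<^esub>s\<in>S. r \<odot>\<^bsub>M\<^esub> (f s \<odot>\<^bsub>M\<^esub> v s))"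
      by (rule M.finsum_cong') (use f r assms(3) in \<open>auto simp: smult_assoc Pi_iff PiE_iff\<close>)
    then show "lin_comb M S v (r \<odot>\<^bsub>free_mod R S\<^esub> f) = r \<odot>\<^bsub>M\<^esub> lin_comb M S v f"
      unfolding lin_comb_def using smult_finsum[OF assms(2) cl[of f] r] f by simp
  qed
qed

lemma lin_comb_basis:
  assumes "right_module R M" "finite S" "v \<in> S \<rightarrow> carrier M" "t \<in> S"
  shows "lin_comb M S v (free_basis R S t) = v t"
proof -
  interpret right_module R M by fact
  have "lin_comb M S v (free_basis R S t)
      = (\<Oplus>\<^bsub>M\<^esub>s\<in>S. (if s = t then \<one>\<^bsub>R\<^esub> else \<zero>\<^bsub>R\<^esub>) \<odot>\<^bsub>M\<^esub> v s)"
    unfolding lin_comb_def free_basis_def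
    by (rule M.finsum_cong') (use assms(3) in \<open>auto simp: Pi_iff\<close>)
  then show ?thesis using finsum_delta[OF assms(2-4)] by simp
qed

text \<open>The equalizer of two homomorphisms is a submodule.\<close>

lemma mod_hom_eq_on_gen:
  assumes "right_module R M" "right_module R N" "f \<in> mod_hom R M N" "g \<in> mod_hom R M N"
    and "gen_by R M S (carrier M)" "\<And>s. s \<in> S \<Longrightarrow> f s = g s" "x \<in> carrier M"
  shows "f x = g x"
proof -
  interpret M: right_module R M by fact
  interpret N: right_module R N by fact
  have "submod R M {x \<in> carrier M. f x = g x}"
    unfolding submod_def
    by (auto simp: mod_homD[OF assms(3)] mod_homD[OF assms(4)] mod_hom_zero[OF assms(1,2,3)]
        mod_hom_zero[OF assms(1,2,4)])
  moreover have "S \<subseteq> {x \<in> carrier M. f x = g x}" using gen_by_subset[OF assms(5)] assms(6) by auto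
  ultimately have "carrier M \<subseteq> {x \<in> carrier M. f x = g x}" by (rule gen_by_least[OF assms(5)])
  then show ?thesis using assms(7) by blast
qed

lemma free_mod_projective:
  assumes "ring R" "finite S"
  shows "projective_mod R (free_mod R S)"
  unfolding projective_mod_def
proof (intro conjI allI impI free_mod_fg[OF assms])
  fix M N :: "('a, 'a univ) module" and g h
  assume M: "fg_module R M" and N: "fg_module R N" and g: "g \<in> mod_hom R M N" "g ` carrier M = carrier N"
    and h: "h \<in> mod_hom R (free_mod R S) N"
  have rF: "right_module R (free_mod R S)" by (rule free_mod_right_module) fact
  have "\<exists>m. m \<in> carrier M \<and> g m = h (free_basis R S s)" if "s \<in> S" for s
  proof -
    have "h (free_basis R S s) \<in> carrier N"
      by (rule mod_hom_closed[OF h free_basis_closed[OF assms(1)]])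
    then have "h (free_basis R S s) \<in> g ` carrier M" using g(2) by simp
    then show ?thesis by (metis imageE)
  qed
  then obtain m where m: "\<And>s. s \<in> S \<Longrightarrow> m s \<in> carrier M" "\<And>s. s \<in> S \<Longrightarrow> g (m s) = h (free_basis R S s)"
    by metis
  have mS: "m \<in> S \<rightarrow> carrier M" using m(1) by blast
  let ?l = "lin_comb M S m"
  have l: "?l \<in> mod_hom R (free_mod R S) M" by (rule lin_comb_hom[OF fg_right_module[OF M] assms(2) mS])
  have "g (?l x) = h x" if x: "x \<in> carrier (free_mod R S)" for x
  proof (rule mod_hom_eq_on_gen[OF rF fg_right_module[OF N] mod_hom_comp'[OF l g(1)] h
        free_mod_gen[OF assms] _ x])
    fix t assume "t \<in> free_basis R S ` S"
    then show "g (?l t) = h t"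
      using m(2) lin_comb_basis[OF fg_right_module[OF M] assms(2) mS] by auto
  qed
  with l show "\<exists>l\<in>mod_hom R (free_mod R S) M. \<forall>x\<in>carrier (free_mod R S). g (l x) = h x" by blast
qed

section \<open>Lifting and factoring homomorphisms between modules of any carrier type\<close>

lemma fg_module_representativeE:
  fixes M :: "('a, 'b) module"
  assumes "fg_module R M"
  obtains N :: "('a, 'a univ) module" and i j where "fg_module R N"
    "i \<in> mod_hom R M N" "j \<in> mod_hom R N M"
    "\<And>x. x \<in> carrier M \<Longrightarrow> j (i x) = x" "\<And>y. y \<in> carrier N \<Longrightarrow> i (j y) = y"
proof -
  obtain N :: "('a, 'a univ) module" and i where N: "fg_module R N" "i \<in> mod_hom R M N"
    "bij_betw i (carrier M) (carrier N)"
    using fg_module_representative[OF assms] unfolding mod_iso_def by blast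
  show ?thesis
    by (rule that[OF N(1,2) mod_hom_inv[OF fg_right_module[OF assms] fg_right_module[OF N(1)] N(2,3)]])
      (simp_all add: bij_betw_inv_into_left[OF N(3)] bij_betw_inv_into_right[OF N(3)])
qed

text \<open>\<open>projective_mod\<close> tests only surjections between modules on the type
  \<open>univ\<close>. Here the target is first cut down to the image of \<open>g\<close>, which is
  finitely generated, and then both modules are replaced by isomorphic copies on that type.\<close>

lemma projective_lift:
  fixes P :: "('a, 'p) module" and M :: "('a, 'b) module" and N :: "('a, 'c) module"
  assumes P: "projective_mod R P" and M: "fg_module R M" and N: "right_module R N"
    and g: "g \<in> mod_hom R M N" and h: "h \<in> mod_hom R P N" and sub: "h ` carrier P \<subseteq> g ` carrier M"
  obtains l where "l \<in> mod_hom R P M" "\<And>x. x \<in> carrier P \<Longrightarrow> g (l x) = h x"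
proof -
  interpret N: right_module R N by fact
  let ?N = "N\<lparr>carrier := g ` carrier M\<rparr>"
  note rM = fg_right_module[OF M]
  interpret M: right_module R M by fact
  have "submod R N (g ` carrier M)" by (rule submod_image[OF rM N g M.submod_self])
  then have rN: "right_module R ?N" by (rule N.submod_right_module)
  have g': "g \<in> mod_hom R M ?N" using g by (auto simp: mod_hom_def)
  have fN: "fg_module R ?N" by (rule fg_module_image[OF M rN g']) simp
  have h': "h \<in> mod_hom R P ?N" using h sub by (auto simp: mod_hom_def)
  obtain M' :: "('a, 'a univ) module" and i j where M': "fg_module R M'"
    "i \<in> mod_hom R M M'" "j \<in> mod_hom R M' M"
    "\<And>x. x \<in> carrier M \<Longrightarrow> j (i x) = x" "\<And>y. y \<in> carrier M' \<Longrightarrow> i (j y) = y"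
    by (rule fg_module_representativeE[OF M]) (rule that; assumption)
  obtain N' :: "('a, 'a univ) module" and i' j' where N': "fg_module R N'"
    "i' \<in> mod_hom R ?N N'" "j' \<in> mod_hom R N' ?N"
    "\<And>x. x \<in> carrier ?N \<Longrightarrow> j' (i' x) = x" "\<And>y. y \<in> carrier N' \<Longrightarrow> i' (j' y) = y"
    by (rule fg_module_representativeE[OF fN]) (rule that; assumption)
  have gg: "(\<lambda>x. i' (g (j x))) \<in> mod_hom R M' N'"
    by (rule mod_hom_comp'[OF mod_hom_comp'[OF M'(3) g'] N'(2)])
  have "carrier N' \<subseteq> (\<lambda>x. i' (g (j x))) ` carrier M'"
  proof
    fix y assume y: "y \<in> carrier N'"
    then have "j' y \<in> g ` carrier M" using mod_hom_closed[OF N'(3) y] by simp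
    then obtain x where x: "x \<in> carrier M" "j' y = g x" by auto
    have "i' (g (j (i x))) = y" unfolding M'(4)[OF x(1)] x(2)[symmetric] by (rule N'(5)[OF y])
    then show "y \<in> (\<lambda>x. i' (g (j x))) ` carrier M'"
      using imageI[OF mod_hom_closed[OF M'(2) x(1)], of "\<lambda>x. i' (g (j x))"] by simp
  qed
  then have surj: "(\<lambda>x. i' (g (j x))) ` carrier M' = carrier N'"
    using mod_hom_closed[OF gg] by blast
  have hh: "(\<lambda>x. i' (h x)) \<in> mod_hom R P N'" by (rule mod_hom_comp'[OF h' N'(2)])
  have "\<exists>l\<in>mod_hom R P M'. \<forall>x\<in>carrier P. i' (g (j (l x))) = i' (h x)"
    using P[unfolded projective_mod_def, THEN conjunct2, rule_format, OF M'(1) N'(1) gg surj hh] .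
  then obtain l where l: "l \<in> mod_hom R P M'" "\<forall>x\<in>carrier P. i' (g (j (l x))) = i' (h x)" by blast
  have "g (j (l x)) = h x" if x: "x \<in> carrier P" for x
  proof -
    have "g (j (l x)) \<in> carrier ?N" "h x \<in> carrier ?N"
      using mod_hom_closed[OF g' mod_hom_closed[OF M'(3) mod_hom_closed[OF l(1) x]]]
        mod_hom_closed[OF h' x] by auto
    then show ?thesis using l(2) x N'(4) by metis
  qed
  then show ?thesis by (rule that[OF mod_hom_comp'[OF l(1) M'(3)]])
qed

text \<open>The value at \<open>w\<close> is that of \<open>h\<close> at a chosen preimage under
  \<open>q\<close>. Two preimages differ by an element killed by \<open>q\<close>, hence by
  \<open>h\<close>, so any other preimage gives the same value.\<close>

lemma mod_hom_factor_surj: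
  assumes rm: "right_module R M" "right_module R W" "right_module R N"
    and q: "q \<in> mod_hom R M W" "q ` carrier M = carrier W" and h: "h \<in> mod_hom R M N"
    and ker: "\<And>x. x \<in> carrier M \<Longrightarrow> q x = \<zero>\<^bsub>W\<^esub> \<Longrightarrow> h x = \<zero>\<^bsub>N\<^esub>"
  obtains g where "g \<in> mod_hom R W N" "\<And>x. x \<in> carrier M \<Longrightarrow> g (q x) = h x"
proof -
  interpret M: right_module R M by fact
  interpret W: right_module R W by fact
  interpret N: right_module R N by fact
  define g where "g w = h (inv_into (carrier M) q w)" for w
  have g: "g (q x) = h x" if x: "x \<in> carrier M" for x
  proof -
    let ?y = "inv_into (carrier M) q (q x)"
    have y: "?y \<in> carrier M" "q ?y = q x" using x by (auto intro: inv_into_into f_inv_into_f)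
    have "q (?y \<ominus>\<^bsub>M\<^esub> x) = \<zero>\<^bsub>W\<^esub>"
      using x y mod_hom_minus[OF rm(1,2) q(1)] mod_hom_closed[OF q(1)] by (simp add: W.minus_eq_iff)
    then have "h ?y \<ominus>\<^bsub>N\<^esub> h x = \<zero>\<^bsub>N\<^esub>"
      using ker[of "?y \<ominus>\<^bsub>M\<^esub> x"] x y mod_hom_minus[OF rm(1,3) h] by simp
    then show ?thesis using x y mod_hom_closed[OF h] by (simp add: N.minus_eq_iff g_def)
  qed
  have ex: "\<exists>x\<in>carrier M. w = q x" if "w \<in> carrier W" for w using that q(2) by blast
  have "g \<in> mod_hom R W N"
  proof (rule mod_homI)
    fix w assume "w \<in> carrier W"
    then obtain x where x: "x \<in> carrier M" "w = q x" using ex by blast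
    then show "g w \<in> carrier N" using g mod_hom_closed[OF h] by simp
    { fix w' assume "w' \<in> carrier W"
      then obtain y where y: "y \<in> carrier M" "w' = q y" using ex by blast
      have "w \<oplus>\<^bsub>W\<^esub> w' = q (x \<oplus>\<^bsub>M\<^esub> y)" using x y by (simp add: mod_hom_add[OF q(1)])
      then show "g (w \<oplus>\<^bsub>W\<^esub> w') = g w \<oplus>\<^bsub>N\<^esub> g w'" using x y g by (simp add: mod_hom_add[OF h]) }
    fix r assume r: "r \<in> carrier R"
    have "r \<odot>\<^bsub>W\<^esub> w = q (r \<odot>\<^bsub>M\<^esub> x)" using x r by (simp add: mod_hom_smult[OF q(1)])
    then show "g (r \<odot>\<^bsub>W\<^esub> w) = r \<odot>\<^bsub>N\<^esub> g w" using x r g by (simp add: mod_hom_smult[OF h])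
  qed
  then show ?thesis using g by (rule that)
qed

text \<open>Says that \<open>q\<close> is a cokernel of \<open>arr V\<close>. The arguments about
  cokernels use this property alone, so they cover at once the coset modules \<open>Cok X\<close>
  and the test modules with a free presentation.\<close>

definition presents :: "'a ring \<Rightarrow> ('a, 'b, 'c) mor_obj \<Rightarrow> ('c \<Rightarrow> 'w) \<Rightarrow> ('a, 'w) module \<Rightarrow> bool" where
  "presents R V q W \<longleftrightarrow> q \<in> mod_hom R (tgt V) W \<and> q ` carrier (tgt V) = carrier W \<and>
     im_arr V = {x \<in> carrier (tgt V). q x = \<zero>\<^bsub>W\<^esub>}"

lemma presentsD:
  assumes "presents R V q W"
  shows presents_hom: "q \<in> mod_hom R (tgt V) W"
    and presents_surj: "q ` carrier (tgt V) = carrier W"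
    and presents_arr: "x \<in> carrier (src V) \<Longrightarrow> q (arr V x) = \<zero>\<^bsub>W\<^esub>"
    and presents_kernel: "y \<in> carrier (tgt V) \<Longrightarrow> q y = \<zero>\<^bsub>W\<^esub> \<Longrightarrow> \<exists>x\<in>carrier (src V). y = arr V x"
    and presents_ex: "w \<in> carrier W \<Longrightarrow> \<exists>y\<in>carrier (tgt V). w = q y"
proof -
  have surj: "carrier W = q ` carrier (tgt V)" using assms by (simp add: presents_def)
  have im: "arr V ` carrier (src V) = {x \<in> carrier (tgt V). q x = \<zero>\<^bsub>W\<^esub>}"
    using assms by (simp add: presents_def im_arr_def)
  show "x \<in> carrier (src V) \<Longrightarrow> q (arr V x) = \<zero>\<^bsub>W\<^esub>" using im by blast
  show "y \<in> carrier (tgt V) \<Longrightarrow> q y = \<zero>\<^bsub>W\<^esub> \<Longrightarrow> \<exists>x\<in>carrier (src V). y = arr V x"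
    using im by (metis (mono_tags, lifting) imageE mem_Collect_eq)
  show "w \<in> carrier W \<Longrightarrow> \<exists>y\<in>carrier (tgt V). w = q y"
    using surj by auto
qed (use assms in \<open>simp_all add: presents_def\<close>)

lemma Cok_presents:
  assumes "in_H R X"
  shows "presents R X (\<lambda>y. im_arr X +>\<^bsub>tgt X\<^esub> y) (Cok X)"
proof -
  interpret I: abelian_subgroup "im_arr X" "tgt X" by (rule im_arr_subgroup) fact
  have z: "\<zero>\<^bsub>Cok X\<^esub> = im_arr X" by (simp add: Cok_def Let_def)
  have "im_arr X +>\<^bsub>tgt X\<^esub> y = im_arr X \<longleftrightarrow> y \<in> im_arr X" if "y \<in> carrier (tgt X)" for y
    using I.a_rcos_self[OF that] I.a_rcos_const by blast
  then have "im_arr X = {y \<in> carrier (tgt X). im_arr X +>\<^bsub>tgt X\<^esub> y = \<zero>\<^bsub>Cok X\<^esub>}"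
    using I.a_subset unfolding z by blast
  then show ?thesis
    using Cok_fg_module(2)[OF assms] Cok_simps(1)[OF assms] by (simp add: presents_def)
qed

text \<open>Take a free module on generators of \<open>W\<close>, and another on generators of the
  kernel of the resulting surjection; that finitely many suffice for the kernel is where the Artin
  algebra enters. The second free module is indexed by elements of the first, whence the carrier
  types.\<close>

lemma presentation_exists:
  fixes W :: "('a, 'w) module"
  assumes art: "artin_algebra k \<Lambda> i" and W: "fg_module \<Lambda> W"
  obtains V :: "('a, ('w \<Rightarrow> 'a) \<Rightarrow> 'a, 'w \<Rightarrow> 'a) mor_obj" and q where "in_P \<Lambda> V" "presents \<Lambda> V q W"
proof -
  interpret artin_algebra k \<Lambda> i by fact
  interpret W: right_module \<Lambda> W by (rule fg_right_module) fact
  note r = \<Lambda>.ring_axioms and rW = W.right_module_axioms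
  have "fg_sub \<Lambda> W (carrier W)" using W by (simp add: fg_module_iff)
  then obtain S where S: "finite S" "gen_by \<Lambda> W S (carrier W)" by (rule fg_subE)
  let ?F = "free_mod \<Lambda> S" and ?q = "lin_comb W S (\<lambda>s. s)"
  have SW: "(\<lambda>s. s) \<in> S \<rightarrow> carrier W" using gen_by_subset[OF S(2)] by blast
  note rF = free_mod_right_module[OF r, of S]
  interpret F: right_module \<Lambda> ?F by (rule rF)
  have q: "?q \<in> mod_hom \<Lambda> ?F W" by (rule lin_comb_hom[OF rW S(1) SW])
  \<comment> \<open>Stated for a submodule \<open>K\<close> of an arbitrary \<open>N\<close>, since
    it is applied both to the whole of \<open>W\<close> and to the kernel inside the free
    module.\<close>
  have surj: "lin_comb N T (\<lambda>s. s) ` carrier (free_mod \<Lambda> T) = K"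
    if N: "right_module \<Lambda> N" and T: "finite T" "gen_by \<Lambda> N T K" and K: "submod \<Lambda> N K"
    for N :: "('a, 'n) module" and T K
  proof
    interpret N: right_module \<Lambda> N by fact
    interpret G: right_module \<Lambda> "free_mod \<Lambda> T" by (rule free_mod_right_module[OF r])
    have TK: "T \<subseteq> K" by (rule gen_by_subset[OF T(2)])
    then have TN: "(\<lambda>s. s) \<in> T \<rightarrow> carrier N" using submod_subset[OF K] by blast
    show "lin_comb N T (\<lambda>s. s) ` carrier (free_mod \<Lambda> T) \<subseteq> K"
      unfolding lin_comb_def
      using TK submod_smult[OF K] by (auto intro!: N.submod_finsum[OF K T(1)] simp: PiE_iff)
    show "K \<subseteq> lin_comb N T (\<lambda>s. s) ` carrier (free_mod \<Lambda> T)"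
    proof (rule gen_by_least[OF T(2)])
      show "submod \<Lambda> N (lin_comb N T (\<lambda>s. s) ` carrier (free_mod \<Lambda> T))"
        by (rule submod_image[OF free_mod_right_module[OF r] N lin_comb_hom[OF N T(1) TN] G.submod_self])
      show "T \<subseteq> lin_comb N T (\<lambda>s. s) ` carrier (free_mod \<Lambda> T)"
      proof
        fix t assume "t \<in> T"
        then have "t = lin_comb N T (\<lambda>s. s) (free_basis \<Lambda> T t)"
          using lin_comb_basis[OF N T(1) TN] by simp
        then show "t \<in> lin_comb N T (\<lambda>s. s) ` carrier (free_mod \<Lambda> T)"
          by (rule image_eqI[OF _ free_basis_closed[OF r]])
      qed
    qed
  qed
  let ?K = "{x \<in> carrier ?F. ?q x = \<zero>\<^bsub>W\<^esub>}"
  have K: "submod \<Lambda> ?F ?K" by (rule submod_kernel[OF rF rW q])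
  have "fg_sub \<Lambda> ?F ?K" by (rule artin_algebra_fg_sub[OF art free_mod_fg[OF r S(1)] K])
  then obtain T where T: "finite T" "gen_by \<Lambda> ?F T ?K" by (rule fg_subE)
  have TF: "(\<lambda>s. s) \<in> T \<rightarrow> carrier ?F" using gen_by_subset[OF T(2)] by blast
  let ?V = "\<lparr>src = free_mod \<Lambda> T, tgt = ?F, arr = lin_comb ?F T (\<lambda>s. s)\<rparr>"
  have "in_P \<Lambda> ?V"
    using free_mod_projective[OF r T(1)] free_mod_projective[OF r S(1)]
      free_mod_fg[OF r T(1)] free_mod_fg[OF r S(1)] lin_comb_hom[OF rF T(1) TF]
    by (simp add: in_P_def in_H_def)
  moreover have "presents \<Lambda> ?V ?q W"
    using q surj[OF rW S W.submod_self] surj[OF rF T K] by (simp add: presents_def im_arr_def)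
  ultimately show ?thesis by (rule that)
qed

lemma in_PD:
  assumes "in_P R X"
  shows "in_H R X" "projective_mod R (src X)" "projective_mod R (tgt X)"
    "fg_module R (src X)" "fg_module R (tgt X)" "right_module R (src X)" "right_module R (tgt X)"
    "arr X \<in> mod_hom R (src X) (tgt X)"
  using assms by (simp_all add: in_P_def in_H_def fg_right_module)

lemma mor_homD:
  assumes "\<sigma> \<in> mor_hom R X Y"
  shows "fst \<sigma> \<in> mod_hom R (src X) (src Y)" "snd \<sigma> \<in> mod_hom R (tgt X) (tgt Y)"
    "x \<in> carrier (src X) \<Longrightarrow> snd \<sigma> (arr X x) = arr Y (fst \<sigma> x)"
  using assms by (auto simp: mor_hom_def)

text \<open>Fullness of the cokernel functor. Projectivity is used twice: \<open>g q\<close> lifts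
  along \<open>p\<close>, and the lift composed with \<open>arr V\<close> lands in the kernel of
  \<open>p\<close>, which is the image of \<open>arr Z\<close>, so that it lifts once more along
  \<open>arr Z\<close>.\<close>

lemma presentation_lift:
  assumes V: "in_P R V" and Z: "in_P R Z" and q: "presents R V q W" and p: "presents R Z p N"
    and rm: "right_module R W" "right_module R N" and g: "g \<in> mod_hom R W N"
  obtains \<tau> where "\<tau> \<in> mor_hom R V Z" "\<And>x. x \<in> carrier (tgt V) \<Longrightarrow> p (snd \<tau> x) = g (q x)"
proof -
  note V' = in_PD[OF V] and Z' = in_PD[OF Z] and q' = presentsD[OF q] and p' = presentsD[OF p]
  have gq: "(\<lambda>x. g (q x)) \<in> mod_hom R (tgt V) N" by (rule mod_hom_comp'[OF q'(1) g])
  have "(\<lambda>x. g (q x)) ` carrier (tgt V) \<subseteq> p ` carrier (tgt Z)"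
    unfolding p'(2) using mod_hom_closed[OF gq] by blast
  then obtain t where t: "t \<in> mod_hom R (tgt V) (tgt Z)" "\<And>x. x \<in> carrier (tgt V) \<Longrightarrow> p (t x) = g (q x)"
    by (rule projective_lift[OF V'(3) Z'(5) rm(2) p'(1) gq]) (rule that; assumption)
  have ta: "(\<lambda>x. t (arr V x)) \<in> mod_hom R (src V) (tgt Z)" by (rule mod_hom_comp'[OF V'(8) t(1)])
  have "(\<lambda>x. t (arr V x)) ` carrier (src V) \<subseteq> arr Z ` carrier (src Z)"
  proof safe
    fix x assume x: "x \<in> carrier (src V)"
    have "p (t (arr V x)) = \<zero>\<^bsub>N\<^esub>"
      using t(2) mod_hom_closed[OF V'(8) x] q'(3)[OF x] mod_hom_zero[OF rm g] by simp
    then show "t (arr V x) \<in> arr Z ` carrier (src Z)"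
      using p'(4) mod_hom_closed[OF ta x] by blast
  qed
  then obtain s where s: "s \<in> mod_hom R (src V) (src Z)"
    "\<And>x. x \<in> carrier (src V) \<Longrightarrow> arr Z (s x) = t (arr V x)"
    by (rule projective_lift[OF V'(2) Z'(4,7,8) ta]) (rule that; assumption)
  show ?thesis
    by (rule that[of "(s, t)"]) (use s t in \<open>simp_all add: mor_hom_def\<close>)
qed

text \<open>Functoriality for arbitrary choices of cokernels: a commutative square maps the image of
  \<open>arr V\<close> into that of \<open>arr Z\<close>.\<close>

lemma presentation_descend:
  assumes V: "in_P R V" and Z: "in_P R Z" and q: "presents R V q W" and p: "presents R Z p N"
    and rm: "right_module R W" "right_module R N" and \<tau>: "\<tau> \<in> mor_hom R V Z"
  obtains g where "g \<in> mod_hom R W N" "\<And>x. x \<in> carrier (tgt V) \<Longrightarrow> g (q x) = p (snd \<tau> x)"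
proof -
  note V' = in_PD[OF V] and Z' = in_PD[OF Z] and q' = presentsD[OF q] and p' = presentsD[OF p]
  note t = mor_homD[OF \<tau>]
  have pt: "(\<lambda>x. p (snd \<tau> x)) \<in> mod_hom R (tgt V) N" by (rule mod_hom_comp'[OF t(2) p'(1)])
  have ker: "p (snd \<tau> y) = \<zero>\<^bsub>N\<^esub>" if y: "y \<in> carrier (tgt V)" "q y = \<zero>\<^bsub>W\<^esub>" for y
  proof -
    obtain x where x: "x \<in> carrier (src V)" "y = arr V x" using q'(4)[OF y] by blast
    then show ?thesis using t(3) p'(3) mod_hom_closed[OF t(1)] by simp
  qed
  show ?thesis
    by (rule mod_hom_factor_surj[OF V'(7) rm q'(1,2) pt ker]) (assumption | rule that; assumption)+
qed

section \<open>Almost split morphisms against objects of any carrier type\<close>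

lemma mor_comp_hom:
  assumes "\<sigma> \<in> mor_hom R X Y" "\<tau> \<in> mor_hom R Y Z"
  shows "mor_comp \<tau> \<sigma> \<in> mor_hom R X Z"
  using mor_homD[OF assms(1)] mor_homD[OF assms(2)] mod_hom_closed[OF mor_homD(1)[OF assms(1)]]
  by (simp add: mor_hom_def mor_comp_def mod_hom_comp)

text \<open>The definition tests only objects on the type \<open>univ\<close>. With a copy
  \<open>W'\<close> on this type and \<open>b a = id\<close>, a section of \<open>\<tau> b\<close>
  composed with \<open>b\<close> is a section of \<open>\<tau>\<close>; thus \<open>\<tau> b\<close>
  inherits that it does not split, and its factorization is pulled back along
  \<open>a\<close>.\<close>

lemma right_almost_split_P_lift:
  fixes W :: "('a, 'u, 'v) mor_obj"
  assumes ras: "right_almost_split_P R Y \<psi> Z" and W: "in_P R W"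
    and \<tau>: "\<tau> \<in> mor_hom R W Z" "\<not> split_epi_mor R W \<tau> Z"
  obtains \<theta> where "\<theta> \<in> mor_hom R W Y" "mor_eq W (mor_comp \<psi> \<theta>) \<tau>"
proof -
  obtain W' :: "('a, 'a univ, 'a univ) mor_obj" and a b where W': "in_P R W'"
    "a \<in> mor_hom R W W'" "b \<in> mor_hom R W' W" "mor_eq W (mor_comp b a) (id, id)"
    using in_P_representative[OF W] unfolding mor_iso_def by blast
  have tb: "mor_comp \<tau> b \<in> mor_hom R W' Z" by (rule mor_comp_hom[OF W'(3) \<tau>(1)])
  have "\<not> split_epi_mor R W' (mor_comp \<tau> b) Z"
  proof
    assume "split_epi_mor R W' (mor_comp \<tau> b) Z"
    then obtain \<rho> where \<rho>: "\<rho> \<in> mor_hom R Z W'" "mor_eq Z (mor_comp (mor_comp \<tau> b) \<rho>) (id, id)"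
      by (auto simp: split_epi_mor_def)
    then have "mor_eq Z (mor_comp \<tau> (mor_comp b \<rho>)) (id, id)" by (simp add: mor_eq_def mor_comp_def)
    then show False using \<tau>(2) mor_comp_hom[OF \<rho>(1) W'(3)] by (auto simp: split_epi_mor_def)
  qed
  then obtain \<theta> where \<theta>: "\<theta> \<in> mor_hom R W' Y" "mor_eq W' (mor_comp \<psi> \<theta>) (mor_comp \<tau> b)"
    using ras W'(1) tb unfolding right_almost_split_P_def by blast
  have "mor_eq W (mor_comp \<psi> (mor_comp \<theta> a)) \<tau>"
    using \<theta>(2) W'(4) mod_hom_closed[OF mor_homD(1)[OF W'(2)]] mod_hom_closed[OF mor_homD(2)[OF W'(2)]]
    by (simp add: mor_eq_def mor_comp_def)
  then show ?thesis by (rule that[OF mor_comp_hom[OF W'(2) \<theta>(1)]])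
qed

lemma left_almost_split_P_lift:
  fixes W :: "('a, 'u, 'v) mor_obj"
  assumes las: "left_almost_split_P R X \<phi> Y" and W: "in_P R W"
    and \<tau>: "\<tau> \<in> mor_hom R X W" "\<not> split_mono_mor R X \<tau> W"
  obtains \<theta> where "\<theta> \<in> mor_hom R Y W" "mor_eq X (mor_comp \<theta> \<phi>) \<tau>"
proof -
  obtain W' :: "('a, 'a univ, 'a univ) mor_obj" and a b where W': "in_P R W'"
    "a \<in> mor_hom R W W'" "b \<in> mor_hom R W' W" "mor_eq W (mor_comp b a) (id, id)"
    using in_P_representative[OF W] unfolding mor_iso_def by blast
  have at: "mor_comp a \<tau> \<in> mor_hom R X W'" by (rule mor_comp_hom[OF \<tau>(1) W'(2)])
  have "\<not> split_mono_mor R X (mor_comp a \<tau>) W'"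
  proof
    assume "split_mono_mor R X (mor_comp a \<tau>) W'"
    then obtain \<rho> where \<rho>: "\<rho> \<in> mor_hom R W' X" "mor_eq X (mor_comp \<rho> (mor_comp a \<tau>)) (id, id)"
      by (auto simp: split_mono_mor_def)
    then have "mor_eq X (mor_comp (mor_comp \<rho> a) \<tau>) (id, id)" by (simp add: mor_eq_def mor_comp_def)
    then show False using \<tau>(2) mor_comp_hom[OF W'(2) \<rho>(1)] by (auto simp: split_mono_mor_def)
  qed
  then obtain \<theta> where \<theta>: "\<theta> \<in> mor_hom R Y W'" "mor_eq X (mor_comp \<theta> \<phi>) (mor_comp a \<tau>)"
    using las W'(1) at unfolding left_almost_split_P_def by blast
  have "mor_eq X (mor_comp (mor_comp b \<theta>) \<phi>) \<tau>"
    using \<theta>(2) W'(4) mod_hom_closed[OF mor_homD(1)[OF \<tau>(1)]] mod_hom_closed[OF mor_homD(2)[OF \<tau>(1)]]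
    by (simp add: mor_eq_def mor_comp_def)
  then show ?thesis by (rule that[OF mor_comp_hom[OF \<theta>(1) W'(3)]])
qed

section \<open>Direct sums and indecomposability\<close>

lemma mod_sum_simps [simp]:
  "carrier (mod_sum A B) = carrier A \<times> carrier B" "\<zero>\<^bsub>mod_sum A B\<^esub> = (\<zero>\<^bsub>A\<^esub>, \<zero>\<^bsub>B\<^esub>)"
  "p \<oplus>\<^bsub>mod_sum A B\<^esub> q = (fst p \<oplus>\<^bsub>A\<^esub> fst q, snd p \<oplus>\<^bsub>B\<^esub> snd q)"
  "r \<odot>\<^bsub>mod_sum A B\<^esub> p = (r \<odot>\<^bsub>A\<^esub> fst p, r \<odot>\<^bsub>B\<^esub> snd p)"
  by (simp_all add: mod_sum_def)

lemma mod_sum_right_module: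
  assumes "right_module R A" "right_module R B"
  shows "right_module R (mod_sum A B)"
proof -
  interpret A: right_module R A by fact
  interpret B: right_module R B by fact
  have "abelian_group (mod_sum A B)"
  proof (rule abelian_groupI)
    fix x assume x: "x \<in> carrier (mod_sum A B)"
    show "\<exists>y\<in>carrier (mod_sum A B). y \<oplus>\<^bsub>mod_sum A B\<^esub> x = \<zero>\<^bsub>mod_sum A B\<^esub>"
      using x by (intro bexI[of _ "(\<ominus>\<^bsub>A\<^esub> fst x, \<ominus>\<^bsub>B\<^esub> snd x)"]) (auto simp: A.M.l_neg B.M.l_neg)
  qed (auto simp: A.M.a_assoc B.M.a_assoc intro: A.M.a_comm B.M.a_comm)
  moreover have "right_module_axioms R (mod_sum A B)"
    by unfold_locales (auto simp: A.smult_l_distr A.smult_r_distr A.smult_assoc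
        B.smult_l_distr B.smult_r_distr B.smult_assoc)
  ultimately show ?thesis using A.R.ring_axioms by (simp add: right_module_def)
qed

text \<open>The biproduct form of a decomposition. Maps into or out of the two summands can then be
  added up without handling pairs.\<close>

lemma mod_iso_sumE:
  assumes M: "right_module R M" and A: "right_module R A" and B: "right_module R B"
    and iso: "mod_iso R M (mod_sum A B)"
  obtains iA iB pA pB where
    "iA \<in> mod_hom R A M" "iB \<in> mod_hom R B M" "pA \<in> mod_hom R M A" "pB \<in> mod_hom R M B"
    "\<And>a. a \<in> carrier A \<Longrightarrow> pA (iA a) = a \<and> pB (iA a) = \<zero>\<^bsub>B\<^esub>"
    "\<And>b. b \<in> carrier B \<Longrightarrow> pB (iB b) = b \<and> pA (iB b) = \<zero>\<^bsub>A\<^esub>"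
    "\<And>x. x \<in> carrier M \<Longrightarrow> iA (pA x) \<oplus>\<^bsub>M\<^esub> iB (pB x) = x"
proof -
  interpret A: right_module R A by fact
  interpret B: right_module R B by fact
  note S = mod_sum_right_module[OF A B]
  obtain m where m: "m \<in> mod_hom R M (mod_sum A B)" "bij_betw m (carrier M) (carrier (mod_sum A B))"
    using iso unfolding mod_iso_def by blast
  define n where "n = inv_into (carrier M) m"
  have n: "n \<in> mod_hom R (mod_sum A B) M" unfolding n_def by (rule mod_hom_inv[OF M S m])
  have nm: "n (m x) = x" if "x \<in> carrier M" for x
    unfolding n_def by (rule bij_betw_inv_into_left[OF m(2) that])
  have mn: "m (n y) = y" if "y \<in> carrier (mod_sum A B)" for y
    unfolding n_def by (rule bij_betw_inv_into_right[OF m(2) that])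
  have inj: "(\<lambda>a. (a, \<zero>\<^bsub>B\<^esub>)) \<in> mod_hom R A (mod_sum A B)" "(\<lambda>b. (\<zero>\<^bsub>A\<^esub>, b)) \<in> mod_hom R B (mod_sum A B)"
    and pr: "fst \<in> mod_hom R (mod_sum A B) A" "snd \<in> mod_hom R (mod_sum A B) B"
    by (auto intro!: mod_homI)
  have mx: "fst (m x) \<in> carrier A" "snd (m x) \<in> carrier B" if "x \<in> carrier M" for x
    using mod_hom_closed[OF m(1) that] by (auto simp: mem_Times_iff)
  have "n (fst (m x), \<zero>\<^bsub>B\<^esub>) \<oplus>\<^bsub>M\<^esub> n (\<zero>\<^bsub>A\<^esub>, snd (m x)) = x" if x: "x \<in> carrier M" for x
  proof -
    have "n (fst (m x), \<zero>\<^bsub>B\<^esub>) \<oplus>\<^bsub>M\<^esub> n (\<zero>\<^bsub>A\<^esub>, snd (m x))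
        = n ((fst (m x), \<zero>\<^bsub>B\<^esub>) \<oplus>\<^bsub>mod_sum A B\<^esub> (\<zero>\<^bsub>A\<^esub>, snd (m x)))"
      using mx[OF x] by (intro mod_hom_add[OF n, symmetric]) auto
    then show ?thesis using mx[OF x] nm[OF x] by simp
  qed
  then show ?thesis
    by (intro that[OF mod_hom_comp'[OF inj(1) n] mod_hom_comp'[OF inj(2) n]
          mod_hom_comp'[OF m(1) pr(1)] mod_hom_comp'[OF m(1) pr(2)]]) (simp_all add: mn)
qed

lemma mod_zeroI: "right_module R M \<Longrightarrow> (\<And>x. x \<in> carrier M \<Longrightarrow> x = \<zero>\<^bsub>M\<^esub>) \<Longrightarrow> mod_zero M"
proof -
  assume M: "right_module R M" and z: "\<And>x. x \<in> carrier M \<Longrightarrow> x = \<zero>\<^bsub>M\<^esub>"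
  interpret right_module R M by (rule M)
  show ?thesis unfolding mod_zero_def using z M.zero_closed by blast
qed

lemma mod_zeroD: "mod_zero M \<Longrightarrow> x \<in> carrier M \<Longrightarrow> x = \<zero>\<^bsub>M\<^esub>"
  by (simp add: mod_zero_def)

lemma split_epi_modI:
  "s \<in> mod_hom R N M \<Longrightarrow> (\<And>y. y \<in> carrier N \<Longrightarrow> f (s y) = y) \<Longrightarrow> split_epi_mod R M f N"
  by (auto simp: split_epi_mod_def)

lemma split_mono_modI:
  "r \<in> mod_hom R N M \<Longrightarrow> (\<And>x. x \<in> carrier M \<Longrightarrow> r (f x) = x) \<Longrightarrow> split_mono_mod R M f N"
  by (auto simp: split_mono_mod_def)

lemma right_almost_split_modE:
  fixes W :: "('a, 'a univ) module"
  assumes "right_almost_split_mod R M f N" "fg_module R W" "g \<in> mod_hom R W N" "\<not> split_epi_mod R W g N"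
  obtains h where "h \<in> mod_hom R W M" "\<And>x. x \<in> carrier W \<Longrightarrow> f (h x) = g x"
proof -
  have "\<exists>h\<in>mod_hom R W M. \<forall>x\<in>carrier W. f (h x) = g x"
    by (rule assms(1)[unfolded right_almost_split_mod_def, THEN conjunct2, rule_format, OF assms(2-4)])
  then obtain h where h: "h \<in> mod_hom R W M" and e: "\<forall>x\<in>carrier W. f (h x) = g x" by (rule bexE)
  show ?thesis by (rule that[OF h bspec[OF e]])
qed

lemma left_almost_split_modE:
  fixes W :: "('a, 'a univ) module"
  assumes "left_almost_split_mod R M f N" "fg_module R W" "g \<in> mod_hom R M W" "\<not> split_mono_mod R M g W"
  obtains h where "h \<in> mod_hom R N W" "\<And>x. x \<in> carrier M \<Longrightarrow> h (f x) = g x"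
proof -
  have "\<exists>h\<in>mod_hom R N W. \<forall>x\<in>carrier M. h (f x) = g x"
    by (rule assms(1)[unfolded left_almost_split_mod_def, THEN conjunct2, rule_format, OF assms(2-4)])
  then obtain h where h: "h \<in> mod_hom R N W" and e: "\<forall>x\<in>carrier M. h (f x) = g x" by (rule bexE)
  show ?thesis by (rule that[OF h bspec[OF e]])
qed

section \<open>Indecomposability of the ends of almost split sequences\<close>

lemma right_almost_split_indecomposable:
  assumes ras: "right_almost_split_mod R M g N" and M: "right_module R M" and N: "fg_module R N"
    and g: "g \<in> mod_hom R M N"
  shows "indecomposable_mod R N"
  unfolding indecomposable_mod_def
proof (intro conjI allI impI N)
  note rN = fg_right_module[OF N]
  interpret M: right_module R M by fact
  interpret N: right_module R N by (rule rN)
  have ns: "\<not> split_epi_mod R M g N" using ras by (simp add: right_almost_split_mod_def)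
  show "\<not> mod_zero N"
  proof
    assume z: "mod_zero N"
    have "g \<zero>\<^bsub>M\<^esub> = y" if "y \<in> carrier N" for y
      using mod_hom_zero[OF M rN g] mod_zeroD[OF z that] by simp
    then have "split_epi_mod R M g N" by (rule split_epi_modI[OF mod_hom_const_zero[OF M]])
    then show False using ns by blast
  qed
  fix A B :: "('a, 'a univ) module"
  assume A: "fg_module R A" and B: "fg_module R B" and iso: "mod_iso R N (mod_sum A B)"
  note rA = fg_right_module[OF A] and rB = fg_right_module[OF B]
  obtain iA iB pA pB where h: "iA \<in> mod_hom R A N" "iB \<in> mod_hom R B N"
      "pA \<in> mod_hom R N A" "pB \<in> mod_hom R N B"
    and 1: "\<And>a. a \<in> carrier A \<Longrightarrow> pA (iA a) = a \<and> pB (iA a) = \<zero>\<^bsub>B\<^esub>"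
    and 2: "\<And>b. b \<in> carrier B \<Longrightarrow> pB (iB b) = b \<and> pA (iB b) = \<zero>\<^bsub>A\<^esub>"
    and 3: "\<And>x. x \<in> carrier N \<Longrightarrow> iA (pA x) \<oplus>\<^bsub>N\<^esub> iB (pB x) = x"
    by (rule mod_iso_sumE[OF rN rA rB iso]) (rule that; assumption)
  show "mod_zero A \<or> mod_zero B"
  \<comment> \<open>An inclusion that is a split epimorphism is onto; composing it with the
    projection to the other summand shows that this summand is zero.\<close>
  proof (cases "split_epi_mod R A iA N \<or> split_epi_mod R B iB N")
    case True
    then show ?thesis
    proof
      assume "split_epi_mod R A iA N"
      then obtain s where s: "s \<in> mod_hom R N A" "\<forall>y\<in>carrier N. iA (s y) = y"
        by (auto simp: split_epi_mod_def)
      have "b = \<zero>\<^bsub>B\<^esub>" if b: "b \<in> carrier B" for b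
      proof -
        have ib: "iB b \<in> carrier N" by (rule mod_hom_closed[OF h(2) b])
        have "pB (iA (s (iB b))) = \<zero>\<^bsub>B\<^esub>" using 1[OF mod_hom_closed[OF s(1) ib]] by blast
        then show ?thesis using s(2) ib 2[OF b] by simp
      qed
      then show ?thesis using mod_zeroI[OF rB] by blast
    next
      assume "split_epi_mod R B iB N"
      then obtain s where s: "s \<in> mod_hom R N B" "\<forall>y\<in>carrier N. iB (s y) = y"
        by (auto simp: split_epi_mod_def)
      have "a = \<zero>\<^bsub>A\<^esub>" if a: "a \<in> carrier A" for a
      proof -
        have ia: "iA a \<in> carrier N" by (rule mod_hom_closed[OF h(1) a])
        have "pA (iB (s (iA a))) = \<zero>\<^bsub>A\<^esub>" using 2[OF mod_hom_closed[OF s(1) ia]] by blast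
        then show ?thesis using s(2) ia 1[OF a] by simp
      qed
      then show ?thesis using mod_zeroI[OF rA] by blast
    qed
  next
    case False
    then have nsA: "\<not> split_epi_mod R A iA N" and nsB: "\<not> split_epi_mod R B iB N" by simp_all
    obtain hA where hA: "hA \<in> mod_hom R A M" "\<And>x. x \<in> carrier A \<Longrightarrow> g (hA x) = iA x"
      by (rule right_almost_split_modE[OF ras A h(1) nsA]) (rule that; assumption)
    obtain hB where hB: "hB \<in> mod_hom R B M" "\<And>x. x \<in> carrier B \<Longrightarrow> g (hB x) = iB x"
      by (rule right_almost_split_modE[OF ras B h(2) nsB]) (rule that; assumption)
    note cA = mod_hom_comp'[OF h(3) hA(1)] and cB = mod_hom_comp'[OF h(4) hB(1)]
    have "g (hA (pA x) \<oplus>\<^bsub>M\<^esub> hB (pB x)) = x" if x: "x \<in> carrier N" for x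
      using hA(2) hB(2) mod_hom_closed[OF h(3) x] mod_hom_closed[OF h(4) x]
        mod_hom_closed[OF cA x] mod_hom_closed[OF cB x] 3[OF x] by (simp add: mod_hom_add[OF g])
    then have "split_epi_mod R M g N" by (rule split_epi_modI[OF mod_hom_plus[OF M cA cB]])
    then show ?thesis using ns by blast
  qed
qed

text \<open>Dual to the previous lemma, with the projections \<open>pA\<close> and \<open>pB\<close>
  in place of the inclusions: if neither is a split monomorphism, both extend along
  \<open>f\<close>, and \<open>iA hA + iB hB\<close> is a retraction of \<open>f\<close>.\<close>

lemma left_almost_split_indecomposable:
  assumes las: "left_almost_split_mod R L f M" and L: "fg_module R L" and M: "right_module R M"
    and f: "f \<in> mod_hom R L M"
  shows "indecomposable_mod R L"
  unfolding indecomposable_mod_def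
proof (intro conjI allI impI L)
  note rL = fg_right_module[OF L]
  interpret M: right_module R M by fact
  interpret L: right_module R L by (rule rL)
  have ns: "\<not> split_mono_mod R L f M" using las by (simp add: left_almost_split_mod_def)
  show "\<not> mod_zero L"
  proof
    assume z: "mod_zero L"
    have "\<zero>\<^bsub>L\<^esub> = x" if "x \<in> carrier L" for x using mod_zeroD[OF z that] by simp
    then have "split_mono_mod R L f M" by (rule split_mono_modI[OF mod_hom_const_zero[OF rL]])
    then show False using ns by blast
  qed
  fix A B :: "('a, 'a univ) module"
  assume A: "fg_module R A" and B: "fg_module R B" and iso: "mod_iso R L (mod_sum A B)"
  note rA = fg_right_module[OF A] and rB = fg_right_module[OF B]
  obtain iA iB pA pB where h: "iA \<in> mod_hom R A L" "iB \<in> mod_hom R B L"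
      "pA \<in> mod_hom R L A" "pB \<in> mod_hom R L B"
    and 1: "\<And>a. a \<in> carrier A \<Longrightarrow> pA (iA a) = a \<and> pB (iA a) = \<zero>\<^bsub>B\<^esub>"
    and 2: "\<And>b. b \<in> carrier B \<Longrightarrow> pB (iB b) = b \<and> pA (iB b) = \<zero>\<^bsub>A\<^esub>"
    and 3: "\<And>x. x \<in> carrier L \<Longrightarrow> iA (pA x) \<oplus>\<^bsub>L\<^esub> iB (pB x) = x"
    by (rule mod_iso_sumE[OF rL rA rB iso]) (rule that; assumption)
  show "mod_zero A \<or> mod_zero B"
  proof (cases "split_mono_mod R L pA A \<or> split_mono_mod R L pB B")
    case True
    then show ?thesis
    proof
      assume "split_mono_mod R L pA A"
      then obtain s where s: "s \<in> mod_hom R A L" "\<forall>x\<in>carrier L. s (pA x) = x"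
        by (auto simp: split_mono_mod_def)
      have "b = \<zero>\<^bsub>B\<^esub>" if b: "b \<in> carrier B" for b
      proof -
        have "iB b = s (pA (iB b))" using s(2) mod_hom_closed[OF h(2) b] by simp
        then have "iB b = \<zero>\<^bsub>L\<^esub>" using 2[OF b] mod_hom_zero[OF rA rL s(1)] by simp
        then show ?thesis using 2[OF b] mod_hom_zero[OF rL rB h(4)] by simp
      qed
      then show ?thesis using mod_zeroI[OF rB] by blast
    next
      assume "split_mono_mod R L pB B"
      then obtain s where s: "s \<in> mod_hom R B L" "\<forall>x\<in>carrier L. s (pB x) = x"
        by (auto simp: split_mono_mod_def)
      have "a = \<zero>\<^bsub>A\<^esub>" if a: "a \<in> carrier A" for a
      proof -
        have "iA a = s (pB (iA a))" using s(2) mod_hom_closed[OF h(1) a] by simp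
        then have "iA a = \<zero>\<^bsub>L\<^esub>" using 1[OF a] mod_hom_zero[OF rB rL s(1)] by simp
        then show ?thesis using 1[OF a] mod_hom_zero[OF rL rA h(3)] by simp
      qed
      then show ?thesis using mod_zeroI[OF rA] by blast
    qed
  next
    case False
    then have nsA: "\<not> split_mono_mod R L pA A" and nsB: "\<not> split_mono_mod R L pB B" by simp_all
    obtain hA where hA: "hA \<in> mod_hom R M A" "\<And>x. x \<in> carrier L \<Longrightarrow> hA (f x) = pA x"
      by (rule left_almost_split_modE[OF las A h(3) nsA]) (rule that; assumption)
    obtain hB where hB: "hB \<in> mod_hom R M B" "\<And>x. x \<in> carrier L \<Longrightarrow> hB (f x) = pB x"
      by (rule left_almost_split_modE[OF las B h(4) nsB]) (rule that; assumption)
    note cA = mod_hom_comp'[OF hA(1) h(1)] and cB = mod_hom_comp'[OF hB(1) h(2)]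
    have "split_mono_mod R L f M"
      by (rule split_mono_modI[OF mod_hom_plus[OF rL cA cB]]) (simp add: hA(2) hB(2) 3)
    then show ?thesis using ns by blast
  qed
qed

text \<open>Lift \<open>h r\<close> over \<open>P\<close> and restrict the lift along
  \<open>s\<close>. This covers direct summands as well as isomorphic copies of projective
  modules.\<close>

lemma projective_retract:
  fixes P :: "('a, 'p) module" and A :: "('a, 'q) module"
  assumes P: "projective_mod R P" and A: "fg_module R A"
    and s: "s \<in> mod_hom R A P" and r: "r \<in> mod_hom R P A" and rs: "\<And>a. a \<in> carrier A \<Longrightarrow> r (s a) = a"
  shows "projective_mod R A"
  unfolding projective_mod_def
proof (intro conjI allI impI A)
  fix M N :: "('a, 'a univ) module" and g h
  assume M: "fg_module R M" and N: "fg_module R N" and g: "g \<in> mod_hom R M N" "g ` carrier M = carrier N"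
    and h: "h \<in> mod_hom R A N"
  have "\<exists>l\<in>mod_hom R P M. \<forall>x\<in>carrier P. g (l x) = h (r x)"
    using P[unfolded projective_mod_def, THEN conjunct2, rule_format, OF M N g mod_hom_comp'[OF r h]] .
  then obtain l where l: "l \<in> mod_hom R P M" "\<forall>x\<in>carrier P. g (l x) = h (r x)" by blast
  have "g (l (s a)) = h a" if "a \<in> carrier A" for a
    using l(2) mod_hom_closed[OF s that] rs[OF that] by simp
  then show "\<exists>l\<in>mod_hom R A M. \<forall>x\<in>carrier A. g (l x) = h x"
    by (intro bexI[OF _ mod_hom_comp'[OF s l(1)]]) simp
qed

section \<open>Objects with zero target\<close>

lemma zero_module_facts:
  assumes "right_module R P"
  shows "fg_module R (P\<lparr>carrier := {\<zero>\<^bsub>P\<^esub>}\<rparr>)" "projective_mod R (P\<lparr>carrier := {\<zero>\<^bsub>P\<^esub>}\<rparr>)"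
proof -
  interpret right_module R P by fact
  have "fg_sub R P {\<zero>\<^bsub>P\<^esub>}" by (rule fg_subI[of "{}"]) (simp_all add: submod_def)
  then show fg: "fg_module R (P\<lparr>carrier := {\<zero>\<^bsub>P\<^esub>}\<rparr>)"
    by (rule fg_sub_fg_module[OF assms submod_zero_set])
  note rO = fg_right_module[OF fg]
  show "projective_mod R (P\<lparr>carrier := {\<zero>\<^bsub>P\<^esub>}\<rparr>)"
    unfolding projective_mod_def
  proof (intro conjI allI impI fg)
    fix M N :: "('a, 'a univ) module" and g h
    assume M: "fg_module R M" and N: "fg_module R N" and g: "g \<in> mod_hom R M N"
      and h: "h \<in> mod_hom R (P\<lparr>carrier := {\<zero>\<^bsub>P\<^esub>}\<rparr>) N"
    note rM = fg_right_module[OF M] and rN = fg_right_module[OF N]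
    have "g \<zero>\<^bsub>M\<^esub> = h \<zero>\<^bsub>P\<^esub>"
      using mod_hom_zero[OF rM rN g] mod_hom_zero[OF rO rN h] by simp
    then show "\<exists>l\<in>mod_hom R (P\<lparr>carrier := {\<zero>\<^bsub>P\<^esub>}\<rparr>) M. \<forall>x\<in>carrier (P\<lparr>carrier := {\<zero>\<^bsub>P\<^esub>}\<rparr>). g (l x) = h x"
      by (intro bexI[OF _ mod_hom_const_zero[OF rM]]) simp
  qed
qed

lemma to_zero_simps [simp]:
  "src (to_zero P) = P" "tgt (to_zero P) = P\<lparr>carrier := {\<zero>\<^bsub>P\<^esub>}\<rparr>" "arr (to_zero P) x = \<zero>\<^bsub>P\<^esub>"
  by (simp_all add: to_zero_def)

lemma to_zero_in_P:
  assumes "projective_mod R P"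
  shows "in_P R (to_zero P)"
proof -
  have P: "fg_module R P" using assms by (simp add: projective_mod_def)
  note Z = zero_module_facts[OF fg_right_module[OF P]]
  have "(\<lambda>_. \<zero>\<^bsub>P\<^esub>) \<in> mod_hom R P (P\<lparr>carrier := {\<zero>\<^bsub>P\<^esub>}\<rparr>)"
    using mod_hom_const_zero[OF fg_right_module[OF Z(1)]] by simp
  then show ?thesis using assms P Z by (simp add: in_P_def in_H_def to_zero_def)
qed

text \<open>The identity of \<open>tgt Z\<close> would factor through the zero module.\<close>

lemma split_epi_to_zero:
  assumes "split_epi_mor R (to_zero Q) \<tau> Z" "\<tau> \<in> mor_hom R (to_zero Q) Z" "right_module R Q"
    and "right_module R (tgt Z)"
  shows "mod_zero (tgt Z)"
proof (rule mod_zeroI[OF assms(4)])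
  fix y assume y: "y \<in> carrier (tgt Z)"
  obtain \<rho> where \<rho>: "\<rho> \<in> mor_hom R Z (to_zero Q)" "mor_eq Z (mor_comp \<tau> \<rho>) (id, id)"
    using assms(1) by (auto simp: split_epi_mor_def)
  have "snd \<rho> y = \<zero>\<^bsub>Q\<^esub>" using mod_hom_closed[OF mor_homD(2)[OF \<rho>(1)] y] by simp
  moreover have "snd \<tau> \<zero>\<^bsub>Q\<^esub> = \<zero>\<^bsub>tgt Z\<^esub>"
    using mod_hom_zero[OF fg_right_module[OF zero_module_facts(1)[OF assms(3)]] assms(4)]
      mor_homD(2)[OF assms(2)] by fastforce
  moreover have "snd \<tau> (snd \<rho> y) = y" using \<rho>(2) y by (simp add: mor_eq_def mor_comp_def)
  ultimately show "y = \<zero>\<^bsub>tgt Z\<^esub>" by simp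
qed

text \<open>Squares between objects with zero target commute automatically, so an isomorphism of the
  sources is enough. The lemma serves for \<open>to_zero P\<close> and for a sum of two such
  objects, whose target is a product of one-point sets.\<close>

lemma mor_iso_zero_tgt:
  assumes i: "i \<in> mod_hom R (src Z) (src V)" and j: "j \<in> mod_hom R (src V) (src Z)"
    and ij: "\<And>x. x \<in> carrier (src Z) \<Longrightarrow> j (i x) = x" "\<And>y. y \<in> carrier (src V) \<Longrightarrow> i (j y) = y"
    and r: "right_module R (tgt Z)" "right_module R (tgt V)"
    and z: "mod_zero (tgt Z)" "mod_zero (tgt V)"
    and a: "\<And>x. x \<in> carrier (src Z) \<Longrightarrow> arr Z x \<in> carrier (tgt Z)"
      "\<And>x. x \<in> carrier (src V) \<Longrightarrow> arr V x \<in> carrier (tgt V)"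
  shows "mor_iso R Z V"
  unfolding mor_iso_def
proof (intro bexI conjI)
  have a0: "arr Z x = \<zero>\<^bsub>tgt Z\<^esub>" if "x \<in> carrier (src Z)" for x by (rule mod_zeroD[OF z(1) a(1)[OF that]])
  have a1: "arr V x = \<zero>\<^bsub>tgt V\<^esub>" if "x \<in> carrier (src V)" for x by (rule mod_zeroD[OF z(2) a(2)[OF that]])
  let ?s = "(i, \<lambda>_. \<zero>\<^bsub>tgt V\<^esub>)" and ?t = "(j, \<lambda>_. \<zero>\<^bsub>tgt Z\<^esub>)"
  show "?s \<in> mor_hom R Z V"
    using i mod_hom_const_zero[OF r(2)] a1 mod_hom_closed[OF i] by (simp add: mor_hom_def)
  show "?t \<in> mor_hom R V Z"
    using j mod_hom_const_zero[OF r(1)] a0 mod_hom_closed[OF j] by (simp add: mor_hom_def)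
  show "mor_eq Z (mor_comp ?t ?s) (id, id)" "mor_eq V (mor_comp ?s ?t) (id, id)"
    using ij mod_zeroD[OF z(1)] mod_zeroD[OF z(2)] by (simp_all add: mor_eq_def mor_comp_def)
qed

text \<open>Read contrapositively, this turns the hypothesis on \<open>Z\<close> into
  \<open>tgt Z\<close> being nonzero. \<open>P\<close> is a copy of \<open>src Z\<close> on the test
  type, and a decomposition of \<open>P\<close> into \<open>A\<close> and \<open>B\<close>
  decomposes \<open>Z\<close> into \<open>A -> 0\<close> and \<open>B -> 0\<close>, whose sources
  are projective as retracts of \<open>P\<close>.\<close>

lemma indecomposable_zero_tgt:
  fixes Z :: "('a, 'f, 'g) mor_obj"
  assumes ind: "indecomposable_P R Z" and z: "mod_zero (tgt Z)"
  shows "\<exists>P :: ('a, 'a univ) module. projective_mod R P \<and> indecomposable_mod R P \<and> mor_iso R Z (to_zero P)"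
proof -
  have Z: "in_P R Z" and nz: "\<not> mor_zero Z"
    and dec: "\<And>(A :: ('a, 'a univ, 'a univ) mor_obj) (B :: ('a, 'a univ, 'a univ) mor_obj).
      in_P R A \<Longrightarrow> in_P R B \<Longrightarrow> mor_iso R Z (mor_sum A B) \<Longrightarrow> mor_zero A \<or> mor_zero B"
    using ind by (simp_all add: indecomposable_P_def)
  note Z' = in_PD[OF Z]
  obtain P :: "('a, 'a univ) module" and i j where P: "fg_module R P"
    and i: "i \<in> mod_hom R (src Z) P" and j: "j \<in> mod_hom R P (src Z)"
    and ji: "\<And>x. x \<in> carrier (src Z) \<Longrightarrow> j (i x) = x" and ij: "\<And>y. y \<in> carrier P \<Longrightarrow> i (j y) = y"
    by (rule fg_module_representativeE[OF Z'(4)]) (rule that; assumption)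
  note rP = fg_right_module[OF P]
  have pP: "projective_mod R P" by (rule projective_retract[OF Z'(2) P j i ij])
  have tz: "right_module R (A\<lparr>carrier := {\<zero>\<^bsub>A\<^esub>}\<rparr>)" if "right_module R A" for A :: "('a, 'a univ) module"
    by (rule fg_right_module[OF zero_module_facts(1)[OF that]])
  have "mor_iso R Z (to_zero P)"
    by (rule mor_iso_zero_tgt[where i = i and j = j])
      (simp_all add: i j ji ij Z'(7) tz[OF rP] z mod_hom_closed[OF Z'(8)], simp add: mod_zero_def)
  moreover have "indecomposable_mod R P"
    unfolding indecomposable_mod_def
  proof (intro conjI allI impI P)
    show "\<not> mod_zero P"
    proof
      assume zP: "mod_zero P"
      have "x = \<zero>\<^bsub>src Z\<^esub>" if x: "x \<in> carrier (src Z)" for x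
        using ji[OF x] mod_zeroD[OF zP mod_hom_closed[OF i x]] mod_hom_zero[OF rP Z'(6) j] by simp
      then have "mod_zero (src Z)" by (rule mod_zeroI[OF Z'(6)])
      then show False using nz z by (simp add: mor_zero_def)
    qed
    fix A B :: "('a, 'a univ) module"
    assume A: "fg_module R A" and B: "fg_module R B" and iso: "mod_iso R P (mod_sum A B)"
    note rA = fg_right_module[OF A] and rB = fg_right_module[OF B]
    obtain iA iB pA pB where h: "iA \<in> mod_hom R A P" "iB \<in> mod_hom R B P"
        "pA \<in> mod_hom R P A" "pB \<in> mod_hom R P B"
      and 1: "\<And>a. a \<in> carrier A \<Longrightarrow> pA (iA a) = a \<and> pB (iA a) = \<zero>\<^bsub>B\<^esub>"
      and 2: "\<And>b. b \<in> carrier B \<Longrightarrow> pB (iB b) = b \<and> pA (iB b) = \<zero>\<^bsub>A\<^esub>"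
      and "\<And>x. x \<in> carrier P \<Longrightarrow> iA (pA x) \<oplus>\<^bsub>P\<^esub> iB (pB x) = x"
      by (rule mod_iso_sumE[OF rP rA rB iso]) (rule that; assumption)
    have "projective_mod R A" by (rule projective_retract[OF pP A h(1,3)]) (simp add: 1)
    then have PA: "in_P R (to_zero A)" by (rule to_zero_in_P)
    have "projective_mod R B" by (rule projective_retract[OF pP B h(2,4)]) (simp add: 2)
    then have PB: "in_P R (to_zero B)" by (rule to_zero_in_P)
    obtain m where m: "m \<in> mod_hom R P (mod_sum A B)" "bij_betw m (carrier P) (carrier (mod_sum A B))"
      using iso unfolding mod_iso_def by blast
    have n: "inv_into (carrier P) m \<in> mod_hom R (mod_sum A B) P" (is "?n \<in> _")
      by (rule mod_hom_inv[OF rP mod_sum_right_module[OF rA rB] m])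
    have nm: "?n (m x) = x" if "x \<in> carrier P" for x by (rule bij_betw_inv_into_left[OF m(2) that])
    have mn: "m (?n y) = y" if "y \<in> carrier (mod_sum A B)" for y
      by (rule bij_betw_inv_into_right[OF m(2) that])
    have "mor_iso R Z (mor_sum (to_zero A) (to_zero B))"
    proof (rule mor_iso_zero_tgt[where i = "\<lambda>x. m (i x)" and j = "\<lambda>y. j (?n y)"])
      let ?S = "mor_sum (to_zero A) (to_zero B)"
      have S: "src ?S = mod_sum A B" "tgt ?S = mod_sum (A\<lparr>carrier := {\<zero>\<^bsub>A\<^esub>}\<rparr>) (B\<lparr>carrier := {\<zero>\<^bsub>B\<^esub>}\<rparr>)"
        "arr ?S = map_prod (arr (to_zero A)) (arr (to_zero B))" by (simp_all add: mor_sum_def)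
      show "(\<lambda>x. m (i x)) \<in> mod_hom R (src Z) (src ?S)" unfolding S by (rule mod_hom_comp'[OF i m(1)])
      show "(\<lambda>y. j (?n y)) \<in> mod_hom R (src ?S) (src Z)" unfolding S by (rule mod_hom_comp'[OF n j])
      show "j (?n (m (i x))) = x" if "x \<in> carrier (src Z)" for x
        using nm[OF mod_hom_closed[OF i that]] ji[OF that] by simp
      show "m (i (j (?n y))) = y" if "y \<in> carrier (src ?S)" for y
        using that mn[of y] ij[OF mod_hom_closed[OF n, of y]] unfolding S by simp
      show "right_module R (tgt Z)" by (rule Z'(7))
      show "right_module R (tgt ?S)" unfolding S by (rule mod_sum_right_module[OF tz[OF rA] tz[OF rB]])
      show "mod_zero (tgt Z)" by (rule z)
      show "mod_zero (tgt ?S)" unfolding S by (auto simp: mod_zero_def)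
      show "arr Z x \<in> carrier (tgt Z)" if "x \<in> carrier (src Z)" for x by (rule mod_hom_closed[OF Z'(8) that])
      show "arr ?S x \<in> carrier (tgt ?S)" for x unfolding S by (cases x) simp
    qed
    then have "mor_zero (to_zero A) \<or> mor_zero (to_zero B)" by (rule dec[OF PA PB])
    then show "mod_zero A \<or> mod_zero B" by (auto simp: mor_zero_def)
  qed
  ultimately show ?thesis using pP by blast
qed

section \<open>Cokernels of almost split sequences\<close>

context
  fixes k :: "'k ring" and \<Lambda> :: "'a ring" and \<iota> :: "'k \<Rightarrow> 'a"
    and X :: "('a, 'b, 'c) mor_obj" and Y :: "('a, 'd, 'e) mor_obj" and Z :: "('a, 'f, 'g) mor_obj"
    and \<phi> :: "('b \<Rightarrow> 'd) \<times> ('c \<Rightarrow> 'e)" and \<psi> :: "('d \<Rightarrow> 'f) \<times> ('e \<Rightarrow> 'g)"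
  assumes artin: "artin_algebra k \<Lambda> \<iota>"
    and ass: "almost_split_sequence_P \<Lambda> X \<phi> Y \<psi> Z"
    and tgt_nonzero: "\<not> mod_zero (tgt Z)"
begin

lemma sequence_facts:
  shows XYZ: "in_P \<Lambda> X" "in_P \<Lambda> Y" "in_P \<Lambda> Z"
    and hom: "\<phi> \<in> mor_hom \<Lambda> X Y" "\<psi> \<in> mor_hom \<Lambda> Y Z"
    and las: "left_almost_split_P \<Lambda> X \<phi> Y" and ras: "right_almost_split_P \<Lambda> Y \<psi> Z"
    and exact: "short_exact_mod \<Lambda> (src X) (fst \<phi>) (src Y) (fst \<psi>) (src Z)"
      "short_exact_mod \<Lambda> (tgt X) (snd \<phi>) (tgt Y) (snd \<psi>) (tgt Z)"
  using ass by (simp_all add: almost_split_sequence_P_def short_exact_P_def)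

lemmas X = in_PD[OF XYZ(1)] and Y = in_PD[OF XYZ(2)] and Z = in_PD[OF XYZ(3)]
lemmas \<phi> = mor_homD[OF hom(1)] and \<psi> = mor_homD[OF hom(2)]

lemma
  shows \<psi>_surj: "fst \<psi> ` carrier (src Y) = carrier (src Z)" "snd \<psi> ` carrier (tgt Y) = carrier (tgt Z)"
    and \<phi>_ker: "fst \<phi> ` carrier (src X) = {x \<in> carrier (src Y). fst \<psi> x = \<zero>\<^bsub>src Z\<^esub>}"
      "snd \<phi> ` carrier (tgt X) = {x \<in> carrier (tgt Y). snd \<psi> x = \<zero>\<^bsub>tgt Z\<^esub>}"
    and \<phi>_inj: "inj_on (snd \<phi>) (carrier (tgt X))"
  using exact by (simp_all add: short_exact_mod_def)

text \<open>The morphism \<open>(Q \<rightarrow> 0) \<rightarrow> Z\<close> given by \<open>h\<close> is not a split epimorphism, so it factors through \<open>\<psi>\<close>.\<close>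

lemma kernel_lift:
  assumes Q: "projective_mod \<Lambda> Q" and h: "h \<in> mod_hom \<Lambda> Q (src Z)"
    and ker: "\<And>x. x \<in> carrier Q \<Longrightarrow> arr Z (h x) = \<zero>\<^bsub>tgt Z\<^esub>"
  obtains l where "l \<in> mod_hom \<Lambda> Q (src Y)" "\<And>x. x \<in> carrier Q \<Longrightarrow> fst \<psi> (l x) = h x"
    "\<And>x. x \<in> carrier Q \<Longrightarrow> arr Y (l x) = \<zero>\<^bsub>tgt Y\<^esub>"
proof -
  have rQ: "right_module \<Lambda> Q" using Q by (simp add: projective_mod_def fg_right_module)
  let ?\<tau> = "(h, \<lambda>_. \<zero>\<^bsub>tgt Z\<^esub>)"
  have \<tau>: "?\<tau> \<in> mor_hom \<Lambda> (to_zero Q) Z"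
    using h ker mod_hom_const_zero[OF Z(7)] by (simp add: mor_hom_def)
  have "\<not> split_epi_mor \<Lambda> (to_zero Q) ?\<tau> Z"
    using split_epi_to_zero[OF _ \<tau> rQ Z(7)] tgt_nonzero by blast
  then obtain \<theta> where \<theta>: "\<theta> \<in> mor_hom \<Lambda> (to_zero Q) Y" "mor_eq (to_zero Q) (mor_comp \<psi> \<theta>) ?\<tau>"
    by (rule right_almost_split_P_lift[OF ras to_zero_in_P[OF Q] \<tau>])
  note t = mor_homD[OF \<theta>(1), simplified]
  have "snd \<theta> \<zero>\<^bsub>Q\<^esub> = \<zero>\<^bsub>tgt Y\<^esub>"
    using mod_hom_zero[OF fg_right_module[OF zero_module_facts(1)[OF rQ]] Y(7) t(2)] by simp
  then show ?thesis
    using \<theta>(2) t(1,3) by (intro that[of "fst \<theta>"]) (simp_all add: mor_eq_def mor_comp_def)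
qed

lemma kernel_surj:
  assumes z: "z \<in> carrier (src Z)" "arr Z z = \<zero>\<^bsub>tgt Z\<^esub>"
  obtains y where "y \<in> carrier (src Y)" "fst \<psi> y = z" "arr Y y = \<zero>\<^bsub>tgt Y\<^esub>"
proof -
  interpret L: ring \<Lambda> using artin by (simp add: artin_algebra_def)
  have fin: "finite {z}" and zZ: "(\<lambda>s. s) \<in> {z} \<rightarrow> carrier (src Z)" using z by auto
  \<comment> \<open>The free module of rank one, indexed by \<open>z\<close> itself, with its basis
    vector \<open>?e\<close> sent to \<open>z\<close>. The required \<open>y\<close> is the value at
    \<open>?e\<close> of the lift to \<open>src Y\<close>.\<close>
  let ?F = "free_mod \<Lambda> {z}" and ?h = "lin_comb (src Z) {z} (\<lambda>s. s)" and ?e = "free_basis \<Lambda> {z} z"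
  note r = L.ring_axioms
  have h: "?h \<in> mod_hom \<Lambda> ?F (src Z)" by (rule lin_comb_hom[OF Z(6) fin zZ])
  note rF = free_mod_right_module[OF r, of "{z}"]
  note e = free_basis_closed[OF r, of "{z}" z]
  have he: "?h ?e = z" by (rule lin_comb_basis[OF Z(6) fin zZ]) simp
  have "arr Z (?h x) = \<zero>\<^bsub>tgt Z\<^esub>" if x: "x \<in> carrier ?F" for x
    by (rule mod_hom_eq_on_gen[OF rF Z(7) mod_hom_comp'[OF h Z(8)] mod_hom_const_zero[OF Z(7)]
          free_mod_gen[OF r fin] _ x]) (auto simp: he z(2))
  then obtain l where l: "l \<in> mod_hom \<Lambda> ?F (src Y)" "\<And>x. x \<in> carrier ?F \<Longrightarrow> fst \<psi> (l x) = ?h x"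
    "\<And>x. x \<in> carrier ?F \<Longrightarrow> arr Y (l x) = \<zero>\<^bsub>tgt Y\<^esub>"
    by (rule kernel_lift[OF free_mod_projective[OF r fin] h]) (assumption | rule that; assumption)+
  show ?thesis
    using l(2)[OF e] l(3)[OF e] he by (intro that[OF mod_hom_closed[OF l(1) e]]) simp_all
qed

text \<open>An endomorphism \<open>\<psi> \<sigma>\<close> of \<open>Z\<close> that is the identity on the cokernel differs from the identity by a
  morphism through \<open>(Z\<^sub>1 = Z\<^sub>1)\<close>, which is projective in the exact category, and one through
  \<open>(Z\<^sub>1 \<rightarrow> 0)\<close>. Both factor through \<open>\<psi>\<close>.\<close>

lemma cokernel_identity_absurd:
  assumes \<sigma>: "\<sigma> \<in> mor_hom \<Lambda> Z Y"
    and id: "\<And>z. z \<in> carrier (tgt Z) \<Longrightarrow> snd \<psi> (snd \<sigma> z) \<ominus>\<^bsub>tgt Z\<^esub> z \<in> im_arr Z"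
  shows False
proof -
  note s = mor_homD[OF \<sigma>]
  interpret Z1: right_module \<Lambda> "src Z" by (rule Z(6))
  interpret Z2: right_module \<Lambda> "tgt Z" by (rule Z(7))
  interpret Y1: right_module \<Lambda> "src Y" by (rule Y(6))
  interpret Y2: right_module \<Lambda> "tgt Y" by (rule Y(7))
  let ?a = "arr Z" and ?b = "arr Y"
  have d: "(\<lambda>z. snd \<psi> (snd \<sigma> z) \<ominus>\<^bsub>tgt Z\<^esub> z) \<in> mod_hom \<Lambda> (tgt Z) (tgt Z)"
    by (rule mod_hom_diff[OF Z(7) mod_hom_comp'[OF s(2) \<psi>(2)] mod_hom_id])
  have "(\<lambda>z. snd \<psi> (snd \<sigma> z) \<ominus>\<^bsub>tgt Z\<^esub> z) ` carrier (tgt Z) \<subseteq> ?a ` carrier (src Z)"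
    using id unfolding im_arr_def by auto
  \<comment> \<open>Projectivity of \<open>tgt Z\<close> turns the pointwise condition
    \<open>id\<close> into a single homomorphism \<open>h\<close> with
    \<open>arr Z h = \<psi> \<sigma> - 1\<close> on targets.\<close>
  then obtain h where h: "h \<in> mod_hom \<Lambda> (tgt Z) (src Z)"
    "\<And>z. z \<in> carrier (tgt Z) \<Longrightarrow> ?a (h z) = snd \<psi> (snd \<sigma> z) \<ominus>\<^bsub>tgt Z\<^esub> z"
    by (rule projective_lift[OF Z(3,4,7,8) d]) (rule that; assumption)
  have id_sub: "(\<lambda>x. x) ` carrier (src Z) \<subseteq> fst \<psi> ` carrier (src Y)" by (simp add: \<psi>_surj)
  obtain t where t: "t \<in> mod_hom \<Lambda> (src Z) (src Y)" "\<And>z. z \<in> carrier (src Z) \<Longrightarrow> fst \<psi> (t z) = z"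
    by (rule projective_lift[OF Z(2) Y(4) Z(6) \<psi>(1) mod_hom_id id_sub]) (rule that; assumption)
  note th = mod_hom_comp'[OF h(1) t(1)]
  note bth = mod_hom_comp'[OF th Y(8)]
  note tha = mod_hom_comp'[OF Z(8) th]
  \<comment> \<open>With \<open>a\<close> and \<open>b\<close> for the structure maps, the composite
    of \<open>(h a, h)\<close> from \<open>Z\<close> to \<open>(Z1 = Z1)\<close> with
    \<open>(t, b t)\<close> from there to \<open>Y\<close> is subtracted from
    \<open>\<sigma>\<close>. On targets \<open>\<psi>\<close> maps this composite to
    \<open>a h = \<psi> \<sigma> - 1\<close>, so that \<open>s2\<close> becomes a section.\<close>
  define s2 where "s2 z = snd \<sigma> z \<ominus>\<^bsub>tgt Y\<^esub> ?b (t (h z))" for z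
  define s1 where "s1 z = fst \<sigma> z \<ominus>\<^bsub>src Y\<^esub> t (h (?a z))" for z
  have s2: "s2 \<in> mod_hom \<Lambda> (tgt Z) (tgt Y)" unfolding s2_def by (rule mod_hom_diff[OF Y(7) s(2) bth])
  have s1: "s1 \<in> mod_hom \<Lambda> (src Z) (src Y)" unfolding s1_def by (rule mod_hom_diff[OF Y(6) s(1) tha])
  have s12: "s2 (?a z) = ?b (s1 z)" if z: "z \<in> carrier (src Z)" for z
    using s(3)[OF z] mod_hom_closed[OF s(1) z] mod_hom_closed[OF tha z]
    by (simp add: s1_def s2_def mod_hom_minus[OF Y(6,7,8)])
  have \<psi>s2: "snd \<psi> (s2 z) = z" if z: "z \<in> carrier (tgt Z)" for z
  proof -
    note c = mod_hom_closed[OF h(1) z] mod_hom_closed[OF th z] mod_hom_closed[OF bth z]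
      mod_hom_closed[OF s(2) z]
    have "snd \<psi> (?b (t (h z))) = ?a (h z)" using \<psi>(3)[OF c(2)] t(2)[OF c(1)] by simp
    then have "snd \<psi> (s2 z) = snd \<psi> (snd \<sigma> z) \<ominus>\<^bsub>tgt Z\<^esub> (snd \<psi> (snd \<sigma> z) \<ominus>\<^bsub>tgt Z\<^esub> z)"
      using c h(2)[OF z] by (simp add: s2_def mod_hom_minus[OF Y(7) Z(7) \<psi>(2)])
    also have "\<dots> = z"
      using z mod_hom_closed[OF \<psi>(2) c(4)]
      by (simp add: Z2.M.minus_eq Z2.M.minus_add Z2.M.r_neg2)
    finally show ?thesis .
  qed
  note \<psi>s1 = mod_hom_comp'[OF s1 \<psi>(1)]
  have d1: "(\<lambda>z. z \<ominus>\<^bsub>src Z\<^esub> fst \<psi> (s1 z)) \<in> mod_hom \<Lambda> (src Z) (src Z)"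
    by (rule mod_hom_diff[OF Z(6) mod_hom_id \<psi>s1])
  \<comment> \<open>What is still missing on sources takes values in the kernel of
    \<open>?a\<close>, because \<open>s2\<close> is already a section on targets.\<close>
  have "?a (z \<ominus>\<^bsub>src Z\<^esub> fst \<psi> (s1 z)) = \<zero>\<^bsub>tgt Z\<^esub>" if z: "z \<in> carrier (src Z)" for z
  proof -
    have "?a (fst \<psi> (s1 z)) = snd \<psi> (s2 (?a z))"
      using \<psi>(3)[OF mod_hom_closed[OF s1 z]] s12[OF z] by simp
    also have "\<dots> = ?a z" by (rule \<psi>s2[OF mod_hom_closed[OF Z(8) z]])
    finally show ?thesis
      using z mod_hom_closed[OF \<psi>s1 z] mod_hom_closed[OF Z(8) z]
      by (simp add: mod_hom_minus[OF Z(6,7,8)] Z2.minus_eq_iff)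
  qed
  then obtain l where l: "l \<in> mod_hom \<Lambda> (src Z) (src Y)"
    "\<And>z. z \<in> carrier (src Z) \<Longrightarrow> fst \<psi> (l z) = z \<ominus>\<^bsub>src Z\<^esub> fst \<psi> (s1 z)"
    "\<And>z. z \<in> carrier (src Z) \<Longrightarrow> ?b (l z) = \<zero>\<^bsub>tgt Y\<^esub>"
    by (rule kernel_lift[OF Z(2) d1]) (assumption | rule that; assumption)+
  \<comment> \<open>Since \<open>?b (l z)\<close> is zero, adding \<open>l\<close> to
    \<open>s1\<close> keeps the square with \<open>s2\<close> commutative.\<close>
  let ?\<rho> = "(\<lambda>z. s1 z \<oplus>\<^bsub>src Y\<^esub> l z, s2)"
  have "?\<rho> \<in> mor_hom \<Lambda> Z Y"
    using mod_hom_plus[OF Y(6) s1 l(1)] s2 s12 l(3) mod_hom_closed[OF s1] mod_hom_closed[OF l(1)]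
      mod_hom_closed[OF Y(8)]
    by (simp add: mor_hom_def mod_hom_add[OF Y(8)])
  moreover have "fst \<psi> (s1 z \<oplus>\<^bsub>src Y\<^esub> l z) = z" if z: "z \<in> carrier (src Z)" for z
  proof -
    have "fst \<psi> (s1 z \<oplus>\<^bsub>src Y\<^esub> l z) = fst \<psi> (s1 z) \<oplus>\<^bsub>src Z\<^esub> (z \<ominus>\<^bsub>src Z\<^esub> fst \<psi> (s1 z))"
      using mod_hom_closed[OF s1 z] mod_hom_closed[OF l(1) z] l(2)[OF z]
      by (simp add: mod_hom_add[OF \<psi>(1)])
    then show ?thesis
      using z mod_hom_closed[OF \<psi>s1 z] by (simp add: Z1.M.minus_eq Z1.M.a_lcomm Z1.M.r_neg)
  qed
  then have "mor_eq Z (mor_comp \<psi> ?\<rho>) (id, id)" by (simp add: mor_eq_def mor_comp_def \<psi>s2)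
  ultimately have "split_epi_mor \<Lambda> Y \<psi> Z" unfolding split_epi_mor_def by blast
  then show False using ras by (simp add: right_almost_split_P_def)
qed

section \<open>The induced sequence for arbitrary choices of cokernels\<close>

context
  fixes CX :: "('a, 'u) module" and CY :: "('a, 'v) module" and CZ :: "('a, 'w) module"
    and pX :: "'c \<Rightarrow> 'u" and pY :: "'e \<Rightarrow> 'v" and pZ :: "'g \<Rightarrow> 'w" and f :: "'u \<Rightarrow> 'v" and g :: "'v \<Rightarrow> 'w"
  assumes presX: "presents \<Lambda> X pX CX" and presY: "presents \<Lambda> Y pY CY" and presZ: "presents \<Lambda> Z pZ CZ"
    and fg: "fg_module \<Lambda> CX" "fg_module \<Lambda> CY" "fg_module \<Lambda> CZ"
    and f: "f \<in> mod_hom \<Lambda> CX CY" "\<And>x. x \<in> carrier (tgt X) \<Longrightarrow> f (pX x) = pY (snd \<phi> x)"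
    and g: "g \<in> mod_hom \<Lambda> CY CZ" "\<And>y. y \<in> carrier (tgt Y) \<Longrightarrow> g (pY y) = pZ (snd \<psi> y)"
begin

lemmas rX = fg_right_module[OF fg(1)] and rY = fg_right_module[OF fg(2)]
  and rZ = fg_right_module[OF fg(3)]
lemmas pX = presentsD[OF presX] and pY = presentsD[OF presY] and pZ = presentsD[OF presZ]

text \<open>Right exactness: as \<open>\<psi>\<close> is onto on sources, a representative
  \<open>y\<close> of \<open>c\<close> can be corrected by an element of the image of
  \<open>arr Y\<close> so that it lies in the kernel of \<open>\<psi>\<close>, which is the image of
  \<open>\<phi>\<close>.\<close>

lemma cokernel_kernel:
  assumes "c \<in> carrier CY" "g c = \<zero>\<^bsub>CZ\<^esub>"
  shows "\<exists>x\<in>carrier CX. c = f x"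
proof -
  interpret Y2: right_module \<Lambda> "tgt Y" by (rule Y(7))
  interpret Z2: right_module \<Lambda> "tgt Z" by (rule Z(7))
  interpret CY: right_module \<Lambda> CY by (rule rY)
  obtain y where y: "y \<in> carrier (tgt Y)" "c = pY y" using pY(5)[OF assms(1)] by blast
  then have "pZ (snd \<psi> y) = \<zero>\<^bsub>CZ\<^esub>" using assms(2) g(2) by simp
  then obtain z where z: "z \<in> carrier (src Z)" "snd \<psi> y = arr Z z"
    using pZ(4)[OF mod_hom_closed[OF \<psi>(2) y(1)]] by blast
  have "z \<in> fst \<psi> ` carrier (src Y)" unfolding \<psi>_surj by (rule z(1))
  then obtain y1 where y1: "y1 \<in> carrier (src Y)" "z = fst \<psi> y1" by (rule imageE)
  note by1 = mod_hom_closed[OF Y(8) y1(1)]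
  have "snd \<psi> (y \<ominus>\<^bsub>tgt Y\<^esub> arr Y y1) = \<zero>\<^bsub>tgt Z\<^esub>"
    using y(1) by1 z(2) \<psi>(3)[OF y1(1)] y1(2) mod_hom_closed[OF \<psi>(2) y(1)]
    by (simp add: mod_hom_minus[OF Y(7) Z(7) \<psi>(2)] Z2.minus_eq_iff)
  then have "y \<ominus>\<^bsub>tgt Y\<^esub> arr Y y1 \<in> snd \<phi> ` carrier (tgt X)" using y(1) by1 by (simp add: \<phi>_ker)
  then obtain x where x: "x \<in> carrier (tgt X)" "y \<ominus>\<^bsub>tgt Y\<^esub> arr Y y1 = snd \<phi> x" by auto
  have "f (pX x) = pY y \<ominus>\<^bsub>CY\<^esub> \<zero>\<^bsub>CY\<^esub>"
    unfolding f(2)[OF x(1)] x(2)[symmetric]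
    using y(1) by1 pY(3)[OF y1(1)] by (simp add: mod_hom_minus[OF Y(7) rY pY(1)])
  also have "\<dots> = c" using mod_hom_closed[OF pY(1) y(1)] y(2) by (simp add: CY.M.minus_eq)
  finally show ?thesis using mod_hom_closed[OF pX(1) x(1)] by blast
qed

lemma cokernel_composite:
  assumes "c \<in> carrier CX"
  shows "g (f c) = \<zero>\<^bsub>CZ\<^esub>"
proof -
  obtain x where x: "x \<in> carrier (tgt X)" "c = pX x" using pX(5)[OF assms] by blast
  have "snd \<phi> x \<in> snd \<phi> ` carrier (tgt X)" using x(1) by (rule imageI)
  then have "snd \<psi> (snd \<phi> x) = \<zero>\<^bsub>tgt Z\<^esub>" by (simp add: \<phi>_ker)
  then show ?thesis
    using x f(2) g(2)[OF mod_hom_closed[OF \<phi>(2) x(1)]] mod_hom_zero[OF Z(7) rZ pZ(1)] by simp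
qed

lemma cokernel_surj: "g ` carrier CY = carrier CZ"
proof
  show "g ` carrier CY \<subseteq> carrier CZ" using mod_hom_closed[OF g(1)] by blast
  show "carrier CZ \<subseteq> g ` carrier CY"
  proof
    fix c assume "c \<in> carrier CZ"
    then obtain z where z: "z \<in> carrier (tgt Z)" "c = pZ z" using pZ(5) by blast
    then obtain y where y: "y \<in> carrier (tgt Y)" "z = snd \<psi> y" using \<psi>_surj(2) by (metis imageE)
    show "c \<in> g ` carrier CY"
      by (rule image_eqI[OF _ mod_hom_closed[OF pY(1) y(1)]]) (simp add: z y g(2))
  qed
qed

text \<open>In the snake lemma the kernel of \<open>f\<close> is the image of the connecting map,
  which vanishes because the kernel of \<open>arr Y\<close> maps onto that of \<open>arr Z\<close>.
  Concretely \<open>y\<close> is replaced by \<open>y - y'\<close>, which has the same image under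
  \<open>arr Y\<close> and comes from \<open>src X\<close>.\<close>

lemma cokernel_inj:
  assumes c: "c \<in> carrier CX" "f c = \<zero>\<^bsub>CY\<^esub>"
  shows "c = \<zero>\<^bsub>CX\<^esub>"
proof -
  interpret Y1: right_module \<Lambda> "src Y" by (rule Y(6))
  interpret Y2: right_module \<Lambda> "tgt Y" by (rule Y(7))
  interpret Z1: right_module \<Lambda> "src Z" by (rule Z(6))
  obtain x where x: "x \<in> carrier (tgt X)" "c = pX x" using pX(5)[OF c(1)] by blast
  then have "pY (snd \<phi> x) = \<zero>\<^bsub>CY\<^esub>" using c(2) f(2) by simp
  then obtain y where y: "y \<in> carrier (src Y)" "snd \<phi> x = arr Y y"
    using pY(4)[OF mod_hom_closed[OF \<phi>(2) x(1)]] by blast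
  have "snd \<phi> x \<in> snd \<phi> ` carrier (tgt X)" using x(1) by (rule imageI)
  then have "snd \<psi> (snd \<phi> x) = \<zero>\<^bsub>tgt Z\<^esub>" by (simp add: \<phi>_ker)
  then have "arr Z (fst \<psi> y) = \<zero>\<^bsub>tgt Z\<^esub>" using \<psi>(3)[OF y(1)] y(2) by simp
  then obtain y' where y': "y' \<in> carrier (src Y)" "fst \<psi> y' = fst \<psi> y" "arr Y y' = \<zero>\<^bsub>tgt Y\<^esub>"
    by (rule kernel_surj[OF mod_hom_closed[OF \<psi>(1) y(1)]])
  have "fst \<psi> (y \<ominus>\<^bsub>src Y\<^esub> y') = \<zero>\<^bsub>src Z\<^esub>"
    using y(1) y' mod_hom_closed[OF \<psi>(1) y(1)]
    by (simp add: mod_hom_minus[OF Y(6) Z(6) \<psi>(1)] Z1.minus_eq_iff)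
  then have "y \<ominus>\<^bsub>src Y\<^esub> y' \<in> fst \<phi> ` carrier (src X)" using y(1) y'(1) by (simp add: \<phi>_ker)
  then obtain x1 where x1: "x1 \<in> carrier (src X)" "y \<ominus>\<^bsub>src Y\<^esub> y' = fst \<phi> x1" by auto
  have "snd \<phi> (arr X x1) = arr Y y \<ominus>\<^bsub>tgt Y\<^esub> \<zero>\<^bsub>tgt Y\<^esub>"
    unfolding \<phi>(3)[OF x1(1)] x1(2)[symmetric]
    using y(1) y'(1,3) by (simp add: mod_hom_minus[OF Y(6,7,8)])
  also have "\<dots> = snd \<phi> x" using y mod_hom_closed[OF Y(8) y(1)] by (simp add: Y2.M.minus_eq)
  finally have "arr X x1 = x" using inj_onD[OF \<phi>_inj] x(1) mod_hom_closed[OF X(8) x1(1)] by blast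
  then show ?thesis using pX(3)[OF x1(1)] x(2) by simp
qed

lemma cokernel_exact: "short_exact_mod \<Lambda> CX f CY g CZ"
proof -
  have "f ` carrier CX = {c \<in> carrier CY. g c = \<zero>\<^bsub>CZ\<^esub>}"
  proof (intro equalityI subsetI)
    fix c assume "c \<in> f ` carrier CX"
    then show "c \<in> {c \<in> carrier CY. g c = \<zero>\<^bsub>CZ\<^esub>}"
      using mod_hom_closed[OF f(1)] cokernel_composite by auto
  next
    fix c assume "c \<in> {c \<in> carrier CY. g c = \<zero>\<^bsub>CZ\<^esub>}"
    then show "c \<in> f ` carrier CX" using cokernel_kernel[of c] by auto
  qed
  moreover have "inj_on f (carrier CX)" by (rule mod_hom_inj_onI[OF rX rY f(1) cokernel_inj])
  ultimately show ?thesis using fg f(1) g(1) cokernel_surj by (simp add: short_exact_mod_def)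
qed

section \<open>Non-splitting and the almost split properties of the induced maps\<close>

lemma cokernel_not_split_epi: "\<not> split_epi_mod \<Lambda> CY g CZ"
proof
  assume "split_epi_mod \<Lambda> CY g CZ"
  then obtain s where s: "s \<in> mod_hom \<Lambda> CZ CY" "\<forall>y\<in>carrier CZ. g (s y) = y"
    unfolding split_epi_mod_def by (rule bexE)
  interpret Z2: right_module \<Lambda> "tgt Z" by (rule Z(7))
  interpret CZ: right_module \<Lambda> CZ by (rule rZ)
  obtain \<sigma> where \<sigma>: "\<sigma> \<in> mor_hom \<Lambda> Z Y" "\<And>z. z \<in> carrier (tgt Z) \<Longrightarrow> pY (snd \<sigma> z) = s (pZ z)"
    by (rule presentation_lift[OF XYZ(3,2) presZ presY rZ rY s(1)]) (rule that; assumption)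
  note s2 = mor_homD(2)[OF \<sigma>(1)]
  have "snd \<psi> (snd \<sigma> z) \<ominus>\<^bsub>tgt Z\<^esub> z \<in> im_arr Z" if z: "z \<in> carrier (tgt Z)" for z
  proof -
    note c = mod_hom_closed[OF s2 z] mod_hom_closed[OF mod_hom_comp'[OF s2 \<psi>(2)] z]
      mod_hom_closed[OF pZ(1) z]
    have "pZ (snd \<psi> (snd \<sigma> z)) = pZ z" using g(2)[OF c(1)] \<sigma>(2)[OF z] s(2) c(3) by simp
    then have "pZ (snd \<psi> (snd \<sigma> z) \<ominus>\<^bsub>tgt Z\<^esub> z) = \<zero>\<^bsub>CZ\<^esub>"
      using z c by (simp add: mod_hom_minus[OF Z(7) rZ pZ(1)] CZ.minus_eq_iff)
    then show ?thesis using presZ z c(2) by (simp add: presents_def)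
  qed
  then show False by (rule cokernel_identity_absurd[OF \<sigma>(1)])
qed

text \<open>With a retraction \<open>r\<close> of \<open>f\<close>, the map \<open>1 - f r\<close>
  vanishes on the kernel of \<open>g\<close> and so factors as \<open>s g\<close>; then
  \<open>s\<close> is a section of \<open>g\<close>, which has been excluded.\<close>

lemma cokernel_not_split_mono: "\<not> split_mono_mod \<Lambda> CX f CY"
proof
  assume "split_mono_mod \<Lambda> CX f CY"
  then obtain r where r: "r \<in> mod_hom \<Lambda> CY CX" "\<forall>x\<in>carrier CX. r (f x) = x"
    unfolding split_mono_mod_def by (rule bexE)
  interpret CX: right_module \<Lambda> CX by (rule rX)
  interpret CY: right_module \<Lambda> CY by (rule rY)
  interpret CZ: right_module \<Lambda> CZ by (rule rZ)
  note rf = mod_hom_comp'[OF r(1) f(1)]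
  have e: "(\<lambda>y. y \<ominus>\<^bsub>CY\<^esub> f (r y)) \<in> mod_hom \<Lambda> CY CY" by (rule mod_hom_diff[OF rY mod_hom_id rf])
  have "y \<ominus>\<^bsub>CY\<^esub> f (r y) = \<zero>\<^bsub>CY\<^esub>" if y: "y \<in> carrier CY" "g y = \<zero>\<^bsub>CZ\<^esub>" for y
  proof -
    obtain x where x: "x \<in> carrier CX" "y = f x" using cokernel_kernel[OF y] by blast
    then show ?thesis using r(2) mod_hom_closed[OF f(1) x(1)] by (simp add: CY.minus_eq_iff)
  qed
  then obtain s where s: "s \<in> mod_hom \<Lambda> CZ CY" "\<And>y. y \<in> carrier CY \<Longrightarrow> s (g y) = y \<ominus>\<^bsub>CY\<^esub> f (r y)"
    by (rule mod_hom_factor_surj[OF rY rZ rY g(1) cokernel_surj e]) (assumption | rule that; assumption)+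
  have "g (s z) = z" if z: "z \<in> carrier CZ" for z
  proof -
    have "z \<in> g ` carrier CY" unfolding cokernel_surj by (rule z)
    then obtain y where y: "y \<in> carrier CY" "z = g y" by auto
    then show ?thesis
      using s(2) cokernel_composite[OF mod_hom_closed[OF r(1) y(1)]] mod_hom_closed[OF rf y(1)] z
      by (simp add: mod_hom_minus[OF rY rZ g(1)] CZ.M.minus_eq)
  qed
  then show False using split_epi_modI[OF s(1)] cokernel_not_split_epi by blast
qed

text \<open>The test map \<open>u\<close> lifts to a morphism \<open>\<tau>\<close> from a
  presentation of \<open>W\<close> to \<open>Z\<close>. A section of \<open>\<tau>\<close> would
  descend to one of \<open>u\<close>, so \<open>\<tau>\<close> factors through
  \<open>\<psi>\<close>, and this factorization descends as well.\<close>

lemma cokernel_right_almost_split: "right_almost_split_mod \<Lambda> CY g CZ"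
  unfolding right_almost_split_mod_def
proof (intro conjI allI ballI impI cokernel_not_split_epi)
  fix W :: "('a, 'a univ) module" and u
  assume W: "fg_module \<Lambda> W" and u: "u \<in> mod_hom \<Lambda> W CZ" and ns: "\<not> split_epi_mod \<Lambda> W u CZ"
  note rW = fg_right_module[OF W]
  obtain V :: "('a, ('a univ \<Rightarrow> 'a) \<Rightarrow> 'a, 'a univ \<Rightarrow> 'a) mor_obj" and q
    where V: "in_P \<Lambda> V" and presV: "presents \<Lambda> V q W"
    by (rule presentation_exists[OF artin W])
  note q = presentsD[OF presV]
  obtain \<tau> where \<tau>: "\<tau> \<in> mor_hom \<Lambda> V Z" "\<And>x. x \<in> carrier (tgt V) \<Longrightarrow> pZ (snd \<tau> x) = u (q x)"
    by (rule presentation_lift[OF V XYZ(3) presV presZ rW rZ u]) (rule that; assumption)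
  have "\<not> split_epi_mor \<Lambda> V \<tau> Z"
  proof
    assume "split_epi_mor \<Lambda> V \<tau> Z"
    then obtain \<rho> where \<rho>: "\<rho> \<in> mor_hom \<Lambda> Z V" "mor_eq Z (mor_comp \<tau> \<rho>) (id, id)"
      by (auto simp: split_epi_mor_def)
    obtain r where r: "r \<in> mod_hom \<Lambda> CZ W" "\<And>z. z \<in> carrier (tgt Z) \<Longrightarrow> r (pZ z) = q (snd \<rho> z)"
      by (rule presentation_descend[OF XYZ(3) V presZ presV rZ rW \<rho>(1)]) (rule that; assumption)
    have "u (r c) = c" if c: "c \<in> carrier CZ" for c
    proof -
      obtain z where z: "z \<in> carrier (tgt Z)" "c = pZ z" using pZ(5)[OF c] by blast
      have "snd \<tau> (snd \<rho> z) = z" using \<rho>(2) z(1) by (simp add: mor_eq_def mor_comp_def)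
      then show ?thesis
        using z r(2)[OF z(1)] \<tau>(2)[OF mod_hom_closed[OF mor_homD(2)[OF \<rho>(1)] z(1)]] by simp
    qed
    then show False using ns split_epi_modI[OF r(1)] by blast
  qed
  then obtain \<theta> where \<theta>: "\<theta> \<in> mor_hom \<Lambda> V Y" "mor_eq V (mor_comp \<psi> \<theta>) \<tau>"
    by (rule right_almost_split_P_lift[OF ras V \<tau>(1)])
  obtain h where h: "h \<in> mod_hom \<Lambda> W CY" "\<And>x. x \<in> carrier (tgt V) \<Longrightarrow> h (q x) = pY (snd \<theta> x)"
    by (rule presentation_descend[OF V XYZ(2) presV presY rW rY \<theta>(1)]) (rule that; assumption)
  have "g (h w) = u w" if w: "w \<in> carrier W" for w
  proof -
    obtain x where x: "x \<in> carrier (tgt V)" "w = q x" using q(5)[OF w] by blast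
    have "snd \<psi> (snd \<theta> x) = snd \<tau> x" using \<theta>(2) x(1) by (simp add: mor_eq_def mor_comp_def)
    then show ?thesis
      using x h(2)[OF x(1)] g(2)[OF mod_hom_closed[OF mor_homD(2)[OF \<theta>(1)] x(1)]] \<tau>(2)[OF x(1)]
      by simp
  qed
  then show "\<exists>h\<in>mod_hom \<Lambda> W CY. \<forall>w\<in>carrier W. g (h w) = u w"
    by (intro bexI[OF _ h(1)] ballI)
qed

text \<open>Here the presentation of \<open>W\<close> is the target of the lifted morphism, and a
  retraction of that morphism would descend to a retraction of \<open>u\<close>.\<close>

lemma cokernel_left_almost_split: "left_almost_split_mod \<Lambda> CX f CY"
  unfolding left_almost_split_mod_def
proof (intro conjI allI ballI impI cokernel_not_split_mono)
  fix W :: "('a, 'a univ) module" and u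
  assume W: "fg_module \<Lambda> W" and u: "u \<in> mod_hom \<Lambda> CX W" and ns: "\<not> split_mono_mod \<Lambda> CX u W"
  note rW = fg_right_module[OF W]
  obtain V :: "('a, ('a univ \<Rightarrow> 'a) \<Rightarrow> 'a, 'a univ \<Rightarrow> 'a) mor_obj" and q
    where V: "in_P \<Lambda> V" and presV: "presents \<Lambda> V q W"
    by (rule presentation_exists[OF artin W])
  note q = presentsD[OF presV]
  obtain \<tau> where \<tau>: "\<tau> \<in> mor_hom \<Lambda> X V" "\<And>x. x \<in> carrier (tgt X) \<Longrightarrow> q (snd \<tau> x) = u (pX x)"
    by (rule presentation_lift[OF XYZ(1) V presX presV rX rW u]) (rule that; assumption)
  have "\<not> split_mono_mor \<Lambda> X \<tau> V"
  proof
    assume "split_mono_mor \<Lambda> X \<tau> V"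
    then obtain \<rho> where \<rho>: "\<rho> \<in> mor_hom \<Lambda> V X" "mor_eq X (mor_comp \<rho> \<tau>) (id, id)"
      by (auto simp: split_mono_mor_def)
    obtain r where r: "r \<in> mod_hom \<Lambda> W CX" "\<And>x. x \<in> carrier (tgt V) \<Longrightarrow> r (q x) = pX (snd \<rho> x)"
      by (rule presentation_descend[OF V XYZ(1) presV presX rW rX \<rho>(1)]) (rule that; assumption)
    have "r (u c) = c" if c: "c \<in> carrier CX" for c
    proof -
      obtain x where x: "x \<in> carrier (tgt X)" "c = pX x" using pX(5)[OF c] by blast
      have "snd \<rho> (snd \<tau> x) = x" using \<rho>(2) x(1) by (simp add: mor_eq_def mor_comp_def)
      then show ?thesis
        using x \<tau>(2)[OF x(1), symmetric] r(2)[OF mod_hom_closed[OF mor_homD(2)[OF \<tau>(1)] x(1)]] by simp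
    qed
    then show False using ns split_mono_modI[OF r(1)] by blast
  qed
  then obtain \<theta> where \<theta>: "\<theta> \<in> mor_hom \<Lambda> Y V" "mor_eq X (mor_comp \<theta> \<phi>) \<tau>"
    by (rule left_almost_split_P_lift[OF las V \<tau>(1)])
  obtain h where h: "h \<in> mod_hom \<Lambda> CY W" "\<And>y. y \<in> carrier (tgt Y) \<Longrightarrow> h (pY y) = q (snd \<theta> y)"
    by (rule presentation_descend[OF XYZ(2) V presY presV rY rW \<theta>(1)]) (rule that; assumption)
  have "h (f c) = u c" if c: "c \<in> carrier CX" for c
  proof -
    obtain x where x: "x \<in> carrier (tgt X)" "c = pX x" using pX(5)[OF c] by blast
    have "snd \<theta> (snd \<phi> x) = snd \<tau> x" using \<theta>(2) x(1) by (simp add: mor_eq_def mor_comp_def)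
    then show ?thesis
      using x f(2)[OF x(1)] h(2)[OF mod_hom_closed[OF \<phi>(2) x(1)]] \<tau>(2)[OF x(1)] by simp
  qed
  then show "\<exists>h\<in>mod_hom \<Lambda> CY W. \<forall>c\<in>carrier CX. h (f c) = u c"
    by (intro bexI[OF _ h(1)] ballI)
qed

lemma cokernel_almost_split: "almost_split_sequence_mod \<Lambda> CX f CY g CZ"
  using cokernel_exact cokernel_left_almost_split cokernel_right_almost_split
    left_almost_split_indecomposable[OF cokernel_left_almost_split fg(1) rY f(1)]
    right_almost_split_indecomposable[OF cokernel_right_almost_split rY fg(3) g(1)]
  by (simp add: almost_split_sequence_mod_def)

end

end

text \<open>Descent along the presentations gives a homomorphism with the right values on cosets.
  Every element of \<open>Cok X\<close> is a coset, so \<open>Cok_map\<close> coincides with it on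
  the carrier.\<close>

lemma Cok_map_hom:
  assumes X: "in_P R X" and Y: "in_P R Y" and \<sigma>: "\<sigma> \<in> mor_hom R X Y"
  shows "Cok_map Y \<sigma> \<in> mod_hom R (Cok X) (Cok Y)"
proof -
  note HX = in_PD(1)[OF X] and HY = in_PD(1)[OF Y]
  obtain h where h: "h \<in> mod_hom R (Cok X) (Cok Y)"
    "\<And>x. x \<in> carrier (tgt X) \<Longrightarrow> h (im_arr X +>\<^bsub>tgt X\<^esub> x) = im_arr Y +>\<^bsub>tgt Y\<^esub> snd \<sigma> x"
    by (rule presentation_descend[OF X Y Cok_presents[OF HX] Cok_presents[OF HY]
          fg_right_module[OF Cok_fg_module(1)[OF HX]] fg_right_module[OF Cok_fg_module(1)[OF HY]] \<sigma>])
      (rule that; assumption)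
  interpret CX: right_module R "Cok X" by (rule fg_right_module[OF Cok_fg_module(1)[OF HX]])
  have eq: "Cok_map Y \<sigma> c = h c" if c: "c \<in> carrier (Cok X)" for c
  proof -
    obtain x where x: "x \<in> carrier (tgt X)" "c = im_arr X +>\<^bsub>tgt X\<^esub> x"
      using presents_ex[OF Cok_presents[OF HX] c] by blast
    then show ?thesis using Cok_map_coset[OF HX HY \<sigma>] h(2) by simp
  qed
  show ?thesis
    by (rule mod_homI) (simp_all add: eq mod_homD[OF h(1)])
qed

theorem proposition4p9:
  fixes k :: "'k ring" and \<Lambda> :: "'a ring" and \<iota> :: "'k \<Rightarrow> 'a"
    and X :: "('a, 'b, 'c) mor_obj" and Y :: "('a, 'd, 'e) mor_obj" and Z :: "('a, 'f, 'g) mor_obj"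
    and \<phi> :: "('b \<Rightarrow> 'd) \<times> ('c \<Rightarrow> 'e)" and \<psi> :: "('d \<Rightarrow> 'f) \<times> ('e \<Rightarrow> 'g)"
  assumes "artin_algebra k \<Lambda> \<iota>"
    and "almost_split_sequence_P \<Lambda> X \<phi> Y \<psi> Z"
    and "\<not> (\<exists>P :: ('a, 'a univ) module.
              projective_mod \<Lambda> P \<and> indecomposable_mod \<Lambda> P \<and> mor_iso \<Lambda> Z (to_zero P))"
  shows "almost_split_sequence_mod \<Lambda> (Cok X) (Cok_map Y \<phi>) (Cok Y) (Cok_map Z \<psi>) (Cok Z)"
proof -
  have "indecomposable_P \<Lambda> Z" using assms(2) by (simp add: almost_split_sequence_P_def)
  then have nz: "\<not> mod_zero (tgt Z)" using indecomposable_zero_tgt assms(3) by blast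
  note S = sequence_facts[OF assms(1,2) nz]
  note H = in_PD(1)[OF S(1)] in_PD(1)[OF S(2)] in_PD(1)[OF S(3)]
  \<comment> \<open>The coset maps serve as presentations, and the values of \<open>Cok_map\<close>
    on cosets are exactly the compatibility required of \<open>f\<close> and
    \<open>g\<close>.\<close>
  show ?thesis
    by (rule cokernel_almost_split[OF assms(1,2) nz Cok_presents[OF H(1)] Cok_presents[OF H(2)]
          Cok_presents[OF H(3)] Cok_fg_module(1)[OF H(1)] Cok_fg_module(1)[OF H(2)]
          Cok_fg_module(1)[OF H(3)] Cok_map_hom[OF S(1,2,4)] Cok_map_coset[OF H(1,2) S(4)]
          Cok_map_hom[OF S(2,3,5)] Cok_map_coset[OF H(2,3) S(5)]])
qed

end
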